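(* Let $r\geq 2$, $1\leq \ell\leq r$, and for $n\geq\binom{r}{\ell}$ let $(V_1^{(n)},\ldots,V_r^{(n)})$ be uniformly distributed on $H_{\ell,r}(n)$. Then, as $n\to\infty$, \[ \frac{{\rm LCM}(V_1^{(n)},\ldots,V_r^{(n)})}{V_1^{(n)}\cdots V_r^{(n)}}\overset{{\rm d}}{\longrightarrow}\prod_{p\in\mathcal{P}}p^{\max_{k=1,\ldots,r}\mathcal{G}_k(p)-\sum_{k=1}^r\mathcal{G}_k(p)}, \] \[ \frac{{\rm LCM}(V_1^{(n)},\ldots,V_r^{(n)})}{n^{r/\ell}}\overset{{\rm d}}{\longrightarrow}U_{\ell,r}\prod_{p\in\mathcal{P}}p^{\max_{k=1,\ldots,r}\mathcal{G}_k(p)-\sum_{k=1}^r\mathcal{G}_k(p)}, \] where $U_{\ell,r}$ is independent of all $\mathcal{G}_k(p)$. Moreover, in both convergences, all power moments of positive order converge to the corresponding moments of the limit random variables.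
   Context: $P_\ell(x_1,\ldots,x_r)=\sum_{1\leq i_1<\cdots<i_\ell\leq r}x_{i_1}\cdots x_{i_\ell}$; $H_{\ell,r}(n)=\{(i_1,\ldots,i_r)\in\mathbb{N}^r: P_\ell(i_1,\ldots,i_r)\leq n\}$, $\mathbb{N}=\{1,2,\ldots\}$. $\mathcal{P}$ is the set of primes; $(\mathcal{G}_k(p))_{k\in\mathbb{N},p\in\mathcal{P}}$ are mutually independent with $\mathbb{P}\{\mathcal{G}_k(p)=j\}=(1-1/p)p^{-j}$, $j\geq 0$. If $\ell=r$, $U_{r,r}$ is uniform on $[0,1]$. If $\ell<r$, $\mathcal{V}_{\ell,r}$ denotes the (finite) Lebesgue measure of $\{y\in[0,\infty)^r:P_\ell(y)\leq 1\}$ and $U_{\ell,r}$ has distribution function $\mathbb{P}\{U_{\ell,r}\leq x\}=\mathcal{V}_{\ell,r}^{-1}\int_{[0,\infty)^r}\mathbbm{1}_{\{P_\ell(y)\leq 1,\,y_1\cdots y_r\leq x\}}{\rm d}y$ for $x\in[0,\binom{r}{\ell}^{-r/\ell}]$. *)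

theory Defs
  imports "HOL-Probability.Probability" "HOL-Computational_Algebra.Primes"
begin

definition esym :: "nat \<Rightarrow> nat \<Rightarrow> (nat \<Rightarrow> 'a::comm_semiring_1) \<Rightarrow> 'a" where
  "esym l r x = (\<Sum>S | S \<subseteq> {1..r} \<and> card S = l. \<Prod>i\<in>S. x i)"

definition hyp_set :: "nat \<Rightarrow> nat \<Rightarrow> nat \<Rightarrow> (nat \<Rightarrow> nat) set" where
  "hyp_set l r n = {v \<in> {1..r} \<rightarrow>\<^sub>E {1..}. esym l r v \<le> n}"

definition uniform_on_hyp ::
    "nat \<Rightarrow> nat \<Rightarrow> nat \<Rightarrow> 'a measure \<Rightarrow> (nat \<Rightarrow> 'a \<Rightarrow> nat) \<Rightarrow> bool" where
  "uniform_on_hyp l r n M V \<longleftrightarrow>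
     (\<forall>k\<in>{1..r}. V k \<in> M \<rightarrow>\<^sub>M count_space UNIV) \<and>
     distr M (count_space UNIV) (\<lambda>\<omega>. \<lambda>k\<in>{1..r}. V k \<omega>) = measure_pmf (pmf_of_set (hyp_set l r n))"

definition geometric_family :: "'b measure \<Rightarrow> (nat \<Rightarrow> nat \<Rightarrow> 'b \<Rightarrow> nat) \<Rightarrow> bool" where
  "geometric_family N G \<longleftrightarrow>
     prob_space.indep_vars N (\<lambda>_. count_space UNIV) (\<lambda>(k, p). G k p) ({1..} \<times> {p. prime p}) \<and>
     (\<forall>k\<ge>1. \<forall>p j. prime p \<longrightarrow>
        measure N {\<omega> \<in> space N. G k p \<omega> = j} = (1 - 1 / real p) * (1 / real p) ^ j)"

definition vol_below :: "nat \<Rightarrow> nat \<Rightarrow> real \<Rightarrow> real" where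
  "vol_below l r x = (\<integral>y. indicator
     {y. (\<forall>i\<in>{1..r}. 0 \<le> y i) \<and> esym l r y \<le> 1 \<and> (\<Prod>i=1..r. y i) \<le> x} y
     \<partial>(\<Pi>\<^sub>M i\<in>{1..r}. (lborel :: real measure)))"

definition vol_total :: "nat \<Rightarrow> nat \<Rightarrow> real" where
  "vol_total l r = measure (\<Pi>\<^sub>M i\<in>{1..r}. (lborel :: real measure))
     {y \<in> {1..r} \<rightarrow>\<^sub>E {0..}. esym l r y \<le> 1}"

text \<open>For \<open>l < r\<close> the product of the coordinates is at most
  \<open>(r choose l) powr (- r / l)\<close> on the region measured by \<open>vol_total\<close> (Maclaurin), so the
  distribution function reaches 1 at the right end point and the law is determined by its
  values on this interval.\<close>

definition has_U_law :: "nat \<Rightarrow> nat \<Rightarrow> 'b measure \<Rightarrow> ('b \<Rightarrow> real) \<Rightarrow> bool" where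
  "has_U_law l r N U \<longleftrightarrow> U \<in> borel_measurable N \<and>
     (if l = r then distr N borel U = uniform_measure lborel {0..1}
      else (\<forall>x\<in>{0..real (r choose l) powr (- (real r / real l))}.
              measure N {\<omega> \<in> space N. U \<omega> \<le> x} = vol_below l r x / vol_total l r))"

text \<open>The library's \<open>indep_var\<close> needs both variables to have the same type, so independence of the
  real variable \<open>U\<close> and the whole integer-valued family is stated through the generated
  sigma-algebras.\<close>

definition indep_of_family :: "'b measure \<Rightarrow> ('b \<Rightarrow> real) \<Rightarrow> (nat \<Rightarrow> nat \<Rightarrow> 'b \<Rightarrow> nat) \<Rightarrow> bool" where
  "indep_of_family N U G \<longleftrightarrow>
     (let I = {1..} \<times> {p. prime p} in
      prob_space.indep_set N
        (sets (vimage_algebra (space N) U borel))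
        (sets (vimage_algebra (space N) (\<lambda>\<omega>. \<lambda>(k, p)\<in>I. G k p \<omega>)
           (\<Pi>\<^sub>M i\<in>I. count_space UNIV))))"

text \<open>The exponents are nonpositive and, for \<open>r \<ge> 2\<close>, almost surely only finitely many
  of them are nonzero; on the exceptional null set \<open>prodinf\<close> has a fixed unspecified value.\<close>

definition prime_prod :: "nat \<Rightarrow> (nat \<Rightarrow> nat \<Rightarrow> 'b \<Rightarrow> nat) \<Rightarrow> 'b \<Rightarrow> real" where
  "prime_prod r G \<omega> = prodinf (\<lambda>p. if prime p
     then real p powi (int (MAX k\<in>{1..r}. G k p \<omega>) - int (\<Sum>k=1..r. G k p \<omega>)) else 1)"

text \<open>The variables \<open>X n\<close> may live on different probability spaces \<open>M n\<close>, and only large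
  \<open>n\<close> matter.\<close>

definition conv_in_distr ::
    "(nat \<Rightarrow> 'a measure) \<Rightarrow> (nat \<Rightarrow> 'a \<Rightarrow> real) \<Rightarrow> 'b measure \<Rightarrow> ('b \<Rightarrow> real) \<Rightarrow> bool" where
  "conv_in_distr M X N Y \<longleftrightarrow>
     (\<forall>\<^sub>F n in sequentially. X n \<in> borel_measurable (M n)) \<and> Y \<in> borel_measurable N \<and>
     weak_conv_m (\<lambda>n. distr (M n) borel (X n)) (distr N borel Y)"

text \<open>Integrability is included because the Bochner integral of a non-integrable function is 0.\<close>

definition moments_converge ::
    "(nat \<Rightarrow> 'a measure) \<Rightarrow> (nat \<Rightarrow> 'a \<Rightarrow> real) \<Rightarrow> 'b measure \<Rightarrow> ('b \<Rightarrow> real) \<Rightarrow> bool" where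
  "moments_converge M X N Y \<longleftrightarrow> (\<forall>s>0.
     (\<forall>\<^sub>F n in sequentially. integrable (M n) (\<lambda>\<omega>. X n \<omega> powr s)) \<and>
     integrable N (\<lambda>\<omega>. Y \<omega> powr s) \<and>
     (\<lambda>n. \<integral>\<omega>. X n \<omega> powr s \<partial>M n) \<longlonglongrightarrow> (\<integral>\<omega>. Y \<omega> powr s \<partial>N))"

end

theory Submission
  imports Defs
begin

text \<open>
  The sets \<open>H\<^sub>l\<^sub>,\<^sub>r(n)\<close>, also when intersected with \<open>{v. v\<^sub>1 \<cdots> v\<^sub>r \<le> x n\<^bsup>r/l\<^esup>}\<close>, are closed under
  decreasing a coordinate. In such a set, imposing \<open>d dvd v\<^sub>k\<close> divides the cardinality by \<open>d\<close> up to an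
  error bounded by the number of points with \<open>v\<^sub>k = 1\<close>, and never leaves more than the \<open>d\<close>-th part.
  The points with \<open>v\<^sub>k = 1\<close> have vanishing relative frequency: for \<open>l = r\<close> by comparison of harmonic
  sums, for \<open>l < r\<close> by dominated convergence after rescaling by \<open>n\<^bsup>-1/l\<^esup>\<close>, which also yields the limit
  law of the rescaled product; for \<open>l = r\<close> the latter is uniform because
  \<open>\<lfloor>x a\<rfloor>\<close> and \<open>x \<lfloor>a\<rfloor>\<close> differ by at most 1 in every fibre.

  Hence the \<open>p\<close>-adic valuations of the coordinates at finitely many primes are asymptotically independent
  geometric variables that are also independent of the rescaled product. A prime contributes to
  \<open>lcm / product\<close> only if it divides two coordinates, which has probability at most
  \<open>r\<^sup>2 / p\<^sup>2\<close> uniformly in \<open>n\<close>, so the primes above \<open>K\<close> matter with probability at most \<open>r\<^sup>2 / K\<close>. This gives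
  convergence of the distribution functions, and all variables lie in \<open>[0, 1]\<close>, so moments follow.
\<close>

section \<open>Sets closed under decreasing a coordinate\<close>

text \<open>Both distribution functions are frequencies of one kind of event,
  \<open>prod <= phi (lcm / prod) * n powr (r / l)\<close>. Since
  \<open>0 < prod <= n powr (r / l)\<close>, an indicator \<open>phi\<close> gives the first ratio,
  and \<open>phi z = max 0 (x / z)\<close> gives the second. Up to late primes, the argument of
  \<open>phi\<close> is a function of finitely many valuations; up to small probability these take
  finitely many values, and for each value the threshold is a constant. So the joint law of product
  and valuations suffices, \<open>phi\<close> may be discontinuous, and convergence holds at every
  \<open>x\<close>, even at atoms of the prime product. This is why the bound on the product is
  built into the counted sets: they obey the same divisibility estimate, and the factor lost to
  divisibility does not depend on \<open>x\<close>, which is the asymptotic independence. The cases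
  \<open>l = r\<close> and \<open>l < r\<close> part because for \<open>l = r\<close> the limiting
  region has infinite volume, so rescaling has no integrable majorant. There one logarithm decides:
  the faces have order at most \<open>n * ln n ^ (r - 2)\<close>, the whole set at least
  \<open>n * ln n ^ (r - 1)\<close>.\<close>

definition lower_at :: "'i \<Rightarrow> ('i \<Rightarrow> nat) set \<Rightarrow> bool" where
  "lower_at i A \<longleftrightarrow> (\<forall>v\<in>A. 1 \<le> v i \<and> (\<forall>t. 1 \<le> t \<longrightarrow> t \<le> v i \<longrightarrow> v(i := t) \<in> A))"

lemma lower_atD: "lower_at i A \<Longrightarrow> v \<in> A \<Longrightarrow> 1 \<le> t \<Longrightarrow> t \<le> v i \<Longrightarrow> v(i := t) \<in> A"
  by (auto simp: lower_at_def)

lemma lower_at_ge1: "lower_at i A \<Longrightarrow> v \<in> A \<Longrightarrow> 1 \<le> v i"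
  by (auto simp: lower_at_def)

lemma finite_fiber:
  assumes "finite A" shows "finite {t. u(i := t) \<in> A}"
proof (rule finite_imageD)
  show "finite ((\<lambda>t. u(i := t)) ` {t. u(i := t) \<in> A})"
    by (rule finite_subset[OF _ assms]) auto
  show "inj_on (\<lambda>t. u(i := t)) {t. u(i := t) \<in> A}"
    by (rule inj_onI) (metis fun_upd_same)
qed

text \<open>Lowering coordinate \<open>i\<close> to 1 stays inside \<open>A\<close>, so the points
  with \<open>u i = 1\<close> index the lines in direction \<open>i\<close> that meet
  \<open>A\<close>. The divisibility counts are done line by line.\<close>

lemma card_eq_sum_fibers:
  assumes A: "finite A" "lower_at i A"
  shows "card {v\<in>A. P v} = (\<Sum>u | u \<in> A \<and> u i = 1. card {t. u(i := t) \<in> A \<and> P (u(i := t))})"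
proof -
  let ?A1 = "{u\<in>A. u i = 1}"
  have fin: "finite {t. u(i := t) \<in> A \<and> P (u(i := t))}" for u
    by (rule finite_subset[OF _ finite_fiber[OF A(1), of u i]]) auto
  have "bij_betw (\<lambda>(u, t). u(i := t)) (SIGMA u:?A1. {t. u(i := t) \<in> A \<and> P (u(i := t))}) {v\<in>A. P v}"
  proof (rule bij_betw_byWitness[where f' = "\<lambda>v. (v(i := 1), v i)"])
    show "(\<lambda>v. (v(i := 1), v i)) ` {v \<in> A. P v}
        \<subseteq> (SIGMA u:?A1. {t. u(i := t) \<in> A \<and> P (u(i := t))})"
      using lower_atD[OF A(2), of _ 1] lower_at_ge1[OF A(2)] by auto
  qed (auto simp: fun_upd_idem)
  then have "card {v\<in>A. P v} = card (SIGMA u:?A1. {t. u(i := t) \<in> A \<and> P (u(i := t))})"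
    by (rule bij_betw_same_card[symmetric])
  also have "\<dots> = (\<Sum>u\<in>?A1. card {t. u(i := t) \<in> A \<and> P (u(i := t))})"
    using A(1) fin by (subst card_SigmaI) auto
  finally show ?thesis .
qed

lemma fiber_eq_interval:
  assumes A: "finite A" "lower_at i A" and u: "u \<in> A"
  obtains K where "1 \<le> K" "{t. u(i := t) \<in> A} = {1..K}"
proof -
  let ?S = "{t. u(i := t) \<in> A}"
  have fin: "finite ?S" by (rule finite_fiber[OF A(1)])
  have ne: "u i \<in> ?S" using u by simp
  have "?S = {1..Max ?S}"
  proof (intro subset_antisym subsetI)
    fix t assume t: "t \<in> ?S"
    then have "1 \<le> t" using lower_at_ge1[OF A(2), of "u(i := t)"] by simp
    then show "t \<in> {1..Max ?S}" using fin t by simp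
  next
    fix t assume t: "t \<in> {1..Max ?S}"
    have "Max ?S \<in> ?S" using ne by (intro Max_in[OF fin]) blast
    then have "u(i := Max ?S) \<in> A" by simp
    from lower_atD[OF A(2) this, of t] t show "t \<in> ?S" by simp
  qed
  moreover have "1 \<le> Max ?S"
    using fin ne lower_at_ge1[OF A(2) u] by (meson Max_ge le_trans)
  ultimately show ?thesis using that by blast
qed

lemma card_multiples:
  assumes "1 \<le> (d::nat)" shows "card {t\<in>{1..K}. d dvd t} = K div d"
proof -
  have "{t\<in>{1..K}. d dvd t} = (\<lambda>j. d * j) ` {1..K div d}"
  proof (intro subset_antisym subsetI)
    fix t assume "t \<in> {t\<in>{1..K}. d dvd t}"
    then obtain j where "t = d * j" "1 \<le> t" "t \<le> K" by auto
    then show "t \<in> (\<lambda>j. d * j) ` {1..K div d}"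
      using assms by (auto simp: less_eq_div_iff_mult_less_eq mult.commute intro!: imageI)
  next
    fix t assume "t \<in> (\<lambda>j. d * j) ` {1..K div d}"
    then show "t \<in> {t\<in>{1..K}. d dvd t}"
      using assms by (auto simp: less_eq_div_iff_mult_less_eq mult.commute)
  qed
  moreover have "inj_on (\<lambda>j. d * j) {1..K div d}"
    using assms by (auto intro!: inj_onI)
  ultimately show ?thesis by (simp add: card_image)
qed

text \<open>The fibre is an interval starting at 1, so the number of multiples is
  \<open>K div d\<close>. The slack \<open>d\<close> does not depend on \<open>K\<close>: divided by
  \<open>d\<close>, it is one point per fibre.\<close>

lemma card_fiber_dvd:
  assumes A: "finite A" "lower_at i A" and u: "u \<in> A" and d: "1 \<le> d"
  shows "d * card {t. u(i := t) \<in> A \<and> d dvd t} \<le> card {t. u(i := t) \<in> A}"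
    and "card {t. u(i := t) \<in> A} \<le> d * card {t. u(i := t) \<in> A \<and> d dvd t} + d"
proof -
  obtain K where K: "{t. u(i := t) \<in> A} = {1..K}" using fiber_eq_interval[OF A u] by metis
  have "{t. u(i := t) \<in> A \<and> d dvd t} = {t\<in>{1..K}. d dvd t}" unfolding K[symmetric] by simp
  then have c: "card {t. u(i := t) \<in> A \<and> d dvd t} = K div d" using card_multiples[OF d] by simp
  show "d * card {t. u(i := t) \<in> A \<and> d dvd t} \<le> card {t. u(i := t) \<in> A}"
    using K c by simp
  have "K = d * (K div d) + K mod d" by simp
  moreover have "K mod d \<le> d" using d by (simp add: less_imp_le)
  ultimately show "card {t. u(i := t) \<in> A} \<le> d * card {t. u(i := t) \<in> A \<and> d dvd t} + d"
    unfolding c K by (simp; linarith)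
qed

lemma card_coord_dvd_upper:
  assumes A: "finite A" "lower_at i A" and d: "1 \<le> d"
  shows "d * card {v\<in>A. d dvd v i} \<le> card A"
  using card_eq_sum_fibers[OF A, of "\<lambda>v. d dvd v i"] card_eq_sum_fibers[OF A, of "\<lambda>v. True"]
  by (auto simp: sum_distrib_left intro!: sum_mono card_fiber_dvd[OF A _ d])

text \<open>There is one fibre for each point with \<open>v i = 1\<close>, so the slack
  \<open>d\<close> per fibre adds up to \<open>d\<close> times the size of that face.\<close>

lemma card_coord_dvd_lower:
  assumes A: "finite A" "lower_at i A" and d: "1 \<le> d"
  shows "card A \<le> d * (card {v\<in>A. d dvd v i} + card {v\<in>A. v i = 1})"
proof -
  have "card A = (\<Sum>u | u \<in> A \<and> u i = 1. card {t. u(i := t) \<in> A})"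
    using card_eq_sum_fibers[OF A, of "\<lambda>v. True"] by simp
  also have "\<dots> \<le> (\<Sum>u | u \<in> A \<and> u i = 1. d * card {t. u(i := t) \<in> A \<and> d dvd t} + d)"
    by (auto intro!: sum_mono card_fiber_dvd[OF A _ d])
  also have "\<dots> = d * (card {v\<in>A. d dvd v i} + card {v\<in>A. v i = 1})"
    using card_eq_sum_fibers[OF A, of "\<lambda>v. d dvd v i"]
    by (simp add: sum.distrib sum_distrib_left algebra_simps)
  finally show ?thesis .
qed

text \<open>The conditions are imposed one coordinate at a time. The bound is free of
  \<open>d\<close>, so only the faces \<open>v k = 1\<close> have to be small.\<close>

lemma card_coords_dvd:
  assumes A: "finite A" and J: "finite J" and low: "\<And>i. i \<in> J \<Longrightarrow> lower_at i A"
    and d: "\<And>i. i \<in> J \<Longrightarrow> 1 \<le> d i"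
  shows "\<bar>real (card {v\<in>A. \<forall>k\<in>J. d k dvd v k}) - real (card A) / (\<Prod>k\<in>J. real (d k))\<bar>
           \<le> (\<Sum>k\<in>J. real (card {v\<in>A. v k = 1}))"
  using J low d
proof (induction J rule: finite_induct)
  case empty
  then show ?case by simp
next
  case (insert i J)
  let ?B = "{v\<in>A. \<forall>k\<in>J. d k dvd v k}"
  let ?C = "{v\<in>A. \<forall>k\<in>insert i J. d k dvd v k}"
  define P where "P = (\<Prod>k\<in>J. real (d k))"
  have B: "finite ?B" using A by simp
  \<comment> \<open>The conditions in \<open>?B\<close> concern coordinates other than
    \<open>i\<close>, so lowering coordinate \<open>i\<close> preserves them.\<close>
  have lB: "lower_at i ?B"
    using insert.prems(1)[of i] insert.hyps(2) unfolding lower_at_def by auto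
  have d1: "1 \<le> d i" using insert.prems by simp
  have C: "?C = {v\<in>?B. d i dvd v i}" by auto
  have "d i * card ?C \<le> card ?B" unfolding C by (rule card_coord_dvd_upper[OF B lB d1])
  then have "real (d i) * real (card ?C) \<le> real (card ?B)"
    unfolding of_nat_mult[symmetric] of_nat_le_iff .
  then have up: "real (card ?C) \<le> real (card ?B) / real (d i)"
    using d1 by (simp add: field_simps)
  have "card ?B \<le> d i * (card ?C + card {v\<in>?B. v i = 1})"
    unfolding C by (rule card_coord_dvd_lower[OF B lB d1])
  also have "\<dots> \<le> d i * (card ?C + card {v\<in>A. v i = 1})"
    using A by (intro mult_le_mono2 add_left_mono card_mono) auto
  finally have "real (card ?B) \<le> real (d i) * (real (card ?C) + real (card {v\<in>A. v i = 1}))"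
    unfolding of_nat_mult[symmetric] of_nat_add[symmetric] of_nat_le_iff .
  then have lo: "real (card ?B) / real (d i) \<le> real (card ?C) + real (card {v\<in>A. v i = 1})"
    using d1 by (simp add: field_simps)
  have IH: "\<bar>real (card ?B) - real (card A) / P\<bar> \<le> (\<Sum>k\<in>J. real (card {v\<in>A. v k = 1}))"
    unfolding P_def using insert by auto
  \<comment> \<open>The error inherited from \<open>J\<close> is divided by \<open>d i >= 1\<close>,
    so the errors add up and are never multiplied.\<close>
  have "\<bar>real (card ?B) / real (d i) - real (card A) / (real (d i) * P)\<bar>
      = \<bar>real (card ?B) - real (card A) / P\<bar> / real (d i)"
  proof -
    have "real (card ?B) / real (d i) - real (card A) / (real (d i) * P)
        = (real (card ?B) - real (card A) / P) / real (d i)"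
      by (simp add: diff_divide_distrib mult.commute)
    then show ?thesis by (simp add: abs_divide)
  qed
  also have "\<dots> \<le> \<bar>real (card ?B) - real (card A) / P\<bar>"
    using d1 by (simp add: divide_le_eq mult_le_cancel_left1)
  finally have "\<bar>real (card ?B) / real (d i) - real (card A) / (real (d i) * P)\<bar>
      \<le> (\<Sum>k\<in>J. real (card {v\<in>A. v k = 1}))" using IH by linarith
  moreover have p: "(\<Prod>k\<in>insert i J. real (d k)) = real (d i) * P"
    unfolding P_def using insert by simp
  moreover have "(\<Sum>k\<in>insert i J. real (card {v\<in>A. v k = 1}))
      = real (card {v\<in>A. v i = 1}) + (\<Sum>k\<in>J. real (card {v\<in>A. v k = 1}))"
    using insert by simp
  ultimately show ?case using up lo unfolding p by linarith
qed

text \<open>Only the one-sided bound is iterated, and it has no error term. Hence the factor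
  \<open>1 / d^2\<close> survives a sum over a range of \<open>d\<close> that grows with
  \<open>n\<close>.\<close>

lemma card_two_coords_dvd:
  assumes A: "finite A" "lower_at i A" "lower_at j A" and ij: "i \<noteq> j" and d: "1 \<le> d"
  shows "d\<^sup>2 * card {v\<in>A. d dvd v i \<and> d dvd v j} \<le> card A"
proof -
  let ?B = "{v\<in>A. d dvd v i}"
  have "lower_at j ?B" using A(3) ij unfolding lower_at_def by auto
  then have "d * card {v\<in>?B. d dvd v j} \<le> card ?B"
    using A(1) d by (intro card_coord_dvd_upper) auto
  moreover have "{v\<in>?B. d dvd v j} = {v\<in>A. d dvd v i \<and> d dvd v j}" by auto
  ultimately have "d * (d * card {v\<in>A. d dvd v i \<and> d dvd v j}) \<le> d * card ?B" by simp
  also have "\<dots> \<le> card A" by (rule card_coord_dvd_upper[OF A(1,2) d])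
  finally show ?thesis by (simp add: power2_eq_square mult.assoc)
qed

section \<open>Elementary symmetric polynomials\<close>

text \<open>Taken over arbitrary index sets because the volume estimate and the null set argument
  split off one coordinate.\<close>

definition esym_on :: "'i set \<Rightarrow> nat \<Rightarrow> ('i \<Rightarrow> 'a::comm_semiring_1) \<Rightarrow> 'a" where
  "esym_on I l x = (\<Sum>S | S \<subseteq> I \<and> card S = l. \<Prod>i\<in>S. x i)"

lemma esym_eq_esym_on: "esym l r x = esym_on {1..r} l x"
  by (simp add: esym_def esym_on_def)



lemma esym_on_insert:
  assumes J: "finite J" "i \<notin> J"
  shows "esym_on (insert i J) (Suc l) x = esym_on J (Suc l) x + x i * esym_on J l x"
proof -
  let ?X = "{S. S \<subseteq> J \<and> card S = Suc l}" and ?Y = "{S. S \<subseteq> J \<and> card S = l}"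
  have fin: "finite ?X" "finite ?Y" using J by auto
  have eq: "{S. S \<subseteq> insert i J \<and> card S = Suc l} = ?X \<union> insert i ` ?Y" (is "?L = ?R")
  proof (intro subset_antisym subsetI)
    fix S assume S: "S \<in> ?L"
    then have fS: "finite S" using J by (auto intro: finite_subset)
    show "S \<in> ?R"
    proof (cases "i \<in> S")
      case True
      then have "S = insert i (S - {i})" "S - {i} \<in> ?Y" using S fS by auto
      then show ?thesis by blast
    qed (use S in auto)
  next
    fix S assume "S \<in> ?R"
    then show "S \<in> ?L"
    proof
      assume "S \<in> insert i ` ?Y"
      then obtain T where T: "S = insert i T" "T \<subseteq> J" "card T = l" by auto
      moreover have "finite T" "i \<notin> T" using T J by (auto intro: finite_subset)
      ultimately show ?thesis by auto
    qed auto
  qed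
  have inj: "inj_on (insert i) ?Y" using J by (auto intro!: inj_onI)
  have "esym_on (insert i J) (Suc l) x = (\<Sum>S\<in>?X. \<Prod>k\<in>S. x k) + (\<Sum>S\<in>insert i ` ?Y. \<Prod>k\<in>S. x k)"
    unfolding esym_on_def eq using fin J by (subst sum.union_disjoint) auto
  also have "(\<Sum>S\<in>insert i ` ?Y. \<Prod>k\<in>S. x k) = (\<Sum>S\<in>?Y. x i * (\<Prod>k\<in>S. x k))"
  proof (subst sum.reindex[OF inj], rule sum.cong)
    fix S assume S: "S \<in> ?Y"
    then have "finite S" "i \<notin> S" using J by (auto intro: finite_subset)
    then show "((\<lambda>S. \<Prod>k\<in>S. x k) \<circ> insert i) S = x i * (\<Prod>k\<in>S. x k)" by simp
  qed simp
  finally show ?thesis by (simp add: esym_on_def sum_distrib_left)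
qed

lemma esym_on_remove:
  assumes "finite I" "i \<in> I"
  shows "esym_on I (Suc l) x = esym_on (I - {i}) (Suc l) x + x i * esym_on (I - {i}) l x"
  using esym_on_insert[of "I - {i}" i l x] assms by (simp add: insert_absorb)

lemma esym_on_cong: "(\<And>i. i \<in> I \<Longrightarrow> x i = y i) \<Longrightarrow> esym_on I l x = esym_on I l y"
  unfolding esym_on_def by (intro sum.cong prod.cong) auto

lemma esym_on_mono:
  fixes x y :: "'i \<Rightarrow> 'a::linordered_semidom"
  assumes "\<And>i. i \<in> I \<Longrightarrow> 0 \<le> x i" "\<And>i. i \<in> I \<Longrightarrow> x i \<le> y i"
  shows "esym_on I l x \<le> esym_on I l y"
  unfolding esym_on_def by (intro sum_mono prod_mono conjI) (auto intro: assms)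

lemma esym_on_nonneg:
  fixes x :: "'i \<Rightarrow> 'a::linordered_semidom"
  assumes "\<And>i. i \<in> I \<Longrightarrow> 0 \<le> x i"
  shows "0 \<le> esym_on I l x"
  unfolding esym_on_def by (intro sum_nonneg prod_nonneg) (auto intro: assms)

lemma prod_le_esym_on:
  fixes x :: "'i \<Rightarrow> 'a::linordered_semidom"
  assumes "finite I" "S \<subseteq> I" "\<And>i. i \<in> I \<Longrightarrow> 0 \<le> x i"
  shows "(\<Prod>i\<in>S. x i) \<le> esym_on I (card S) x"
proof -
  have "(\<Sum>T\<in>{S}. \<Prod>i\<in>T. x i) \<le> esym_on I (card S) x"
    unfolding esym_on_def using assms
    by (intro sum_mono2 prod_nonneg) (auto intro: assms(3))
  then show ?thesis by simp
qed

lemma esym_on_pos: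
  fixes x :: "'i \<Rightarrow> 'a::linordered_semidom"
  assumes "finite I" "l \<le> card I" "\<And>i. i \<in> I \<Longrightarrow> 0 < x i"
  shows "0 < esym_on I l x"
proof -
  obtain S where S: "S \<subseteq> I" "card S = l" using assms obtain_subset_with_card_n by metis
  have "0 < (\<Prod>i\<in>S. x i)" using S assms by (intro prod_pos) auto
  also have "\<dots> \<le> esym_on I l x"
    using prod_le_esym_on[OF assms(1) S(1), of x] assms(3) S by (simp add: less_imp_le)
  finally show ?thesis .
qed

lemma esym_on_const:
  assumes "finite I" shows "esym_on I l (\<lambda>_. c) = of_nat (card I choose l) * c ^ l"
proof -
  have "esym_on I l (\<lambda>_. c) = (\<Sum>S | S \<subseteq> I \<and> card S = l. c ^ l)"
    unfolding esym_on_def by (intro sum.cong) auto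
  then show ?thesis using n_subsets[OF assms] by simp
qed

lemma esym_on_scale: "esym_on I l (\<lambda>i. c * x i) = c ^ l * esym_on I l x"
  unfolding esym_on_def sum_distrib_left
  by (intro sum.cong) (auto simp: prod.distrib)

lemma esym_on_card: "finite I \<Longrightarrow> esym_on I (card I) x = (\<Prod>i\<in>I. x i)"
proof -
  assume "finite I"
  then have "{S. S \<subseteq> I \<and> card S = card I} = {I}" by (auto dest: card_subset_eq)
  then show ?thesis by (simp add: esym_on_def)
qed

text \<open>AM-GM in logarithmic form, from \<open>ln t <= t - 1\<close> at
  \<open>t = f i / m\<close> with \<open>m\<close> the mean: the right-hand sides add up to
  0.\<close>

lemma sum_ln_le_card_ln_mean:
  fixes f :: "'i \<Rightarrow> real"
  assumes "finite A" "A \<noteq> {}" "\<And>i. i \<in> A \<Longrightarrow> 0 < f i"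
  shows "(\<Sum>i\<in>A. ln (f i)) \<le> card A * ln ((\<Sum>i\<in>A. f i) / card A)"
proof -
  define m where "m = (\<Sum>i\<in>A. f i) / card A"
  have c: "0 < real (card A)" using assms by (simp add: card_gt_0_iff)
  have s: "0 < (\<Sum>i\<in>A. f i)" using assms by (intro sum_pos) auto
  have m: "0 < m" using c s by (simp add: m_def)
  have "(\<Sum>i\<in>A. ln (f i) - ln m) \<le> (\<Sum>i\<in>A. f i / m - 1)"
  proof (rule sum_mono)
    fix i assume "i \<in> A"
    then have "0 < f i" by (rule assms)
    then have "ln (f i / m) \<le> f i / m - 1" using m by (intro ln_le_minus_one) auto
    then show "ln (f i) - ln m \<le> f i / m - 1" using m \<open>0 < f i\<close> by (simp add: ln_div)
  qed
  also have "\<dots> = (\<Sum>i\<in>A. f i) / m - card A" by (simp add: sum_subtractf sum_divide_distrib)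
  also have "\<dots> = 0" using c s by (simp add: m_def)
  finally show ?thesis by (simp add: sum_subtractf m_def)
qed

lemma card_subsets_containing:
  assumes "finite I" "i \<in> I"
  shows "card {S. S \<subseteq> I \<and> card S = Suc l \<and> i \<in> S} = (card I - 1) choose l"
proof -
  have "{S. S \<subseteq> I \<and> card S = Suc l \<and> i \<in> S} = insert i ` {S. S \<subseteq> I - {i} \<and> card S = l}"
    (is "?L = ?R")
  proof (intro subset_antisym subsetI)
    fix S assume S: "S \<in> ?L"
    then have "finite S" using assms by (auto intro: finite_subset)
    then have "S = insert i (S - {i})" "S - {i} \<in> {S. S \<subseteq> I - {i} \<and> card S = l}" using S by auto
    then show "S \<in> ?R" by blast
  next
    fix S assume "S \<in> ?R"
    then obtain T where T: "S = insert i T" "T \<subseteq> I - {i}" "card T = l" by auto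
    moreover have "finite T" "i \<notin> T" using T assms by (auto intro: finite_subset)
    ultimately show "S \<in> ?L" using assms by auto
  qed
  moreover have "inj_on (insert i) {S. S \<subseteq> I - {i} \<and> card S = l}" by (auto intro!: inj_onI)
  ultimately show ?thesis using assms n_subsets[of "I - {i}" l] by (simp add: card_image)
qed

text \<open>Maclaurin's inequality for the degrees \<open>l\<close> and \<open>card I\<close> is AM-GM for the monomials of
  degree \<open>l\<close>, each variable occurring in \<open>(card I - 1) choose (l - 1)\<close> of them.\<close>

lemma prod_le_of_esym_on_le:
  fixes y :: "'i \<Rightarrow> real"
  assumes I: "finite I" and l: "1 \<le> l" "l \<le> card I" and y: "\<And>i. i \<in> I \<Longrightarrow> 0 \<le> y i"
    and s: "esym_on I l y \<le> s"
  shows "(\<Prod>i\<in>I. y i) \<le> (s / real (card I choose l)) powr (real (card I) / real l)"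
proof (cases "\<exists>i\<in>I. y i = 0")
  case True
  then have "(\<Prod>i\<in>I. y i) = 0" using I by auto
  then show ?thesis by simp
next
  case False
  then have pos: "\<And>i. i \<in> I \<Longrightarrow> 0 < y i" using y by (metis order_less_le)
  obtain l' where l': "l = Suc l'" using l by (cases l) auto
  let ?\<S> = "{S. S \<subseteq> I \<and> card S = l}"
  define N where "N = card I choose l"
  have N: "card ?\<S> = N" using n_subsets[OF I] by (simp add: N_def)
  have N0: "0 < N" using l by (simp add: N_def)
  have fin: "finite ?\<S>" using I by auto
  have e0: "0 < esym_on I l y" by (rule esym_on_pos[OF I l(2) pos])
  have "(\<Sum>S\<in>?\<S>. ln (\<Prod>i\<in>S. y i)) \<le> N * ln (esym_on I l y / N)"
  proof -
    have "?\<S> \<noteq> {}" using N N0 by (metis card.empty less_irrefl)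
    moreover have "0 < (\<Prod>i\<in>S. y i)" if "S \<in> ?\<S>" for S
      using that pos by (intro prod_pos) auto
    ultimately show ?thesis
      using sum_ln_le_card_ln_mean[OF fin, of "\<lambda>S. \<Prod>i\<in>S. y i"]
      unfolding N esym_on_def by simp
  qed
  also have "(\<Sum>S\<in>?\<S>. ln (\<Prod>i\<in>S. y i)) = (\<Sum>S\<in>?\<S>. \<Sum>i | i \<in> I \<and> i \<in> S. ln (y i))"
  proof (rule sum.cong)
    fix S assume S: "S \<in> ?\<S>"
    then have "finite S" using I by (auto intro: finite_subset)
    then have "ln (\<Prod>i\<in>S. y i) = (\<Sum>i\<in>S. ln (y i))" using S pos by (intro ln_prod) force+
    moreover have "S = {i \<in> I. i \<in> S}" using S by auto
    ultimately show "ln (\<Prod>i\<in>S. y i) = (\<Sum>i | i \<in> I \<and> i \<in> S. ln (y i))" by simp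
  qed simp
  also have "\<dots> = (\<Sum>i\<in>I. \<Sum>S | S \<in> ?\<S> \<and> i \<in> S. ln (y i))"
    by (rule sum.swap_restrict[OF fin I])
  also have "\<dots> = (\<Sum>i\<in>I. real ((card I - 1) choose l') * ln (y i))"
  proof (rule sum.cong)
    fix i assume "i \<in> I"
    then show "(\<Sum>S | S \<in> ?\<S> \<and> i \<in> S. ln (y i)) = real ((card I - 1) choose l') * ln (y i)"
      using card_subsets_containing[OF I, of i l'] by (simp add: l' conj_assoc)
  qed simp
  also have "\<dots> = real ((card I - 1) choose l') * ln (\<Prod>i\<in>I. y i)"
    using I pos by (subst ln_prod) (force simp: sum_distrib_left)+
  finally have 1: "real ((card I - 1) choose l') * ln (\<Prod>i\<in>I. y i) \<le> N * ln (esym_on I l y / N)" .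
  \<comment> \<open>The absorption identity turns the ratio of the number of monomials to the number
    of monomials containing a given variable into the exponent \<open>card I / l\<close>.\<close>
  have "Suc l' * (Suc (card I - 1) choose Suc l') = Suc (card I - 1) * ((card I - 1) choose l')"
    using Suc_times_binomial_eq[of "card I - 1" l'] by (simp only: mult.commute)
  then have "l * N = card I * ((card I - 1) choose l')" using l l' by (simp add: N_def)
  then have 2: "real l * N = card I * real ((card I - 1) choose l')"
    by (metis of_nat_mult)
  define B where "B = real ((card I - 1) choose l')"
  have B0: "0 < B" using l l' by (simp add: B_def)
  have l0: "0 < real l" using l by simp
  have "real N = B * (card I / l)" using 2 l0 unfolding B_def[symmetric] by (simp add: field_simps)
  then have "B * ln (\<Prod>i\<in>I. y i) \<le> B * (card I / l) * ln (esym_on I l y / real N)"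
    using 1 unfolding B_def[symmetric] by metis
  then have "ln (\<Prod>i\<in>I. y i) \<le> card I / l * ln (esym_on I l y / N)"
    using B0 unfolding mult.assoc by (simp only: mult_le_cancel_left_pos)
  also have "\<dots> \<le> card I / l * ln (s / N)"
    using e0 s N0 by (intro mult_left_mono ln_mono) (auto simp: divide_right_mono)
  finally have "ln (\<Prod>i\<in>I. y i) \<le> card I / l * ln (s / N)" .
  moreover have "0 < s / N" using e0 s N0 by simp
  moreover have "0 < (\<Prod>i\<in>I. y i)" using pos by (rule prod_pos)
  ultimately have "(\<Prod>i\<in>I. y i) \<le> exp (card I / l * ln (s / N))"
    by (metis exp_le_cancel_iff exp_ln)
  also have "\<dots> = (s / N) powr (card I / l)" using \<open>0 < s / N\<close> N0 unfolding powr_def by auto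
  finally show ?thesis by (simp add: N_def)
qed

section \<open>The sets \<open>H\<^sub>l\<^sub>,\<^sub>r(n)\<close>\<close>

lemma hyp_set_iff:
  "v \<in> hyp_set l r n \<longleftrightarrow> v \<in> {1..r} \<rightarrow>\<^sub>E {1..} \<and> esym_on {1..r} l v \<le> n"
  by (simp add: hyp_set_def esym_eq_esym_on)

lemma hyp_set_ge1: "v \<in> hyp_set l r n \<Longrightarrow> k \<in> {1..r} \<Longrightarrow> 1 \<le> v k"
  by (auto simp: hyp_set_iff PiE_iff)

lemma hyp_set_prod_pos: "v \<in> hyp_set l r n \<Longrightarrow> 0 < (\<Prod>k=1..r. v k)"
  using hyp_set_ge1[of v l r n] by (intro prod_pos) (auto simp: Suc_le_eq)

text \<open>Complete \<open>i\<close> to an index set of size \<open>l\<close>. Its monomial is at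
  least \<open>v i\<close>, because all other factors are at least 1.\<close>

lemma hyp_set_le:
  assumes l: "1 \<le> l" "l \<le> r" and v: "v \<in> hyp_set l r n" and i: "i \<in> {1..r}"
  shows "v i \<le> n"
proof -
  obtain T where T: "T \<subseteq> {1..r} - {i}" "card T = l - 1"
    using obtain_subset_with_card_n[of "l - 1" "{1..r} - {i}"] l i
    by (metis card_Diff_singleton card_atLeastAtMost diff_Suc_1 diff_le_mono)
  have fT: "finite T" "i \<notin> T" using T by (auto intro: finite_subset)
  have ge: "1 \<le> (\<Prod>k\<in>T. v k)" using T hyp_set_ge1[OF v] by (intro prod_ge_1) auto
  have "v i \<le> v i * (\<Prod>k\<in>T. v k)" using ge by simp
  also have "\<dots> = (\<Prod>k\<in>insert i T. v k)" using fT by simp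
  also have "\<dots> \<le> esym_on {1..r} (card (insert i T)) v"
    using T i by (intro prod_le_esym_on) auto
  also have "card (insert i T) = l" using fT T l by simp
  finally show ?thesis using v by (simp add: hyp_set_iff)
qed

lemma finite_hyp_set: "1 \<le> l \<Longrightarrow> l \<le> r \<Longrightarrow> finite (hyp_set l r n)"
proof (rule finite_subset)
  assume l: "1 \<le> l" "l \<le> r"
  show "hyp_set l r n \<subseteq> {1..r} \<rightarrow>\<^sub>E {1..n}"
  proof
    fix v assume v: "v \<in> hyp_set l r n"
    then have "v \<in> extensional {1..r}" by (simp add: hyp_set_iff PiE_iff)
    then show "v \<in> {1..r} \<rightarrow>\<^sub>E {1..n}"
      using hyp_set_le[OF l v] hyp_set_ge1[OF v] by (simp add: PiE_iff)
  qed
qed (auto intro: finite_PiE)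

lemma hyp_set_nonempty: "r choose l \<le> n \<Longrightarrow> hyp_set l r n \<noteq> {}"
proof -
  assume "r choose l \<le> n"
  then have "esym_on {1..r} l (\<lambda>_. 1::nat) \<le> n" using esym_on_const[of "{1..r}" l "1::nat"] by simp
  also have "esym_on {1..r} l (\<lambda>_. 1::nat) = esym_on {1..r} l (\<lambda>k\<in>{1..r}. 1)"
    by (intro esym_on_cong) auto
  finally have "(\<lambda>k\<in>{1..r}. 1) \<in> hyp_set l r n" by (auto simp: hyp_set_iff)
  then show ?thesis by blast
qed

lemma card_hyp_set_pos: "1 \<le> l \<Longrightarrow> l \<le> r \<Longrightarrow> r choose l \<le> n \<Longrightarrow> 0 < card (hyp_set l r n)"
  using finite_hyp_set hyp_set_nonempty by (simp add: card_gt_0_iff)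

lemma lower_at_hyp_set:
  assumes i: "i \<in> {1..r}" shows "lower_at i (hyp_set l r n)"
  unfolding lower_at_def
proof (intro ballI conjI allI impI)
  fix v assume v: "v \<in> hyp_set l r n"
  then show "1 \<le> v i" using i by (rule hyp_set_ge1)
  fix t assume t: "1 \<le> t" "t \<le> v i"
  have "v(i := t) \<in> {1..r} \<rightarrow>\<^sub>E {1..}" using v i t by (auto simp: hyp_set_iff PiE_iff extensional_def)
  moreover have "esym_on {1..r} l (v(i := t)) \<le> esym_on {1..r} l v"
    using t by (intro esym_on_mono) auto
  ultimately show "v(i := t) \<in> hyp_set l r n" using v by (auto simp: hyp_set_iff)
qed

lemma lower_at_hyp_set_prod_le:
  assumes i: "i \<in> {1..r}"
  shows "lower_at i {v\<in>hyp_set l r n. real (\<Prod>k=1..r. v k) \<le> x}"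
  unfolding lower_at_def
proof (intro ballI conjI allI impI)
  fix v assume v: "v \<in> {v\<in>hyp_set l r n. real (\<Prod>k=1..r. v k) \<le> x}"
  then show "1 \<le> v i" using i hyp_set_ge1 by blast
  fix t assume t: "1 \<le> t" "t \<le> v i"
  have "v(i := t) \<in> hyp_set l r n" using v lower_atD[where v = v and t = t, OF lower_at_hyp_set[OF i]] t by blast
  moreover have "(\<Prod>k=1..r. (v(i := t)) k) \<le> (\<Prod>k=1..r. v k)"
    using t by (intro prod_mono) auto
  then have "real (\<Prod>k=1..r. (v(i := t)) k) \<le> real (\<Prod>k=1..r. v k)" by (rule of_nat_mono)
  ultimately show "v(i := t) \<in> {v\<in>hyp_set l r n. real (\<Prod>k=1..r. v k) \<le> x}" using v by auto
qed

text \<open>Maclaurin's inequality with the binomial coefficient estimated by 1. It places the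
  rescaled product in \<open>[0, 1]\<close>, on which the bounds for both ratios rest.\<close>

lemma hyp_set_prod_le:
  assumes l: "1 \<le> l" "l \<le> r" and v: "v \<in> hyp_set l r n"
  shows "real (\<Prod>k=1..r. v k) \<le> real n powr (real r / real l)"
proof -
  have "esym_on {1..r} l (\<lambda>k. real (v k)) = real (esym_on {1..r} l v)"
    by (simp add: esym_on_def)
  then have "esym_on {1..r} l (\<lambda>k. real (v k)) \<le> real n" using v by (simp add: hyp_set_iff)
  then have "(\<Prod>k=1..r. real (v k)) \<le> (real n / real (r choose l)) powr (real r / real l)"
    using prod_le_of_esym_on_le[of "{1..r}" l "\<lambda>k. real (v k)" "real n"] l by simp
  also have "\<dots> \<le> real n powr (real r / real l)"
  proof (rule powr_mono2)
    have "1 \<le> r choose l" using l by (simp add: Suc_le_eq)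
    then have "1 \<le> real (r choose l)" by linarith
    then show "real n / real (r choose l) \<le> real n"
      by (simp add: divide_le_eq mult_le_cancel_left1)
  qed auto
  finally show ?thesis by simp
qed

section \<open>The hyperbolic case \<open>l = r\<close>\<close>

lemma hyp_set_full_iff: "v \<in> hyp_set r r n \<longleftrightarrow> v \<in> {1..r} \<rightarrow>\<^sub>E {1..} \<and> (\<Prod>k=1..r. v k) \<le> n"
  using esym_on_card[of "{1..r}" v] by (simp add: hyp_set_iff)

lemma prod_fun_upd_one:
  fixes u :: "'i \<Rightarrow> nat"
  assumes "finite I" "i \<in> I" "u i = 1"
  shows "(\<Prod>k\<in>I. (u(i := t)) k) = t * (\<Prod>k\<in>I. u k)"
proof -
  have "(\<Prod>k\<in>I. (u(i := t)) k) = (u(i := t)) i * (\<Prod>k\<in>I - {i}. (u(i := t)) k)"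
    by (rule prod.remove[OF assms(1,2)])
  also have "(\<Prod>k\<in>I - {i}. (u(i := t)) k) = (\<Prod>k\<in>I - {i}. u k)" by (intro prod.cong) auto
  also have "\<dots> = (\<Prod>k\<in>I. u k)" using prod.remove[OF assms(1,2), of u] assms(3) by simp
  finally show ?thesis by simp
qed

lemma hyp_set_full_upd_iff:
  assumes "u \<in> hyp_set r r n" "i \<in> {1..r}" "u i = 1"
  shows "u(i := t) \<in> hyp_set r r n \<longleftrightarrow> 1 \<le> t \<and> t * (\<Prod>k=1..r. u k) \<le> n"
  using prod_fun_upd_one[of "{1..r}" i u t] assms
  by (auto simp: hyp_set_full_iff PiE_iff extensional_def)

lemma hyp_set_full_fiber:
  assumes "u \<in> hyp_set r r n" "i \<in> {1..r}" "u i = 1"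
  shows "{t. u(i := t) \<in> hyp_set r r n} = {1..n div (\<Prod>k=1..r. u k)}"
  using hyp_set_prod_pos[OF assms(1)] hyp_set_full_upd_iff[OF assms]
  by (auto simp: less_eq_div_iff_mult_less_eq)

lemma abs_card_prod_le_hyperbola:
  assumes r: "1 \<le> r" and x: "0 \<le> x" "x \<le> 1"
  shows "\<bar>real (card {v\<in>hyp_set r r n. real (\<Prod>k=1..r. v k) \<le> x * real n})
            - x * real (card (hyp_set r r n))\<bar> \<le> real (card {v\<in>hyp_set r r n. v 1 = 1})"
proof -
  let ?H = "hyp_set r r n"
  have H: "finite ?H" "lower_at 1 ?H"
    using r by (auto intro!: finite_hyp_set lower_at_hyp_set)
  let ?H1 = "{u. u \<in> ?H \<and> u 1 = 1}"
  let ?P = "\<lambda>v. real (\<Prod>k=1..r. v k) \<le> x * real n"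
  have "\<bar>real (card {t. u(1 := t) \<in> ?H \<and> ?P (u(1 := t))}) - x * real (card {t. u(1 := t) \<in> ?H})\<bar> \<le> 1"
    if u: "u \<in> ?H1" for u
  proof -
    have u': "u \<in> ?H" "1 \<in> {1..r}" "u 1 = 1" using u r by auto
    define q where "q = (\<Prod>k=1..r. u k)"
    have q: "0 < q" unfolding q_def by (rule hyp_set_prod_pos[OF u'(1)])
    \<comment> \<open>The real length of the fibre over \<open>u\<close>: the fibre has
      \<open>floor a\<close> points, and the bound \<open>x * n\<close> on the product leaves
      \<open>floor (x * a)\<close> of them.\<close>
    define a where "a = real n / real q"
    have a: "0 \<le> a" by (simp add: a_def)
    have pr: "(\<Prod>k=1..r. (u(1 := t)) k) = t * q" for t
      unfolding q_def using prod_fun_upd_one[of "{1..r}" 1 u t] u' by simp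
    have "{t. u(1 := t) \<in> ?H \<and> ?P (u(1 := t))} = {1..nat \<lfloor>x * a\<rfloor>}"
    proof (intro set_eqI iffI)
      fix t assume "t \<in> {t. u(1 := t) \<in> ?H \<and> ?P (u(1 := t))}"
      then have t: "1 \<le> t" "real (t * q) \<le> x * real n"
        unfolding mem_Collect_eq pr hyp_set_full_upd_iff[OF u'] by auto
      then have "real t \<le> x * a" using q by (simp add: a_def field_simps)
      then show "t \<in> {1..nat \<lfloor>x * a\<rfloor>}" using t by (simp add: le_nat_floor)
    next
      fix t assume t: "t \<in> {1..nat \<lfloor>x * a\<rfloor>}"
      have "real t \<le> x * a" using t x a by (simp add: le_nat_iff le_floor_iff)
      then have 1: "real (t * q) \<le> x * real n" using q by (simp add: a_def field_simps)
      also have "\<dots> \<le> real n" using x by (simp add: mult_left_le_one_le)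
      finally have "t * q \<le> n" by (simp only: of_nat_le_iff)
      then show "t \<in> {t. u(1 := t) \<in> ?H \<and> ?P (u(1 := t))}"
        unfolding mem_Collect_eq pr hyp_set_full_upd_iff[OF u'] q_def[symmetric]
        using t 1 by simp
    qed
    then have c1: "real (card {t. u(1 := t) \<in> ?H \<and> ?P (u(1 := t))}) = of_int \<lfloor>x * a\<rfloor>"
      using x a by simp
    have c2: "real (card {t. u(1 := t) \<in> ?H}) = of_int \<lfloor>a\<rfloor>"
      unfolding hyp_set_full_fiber[OF u'] a_def q_def[symmetric]
      by (simp add: floor_divide_of_nat_eq)
    \<comment> \<open>With \<open>x <= 1\<close> both numbers lie in the interval from
      \<open>x * a - 1\<close> to \<open>x * a\<close>.\<close>
    have "x * of_int \<lfloor>a\<rfloor> \<le> x * a" "x * (a - 1) \<le> x * of_int \<lfloor>a\<rfloor>"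
      using x by (intro mult_left_mono; linarith)+
    moreover have "of_int \<lfloor>x * a\<rfloor> \<le> x * a" "x * a - 1 < of_int \<lfloor>x * a\<rfloor>" by linarith+
    ultimately show ?thesis using x unfolding c1 c2 by (simp add: algebra_simps) linarith
  qed
  note bound = this
  have eq: "real (card {v\<in>?H. ?P v}) - x * real (card ?H)
     = (\<Sum>u\<in>?H1. real (card {t. u(1 := t) \<in> ?H \<and> ?P (u(1 := t))}) - x * real (card {t. u(1 := t) \<in> ?H}))"
    using card_eq_sum_fibers[OF H, of ?P] card_eq_sum_fibers[OF H, of "\<lambda>_. True"]
    by (simp add: sum_subtractf sum_distrib_left)
  have "\<bar>real (card {v\<in>?H. ?P v}) - x * real (card ?H)\<bar> \<le> (\<Sum>u\<in>?H1. 1)"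
    unfolding eq by (rule order_trans[OF sum_abs sum_mono]) (rule bound)
  then show ?thesis by simp
qed

lemma harm_eq_sum: "(\<Sum>t=1..n. 1 / real t) = harm n"
  by (simp add: harm_def divide_inverse)

text \<open>One coordinate is fixed at 1. A second one, \<open>j\<close>, is counted along its
  fibre, which has at most \<open>n\<close> divided by the remaining coordinates many points.
  Summing over these \<open>r - 2\<close> coordinates up to \<open>n\<close> factors into harmonic
  sums.\<close>

lemma card_hyperbola_face_le:
  assumes r: "2 \<le> r" and i: "i \<in> {1..r}"
  shows "real (card {v\<in>hyp_set r r n. v i = 1}) \<le> real n * harm n ^ (r - 2)"
proof -
  let ?B = "{v\<in>hyp_set r r n. v i = 1}"
  have "card ({1..r} - {i}) \<noteq> 0" using r i by simp
  then obtain j where j: "j \<in> {1..r}" "j \<noteq> i"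
    by (metis Diff_iff card.empty ex_in_conv insertCI)
  let ?J = "{1..r} - {i, j}"
  have cJ: "card ?J = r - 2" using i j by (simp add: card_Diff_subset)
  have "finite (hyp_set r r n)" using r by (intro finite_hyp_set) auto
  then have B: "finite ?B" "lower_at j ?B"
    using j lower_at_hyp_set[OF j(1), of r n] by (auto simp: lower_at_def)
  let ?B1 = "{u. u \<in> ?B \<and> u j = 1}"
  \<comment> \<open>Nothing is lost by forgetting the coordinates \<open>i\<close> and
    \<open>j\<close>, which are 1 on \<open>?B1\<close>, and those outside \<open>{1..r}\<close>,
    which are \<open>undefined\<close>.\<close>
  have inj: "inj_on (\<lambda>u. restrict u ?J) ?B1"
  proof (rule inj_onI, rule ext)
    fix u w k assume u: "u \<in> ?B1" and w: "w \<in> ?B1" and eq: "restrict u ?J = restrict w ?J"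
    show "u k = w k"
    proof (cases "k \<in> ?J")
      case True then show ?thesis using fun_cong[OF eq, of k] by simp
    next
      case False
      then consider "k \<notin> {1..r}" | "k = i" | "k = j" by auto
      then show ?thesis
        using u w by cases (auto simp: hyp_set_full_iff PiE_iff extensional_def)
    qed
  qed
  have fib: "real (card {t. u(j := t) \<in> ?B \<and> True}) \<le> real n * (\<Prod>k\<in>?J. 1 / real (restrict u ?J k))"
    if u: "u \<in> ?B1" for u
  proof -
    have u': "u \<in> hyp_set r r n" "j \<in> {1..r}" "u j = 1" "u i = 1" using u j by auto
    have "{t. u(j := t) \<in> ?B \<and> True} = {1..n div (\<Prod>k=1..r. u k)}"
      using hyp_set_full_fiber[OF u'(1-3)] u' j by auto
    then have "real (card {t. u(j := t) \<in> ?B \<and> True}) \<le> real n / real (\<Prod>k=1..r. u k)"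
      by (simp add: of_nat_div_le_of_nat del: of_nat_prod)
    also have "(\<Prod>k=1..r. u k) = (\<Prod>k\<in>?J. u k)"
      using u' i j by (intro prod.mono_neutral_right) auto
    also have "real n / real (\<Prod>k\<in>?J. u k) = real n * (\<Prod>k\<in>?J. 1 / real (restrict u ?J k))"
      by (simp add: prod_dividef)
    finally show ?thesis .
  qed
  have "real (card ?B) = (\<Sum>u\<in>?B1. real (card {t. u(j := t) \<in> ?B \<and> True}))"
    using card_eq_sum_fibers[OF B, of "\<lambda>_. True"] by simp
  also have "\<dots> \<le> (\<Sum>u\<in>?B1. real n * (\<Prod>k\<in>?J. 1 / real (restrict u ?J k)))"
    by (rule sum_mono) (rule fib)
  also have "\<dots> = (\<Sum>w\<in>(\<lambda>u. restrict u ?J) ` ?B1. real n * (\<Prod>k\<in>?J. 1 / real (w k)))"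
    by (subst sum.reindex[OF inj]) simp
  also have "\<dots> \<le> (\<Sum>w\<in>?J \<rightarrow>\<^sub>E {1..n}. real n * (\<Prod>k\<in>?J. 1 / real (w k)))"
  proof (rule sum_mono2)
    show "(\<lambda>u. restrict u ?J) ` ?B1 \<subseteq> ?J \<rightarrow>\<^sub>E {1..n}"
    proof clarify
      fix u assume "u \<in> hyp_set r r n"
      then show "restrict u ?J \<in> ?J \<rightarrow>\<^sub>E {1..n}"
        using hyp_set_le[of r r u n] hyp_set_ge1[of u r r n] r by (simp add: restrict_PiE_iff)
    qed
  qed (auto intro!: finite_PiE mult_nonneg_nonneg prod_nonneg)
  also have "\<dots> = real n * harm n ^ (r - 2)"
    using prod_sum_PiE[of ?J "\<lambda>_. {1..n}" "\<lambda>_ t. 1 / real t"] cJ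
    unfolding harm_eq_sum sum_distrib_left[symmetric] by simp
  finally show ?thesis .
qed

text \<open>Coordinate 1 is counted along its fibre, the other \<open>r - 1\<close> coordinates run
  only up to \<open>m\<close>. The condition on \<open>m\<close> keeps their product at most
  \<open>n\<close>, so that no fibre counted is empty.\<close>

lemma card_hyperbola_ge:
  assumes r: "1 \<le> r" and m: "m ^ (r - 1) \<le> n"
  shows "real n / 2 * harm m ^ (r - 1) \<le> real (card (hyp_set r r n))"
proof -
  let ?H = "hyp_set r r n"
  let ?J = "{1..r} - {1::nat}"
  have H: "finite ?H" "lower_at 1 ?H"
    using r by (auto intro!: finite_hyp_set lower_at_hyp_set)
  let ?H1 = "{u. u \<in> ?H \<and> u 1 = 1}"
  let ?e = "\<lambda>w. w(1 := 1::nat)"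
  have prJ: "(\<Prod>k=1..r. (?e w) k) = (\<Prod>k\<in>?J. w k)" for w
  proof -
    have "(\<Prod>k=1..r. (?e w) k) = (?e w) 1 * (\<Prod>k\<in>?J. (?e w) k)"
      using r by (intro prod.remove) auto
    also have "(\<Prod>k\<in>?J. (?e w) k) = (\<Prod>k\<in>?J. w k)" by (intro prod.cong) auto
    finally show ?thesis by simp
  qed
  have le: "(\<Prod>k\<in>?J. w k) \<le> n" if "w \<in> ?J \<rightarrow>\<^sub>E {1..m}" for w
  proof -
    have "(\<Prod>k\<in>?J. w k) \<le> (\<Prod>k\<in>?J. m)" using that by (intro prod_mono) (auto simp: PiE_iff)
    also have "\<dots> = m ^ (r - 1)" using r by simp
    finally show ?thesis using m by simp
  qed
  have sub: "?e ` (?J \<rightarrow>\<^sub>E {1..m}) \<subseteq> ?H1"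
  proof (clarify, intro conjI)
    fix w assume w: "w \<in> ?J \<rightarrow>\<^sub>E {1..m}"
    show "?e w \<in> ?H" unfolding hyp_set_full_iff prJ
      using w le[OF w] r by (auto simp: PiE_iff extensional_def)
  qed simp
  have inj: "inj_on ?e (?J \<rightarrow>\<^sub>E {1..m})"
  proof (rule inj_onI, rule ext)
    fix u w k assume "u \<in> ?J \<rightarrow>\<^sub>E {1..m}" "w \<in> ?J \<rightarrow>\<^sub>E {1..m}" "?e u = ?e w"
    then show "u k = w k"
      by (cases "k = 1") (auto simp: PiE_iff extensional_def dest: fun_cong[of _ _ k])
  qed
  have "harm m ^ (r - 1) = (\<Sum>w\<in>?J \<rightarrow>\<^sub>E {1..m}. \<Prod>k\<in>?J. 1 / real (w k))"
    using prod_sum_PiE[of ?J "\<lambda>_. {1..m}" "\<lambda>_ t. 1 / real t"] r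
    unfolding harm_eq_sum by simp
  then have "real n / 2 * harm m ^ (r - 1) = (\<Sum>w\<in>?J \<rightarrow>\<^sub>E {1..m}. real n / 2 * (\<Prod>k\<in>?J. 1 / real (w k)))"
    by (simp only: sum_distrib_left)
  also have "\<dots> \<le> (\<Sum>w\<in>?J \<rightarrow>\<^sub>E {1..m}. real (n div (\<Prod>k=1..r. (?e w) k)))"
  proof (rule sum_mono)
    fix w assume w: "w \<in> ?J \<rightarrow>\<^sub>E {1..m}"
    define q where "q = (\<Prod>k\<in>?J. w k)"
    have q: "0 < q" "q \<le> n" unfolding q_def
      using le[OF w] w by (auto simp: PiE_iff Suc_le_eq intro!: prod_pos)
    \<comment> \<open>A quotient that is at least 1 loses at most half of its value when rounded
      down; this is the factor \<open>1 / 2\<close> in the claim.\<close>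
    have "n = q * (n div q) + n mod q" "n mod q < q" using q by simp_all
    moreover have "1 \<le> n div q" using q by (simp add: less_eq_div_iff_mult_less_eq)
    then have "q \<le> q * (n div q)" by simp
    ultimately have "n \<le> 2 * (q * (n div q))" by linarith
    then have "real n \<le> 2 * (real q * real (n div q))"
      by (metis of_nat_le_iff of_nat_mult of_nat_numeral)
    then have "real n / 2 / real q \<le> real (n div q)" using q by (simp add: field_simps)
    moreover have "real n / 2 * (\<Prod>k\<in>?J. 1 / real (w k)) = real n / 2 / real q"
      by (simp add: q_def prod_dividef)
    ultimately show "real n / 2 * (\<Prod>k\<in>?J. 1 / real (w k)) \<le> real (n div (\<Prod>k=1..r. (?e w) k))"
      unfolding prJ q_def by simp
  qed
  also have "\<dots> = (\<Sum>u\<in>?e ` (?J \<rightarrow>\<^sub>E {1..m}). real (n div (\<Prod>k=1..r. u k)))"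
    by (subst sum.reindex[OF inj]) simp
  also have "\<dots> \<le> (\<Sum>u\<in>?H1. real (n div (\<Prod>k=1..r. u k)))"
    using sub H by (intro sum_mono2) auto
  also have "\<dots> = (\<Sum>u\<in>?H1. real (card {t. u(1 := t) \<in> ?H \<and> True}))"
  proof (rule sum.cong)
    fix u assume "u \<in> ?H1"
    then show "real (n div (\<Prod>k=1..r. u k)) = real (card {t. u(1 := t) \<in> ?H \<and> True})"
      using hyp_set_full_fiber[of u r n 1] r by simp
  qed simp
  also have "\<dots> = real (card ?H)" using card_eq_sum_fibers[OF H, of "\<lambda>_. True"] by simp
  finally show ?thesis .
qed

lemma hyperbola_face_negligible:
  assumes r: "2 \<le> r" and i: "i \<in> {1..r}"
  shows "(\<lambda>n. real (card {v\<in>hyp_set r r n. v i = 1}) / real (card (hyp_set r r n))) \<longlonglongrightarrow> 0"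
proof (rule tendsto_sandwich[OF _ _ tendsto_const])
  \<comment> \<open>The factor 2 undoes \<open>real n / 2\<close> in the lower bound,
    \<open>2 ^ (r - 2)\<close> comes from \<open>harm n <= 2 * ln n\<close>, and
    \<open>real r ^ (r - 1)\<close> from \<open>harm m >= ln n / r\<close>. The exponents
    \<open>r - 2\<close> and \<open>r - 1\<close> leave one logarithm in the denominator.\<close>
  define C where "C = 2 * 2 ^ (r - 2) * real r ^ (r - 1)"
  show "\<forall>\<^sub>F n in sequentially. 0 \<le> real (card {v\<in>hyp_set r r n. v i = 1}) / real (card (hyp_set r r n))"
    by simp
  show "(\<lambda>n. C / ln (real n)) \<longlonglongrightarrow> 0"
    by (intro real_tendsto_divide_at_top[OF tendsto_const]
        filterlim_compose[OF ln_at_top filterlim_real_sequentially])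
  show "\<forall>\<^sub>F n in sequentially.
      real (card {v\<in>hyp_set r r n. v i = 1}) / real (card (hyp_set r r n)) \<le> C / ln (real n)"
    using eventually_ge_at_top[of 3]
  proof eventually_elim
    case (elim n)
    \<comment> \<open>The lower bound needs \<open>m ^ (r - 1) <= n\<close> while
      \<open>ln (m + 1)\<close> stays a fixed fraction of \<open>ln n\<close>; the integer part of
      the \<open>r\<close>-th root does both.\<close>
    define m where "m = nat \<lfloor>root r (real n)\<rfloor>"
    have n0: "0 < real n" using elim by simp
    have r0: "0 < r" using r by simp
    \<comment> \<open>The threshold 3 enters here, through \<open>exp 1 <= 3\<close>. The estimate
      then absorbs the constant in \<open>harm n <= 1 + ln n\<close>.\<close>
    have L: "1 \<le> ln (real n)"
    proof -
      have "exp 1 \<le> real n" using elim exp_le by linarith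
      then show ?thesis using n0 by (simp add: ln_ge_iff)
    qed
    have rt: "1 \<le> root r (real n)" using r0 elim by simp
    have mle: "real m \<le> root r (real n)" using rt by (simp add: m_def)
    have "real m ^ r \<le> real n"
      using power_mono[OF mle, of r] r0 n0 by (simp add: real_root_pow_pos2)
    moreover have "1 \<le> m" using rt by (simp add: m_def le_nat_iff le_floor_iff)
    then have "m ^ (r - 1) \<le> m ^ r" by (intro power_increasing) auto
    ultimately have m: "m ^ (r - 1) \<le> n"
      by (metis le_trans of_nat_le_iff of_nat_power)
    have "root r (real n) \<le> real m + 1" unfolding m_def by linarith
    then have "ln (root r (real n)) \<le> ln (real m + 1)" using rt by (intro ln_mono) auto
    then have hm: "ln (real n) / real r \<le> harm m"
      using ln_le_harm[of m] ln_root[OF r0, of "real n"] by simp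
    have "harm n - ln (real n) \<le> harm 1 - ln (real 1)"
      using euler_mascheroni_sequence_decreasing[of 1 n] elim by simp
    then have hn: "harm n \<le> 2 * ln (real n)" using L by (simp add: harm_def)
    have up: "real (card {v\<in>hyp_set r r n. v i = 1}) \<le> real n * (2 * ln (real n)) ^ (r - 2)"
      using card_hyperbola_face_le[OF r i, of n] power_mono[OF hn harm_nonneg, of "r - 2"] n0
      by (smt (verit) mult_left_mono)
    have lo: "real n / 2 * (ln (real n) / real r) ^ (r - 1) \<le> real (card (hyp_set r r n))"
    proof -
      have "real n / 2 * (ln (real n) / real r) ^ (r - 1) \<le> real n / 2 * harm m ^ (r - 1)"
        using power_mono[OF hm, of "r - 1"] L n0 by (intro mult_left_mono) auto
      then show ?thesis using card_hyperbola_ge[of r m n] r m by linarith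
    qed
    have "real (card {v\<in>hyp_set r r n. v i = 1}) / real (card (hyp_set r r n))
        \<le> (real n * (2 * ln (real n)) ^ (r - 2)) / (real n / 2 * (ln (real n) / real r) ^ (r - 1))"
      using L n0 r0 elim by (intro frac_le up lo) (auto intro!: mult_pos_pos divide_pos_pos zero_less_power)
    also have "\<dots> = C / ln (real n)"
    proof -
      obtain s where s: "r = Suc (Suc s)" using r by (metis Suc_le_D add_2_eq_Suc le_Suc_ex)
      have "(a * (2 * b) ^ s) / (a / 2 * (b / c) ^ Suc s) = 2 * 2 ^ s * c ^ Suc s / b"
        if "0 < a" "0 < b" "0 < c" for a b c :: real
        using that by (simp add: power_divide power_mult_distrib field_simps)
      from this[of "real n" "ln (real n)" "real r"] show ?thesis
        unfolding C_def using L n0 r0 elim by (simp add: s del: of_nat_Suc power_Suc)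
    qed
    finally show ?case .
  qed
qed

section \<open>The case \<open>l < r\<close>: sublevel sets of finite volume\<close>

interpretation lborel_prod: product_sigma_finite "\<lambda>_. lborel :: real measure"
  by standard

abbreviation lborel_on :: "'i set \<Rightarrow> ('i \<Rightarrow> real) measure" where
  "lborel_on I \<equiv> Pi\<^sub>M I (\<lambda>_. lborel)"

lemma borel_measurable_coord: "i \<in> K \<Longrightarrow> (\<lambda>y. y i) \<in> borel_measurable (lborel_on K)"
  using measurable_component_singleton[of i K "\<lambda>_. lborel"] by simp

lemma borel_measurable_esym_on:
  assumes "I \<subseteq> K" shows "(\<lambda>y. esym_on I l y :: real) \<in> borel_measurable (lborel_on K)"
  unfolding esym_on_def
proof (intro borel_measurable_sum borel_measurable_prod)
  fix S i assume "S \<in> {S. S \<subseteq> I \<and> card S = l}" "i \<in> S"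
  then have "i \<in> K" using assms by auto
  then show "(\<lambda>y. y i) \<in> borel_measurable (lborel_on K)"
    by (rule borel_measurable_coord)
qed



text \<open>Fubini in the direction \<open>i\<close>: countable sections have length 0.\<close>

lemma null_set_if_countable_sections:
  assumes J: "finite J" "i \<notin> J" and A: "A \<in> sets (lborel_on (insert i J))"
    and sec: "\<And>y. y \<in> space (lborel_on J) \<Longrightarrow> countable {t. y(i := t) \<in> A}"
  shows "A \<in> null_sets (lborel_on (insert i J))"
proof -
  have "emeasure (lborel_on (insert i J)) A = (\<integral>\<^sup>+ z. indicator A z \<partial>lborel_on (insert i J))"
    using A by simp
  also have "\<dots> = (\<integral>\<^sup>+ y. (\<integral>\<^sup>+ t. indicator A (y(i := t)) \<partial>lborel) \<partial>lborel_on J)"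
    using A J by (intro lborel_prod.product_nn_integral_insert) auto
  also have "\<dots> = (\<integral>\<^sup>+ y. 0 \<partial>lborel_on J)"
  proof (rule nn_integral_cong)
    fix y assume "y \<in> space (lborel_on J)"
    then have c: "countable {t. y(i := t) \<in> A}" by (rule sec)
    have "(\<integral>\<^sup>+ t. indicator A (y(i := t)) \<partial>lborel) = (\<integral>\<^sup>+ t. indicator {t. y(i := t) \<in> A} t \<partial>lborel)"
      by (intro nn_integral_cong) (auto simp: indicator_def)
    also have "\<dots> = emeasure lborel {t. y(i := t) \<in> A}"
      using sets.countable[OF _ c, of lborel] by simp
    also have "\<dots> = 0" by (rule emeasure_lborel_countable[OF c])
    finally show "(\<integral>\<^sup>+ t. indicator A (y(i := t)) \<partial>lborel) = 0" .
  qed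
  finally show ?thesis using A by (simp add: null_sets_def)
qed

lemma pred_nonneg_coords:
  assumes "finite J" "J \<subseteq> K"
  shows "Measurable.pred (lborel_on K) (\<lambda>y. \<forall>k\<in>J. 0 \<le> y k)"
proof (rule pred_intros_finite(3)[OF assms(1)])
  fix k assume "k \<in> J"
  then have [measurable]: "(\<lambda>y. y k) \<in> borel_measurable (lborel_on K)"
    using assms by (intro borel_measurable_coord) auto
  show "Measurable.pred (lborel_on K) (\<lambda>y. 0 \<le> y k)" by measurable
qed

definition sublevel :: "'i set \<Rightarrow> nat \<Rightarrow> real \<Rightarrow> ('i \<Rightarrow> real) set" where
  "sublevel I l s = {y\<in>space (lborel_on I). (\<forall>i\<in>I. 0 \<le> y i) \<and> esym_on I l y \<le> s}"

lemma sets_sublevel [simp]: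
  assumes "finite I" shows "sublevel I l s \<in> sets (lborel_on I)"
proof -
  note [measurable] = pred_nonneg_coords[OF assms subset_refl] borel_measurable_esym_on[OF subset_refl]
  show ?thesis unfolding sublevel_def by measurable
qed

lemma nn_integral_powr_tail:
  assumes "1 < a" "0 < T" "0 \<le> K"
  shows "(\<integral>\<^sup>+ t. indicator {T..} t * ennreal (K * t powr - a) \<partial>lborel)
           = ennreal (K * (T powr (1 - a) / (a - 1)))"
proof -
  have "((\<lambda>t. t powr - a) has_integral - (T powr (- a + 1)) / (- a + 1)) {T..}"
    using assms by (intro has_integral_powr_to_inf) auto
  also have "- (T powr (- a + 1)) / (- a + 1) = T powr (1 - a) / (a - 1)"
    using assms by (simp add: field_simps)
  finally have "(\<integral>\<^sup>+ t. indicator {T..} t * t powr - a \<partial>lborel) = ennreal (T powr (1 - a) / (a - 1))"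
    by (intro nn_integral_has_integral_lebesgue) auto
  then have "ennreal K * (\<integral>\<^sup>+ t. ennreal (indicator {T..} t * t powr - a) \<partial>lborel)
      = ennreal (K * (T powr (1 - a) / (a - 1)))"
    using assms by (simp only: ennreal_mult')
  moreover have "ennreal K * (\<integral>\<^sup>+ t. ennreal (indicator {T..} t * t powr - a) \<partial>lborel)
      = (\<integral>\<^sup>+ t. ennreal K * ennreal (indicator {T..} t * t powr - a) \<partial>lborel)"
    by (intro nn_integral_cmult[symmetric]) measurable
  moreover have "(\<integral>\<^sup>+ t. ennreal K * ennreal (indicator {T..} t * t powr - a) \<partial>lborel)
      = (\<integral>\<^sup>+ t. indicator {T..} t * ennreal (K * t powr - a) \<partial>lborel)"
    using assms by (intro nn_integral_cong) (auto simp: indicator_def ennreal_mult'[symmetric])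
  ultimately show ?thesis by simp
qed

text \<open>Off the cube \<open>[0, T]\<^sup>I\<close> with \<open>T = s\<^bsup>1/(l+1)\<^esup>\<close>, some coordinate \<open>y\<^sub>i\<close> exceeds \<open>T\<close> and the others
  lie in the sublevel set of degree \<open>l\<close> at level \<open>s / y\<^sub>i\<close>; by the bound for degree \<open>l\<close> the
  contribution is a convergent integral of a power of \<open>y\<^sub>i\<close> exactly when \<open>l + 1 < card I\<close>.\<close>

lemma emeasure_sublevel_le:
  assumes "finite I" "1 \<le> l" "l < card I"
  shows "\<exists>C\<ge>0. \<forall>s>0. emeasure (lborel_on I) (sublevel I l s)
            \<le> ennreal (C * s powr (real (card I) / real l))"
  using assms
proof (induction l arbitrary: I)
  case 0
  then show ?case by simp
next
  case (Suc l)
  note I = Suc.prems(1)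
  have cube: "emeasure (lborel_on I) (I \<rightarrow>\<^sub>E {0..T}) = ennreal (T powr real (card I))" if "0 < T" for T
  proof -
    have "emeasure (lborel_on I) (I \<rightarrow>\<^sub>E {0..T}) = (\<Prod>i\<in>I. emeasure lborel {0..T})"
      using I by (intro lborel_prod.emeasure_PiM) auto
    also have "\<dots> = ennreal (T ^ card I)" using that by (simp add: ennreal_power)
    finally show ?thesis using that by (simp add: powr_realpow)
  qed
  show ?case
  proof (cases "l = 0")
    \<comment> \<open>Degree 1 is the actual base of the induction: every coordinate is at most
      \<open>s\<close>, so the sublevel set lies in a cube.\<close>
    case True
    show ?thesis
    proof (intro exI[of _ 1] conjI allI impI)
      fix s :: real assume s: "0 < s"
      have "sublevel I (Suc l) s \<subseteq> I \<rightarrow>\<^sub>E {0..s}"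
      proof
        fix y assume y: "y \<in> sublevel I (Suc l) s"
        have "y i \<le> s" if "i \<in> I" for i
          using prod_le_esym_on[of I "{i}" y] that y True I by (auto simp: sublevel_def)
        then show "y \<in> I \<rightarrow>\<^sub>E {0..s}" using y by (auto simp: sublevel_def space_PiM PiE_iff)
      qed
      then have "emeasure (lborel_on I) (sublevel I (Suc l) s) \<le> emeasure (lborel_on I) (I \<rightarrow>\<^sub>E {0..s})"
        using I by (intro emeasure_mono) auto
      then show "emeasure (lborel_on I) (sublevel I (Suc l) s)
          \<le> ennreal (1 * s powr (real (card I) / real (Suc l)))"
        using cube[OF s] True by simp
    qed simp
  next
    case False
    define a where "a = real (card I - 1) / real l"
    have a: "1 < a" using False Suc.prems by (simp add: a_def)
    have "\<forall>i\<in>I. \<exists>C\<ge>0. \<forall>s>0. emeasure (lborel_on (I - {i})) (sublevel (I - {i}) l s)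
            \<le> ennreal (C * s powr a)"
    proof
      fix i assume i: "i \<in> I"
      have "card (I - {i}) = card I - 1" using i I by simp
      then show "\<exists>C\<ge>0. \<forall>s>0. emeasure (lborel_on (I - {i})) (sublevel (I - {i}) l s)
            \<le> ennreal (C * s powr a)"
        using Suc.IH[of "I - {i}"] I False Suc.prems by (simp add: a_def)
    qed
    then obtain C where C: "\<And>i. i \<in> I \<Longrightarrow> 0 \<le> C i"
      "\<And>i s. i \<in> I \<Longrightarrow> 0 < s \<Longrightarrow> emeasure (lborel_on (I - {i})) (sublevel (I - {i}) l s)
            \<le> ennreal (C i * s powr a)"
      by metis
    show ?thesis
    proof (intro exI[of _ "1 + (\<Sum>i\<in>I. C i / (a - 1))"] conjI allI impI)
      show "0 \<le> 1 + (\<Sum>i\<in>I. C i / (a - 1))" using C a by (intro add_nonneg_nonneg sum_nonneg) auto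
    next
      fix s :: real assume s: "0 < s"
      \<comment> \<open>This choice balances the two contributions: \<open>T powr card I\<close> for
        the cube and \<open>s powr a * T powr (1 - a)\<close> for the tails are both equal to
        \<open>s powr e\<close>.\<close>
      define T where "T = s powr (1 / real (Suc l))"
      have T: "0 < T" using s by (simp add: T_def)
      define e where "e = real (card I) / real (Suc l)"
      \<comment> \<open>Dropping from \<open>esym_on_remove\<close> the nonnegative summand free of
        \<open>y i\<close> leaves \<open>y i * esym_on (I - {i}) l y <= s\<close>.\<close>
      define B where "B i = {y\<in>space (lborel_on I). T < y i \<and> (\<forall>k\<in>I - {i}. 0 \<le> y k) \<and>
          esym_on (I - {i}) l y \<le> s / y i}" for i
      have B_sets: "B i \<in> sets (lborel_on I)" if "i \<in> I" for i
      proof -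
        have [measurable]: "(\<lambda>y. y i) \<in> borel_measurable (lborel_on I)"
          "(\<lambda>y. esym_on (I - {i}) l y) \<in> borel_measurable (lborel_on I)"
          using that by (auto intro: borel_measurable_esym_on)
        have 1: "{y\<in>space (lborel_on I). \<forall>k\<in>I - {i}. 0 \<le> y k} \<in> sets (lborel_on I)"
          using I by (intro predE pred_nonneg_coords) auto
        have [measurable]: "(\<lambda>y. s / y i) \<in> borel_measurable (lborel_on I)" by measurable
        have 2: "{y\<in>space (lborel_on I). esym_on (I - {i}) l y \<le> s / y i} \<in> sets (lborel_on I)"
          by measurable
        have 3: "{y\<in>space (lborel_on I). T < y i} \<in> sets (lborel_on I)" by measurable
        show ?thesis unfolding B_def by (intro sets.sets_Collect_conj 1 2 3)
      qed
      have sub: "sublevel I (Suc l) s \<subseteq> (I \<rightarrow>\<^sub>E {0..T}) \<union> (\<Union>i\<in>I. B i)"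
      proof
        fix y assume y: "y \<in> sublevel I (Suc l) s"
        show "y \<in> (I \<rightarrow>\<^sub>E {0..T}) \<union> (\<Union>i\<in>I. B i)"
        proof (cases "\<forall>i\<in>I. y i \<le> T")
          case True
          then show ?thesis using y by (auto simp: sublevel_def space_PiM PiE_iff)
        next
          case F: False
          then obtain i where i: "i \<in> I" "T < y i" by force
          have "0 \<le> esym_on (I - {i}) (Suc l) y"
            using y by (intro esym_on_nonneg) (auto simp: sublevel_def)
          then have "y i * esym_on (I - {i}) l y \<le> s"
            using esym_on_remove[OF I i(1), of l y] y by (simp add: sublevel_def)
          then have "esym_on (I - {i}) l y \<le> s / y i" using i T by (simp add: field_simps)
          then have "y \<in> B i" using y i by (auto simp: B_def sublevel_def)
          then show ?thesis using i by blast
        qed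
      qed
      have Bi: "emeasure (lborel_on I) (B i) \<le> ennreal (C i / (a - 1) * s powr e)" if i: "i \<in> I" for i
      proof -
        let ?J = "I - {i}"
        have ins: "insert i ?J = I" using i by auto
        have "emeasure (lborel_on I) (B i) = (\<integral>\<^sup>+ y. indicator (B i) y \<partial>lborel_on (insert i ?J))"
          using B_sets[OF i] ins by simp
        also have "\<dots> = (\<integral>\<^sup>+ t. (\<integral>\<^sup>+ y. indicator (B i) (y(i := t)) \<partial>lborel_on ?J) \<partial>lborel)"
          using I B_sets[OF i] ins by (intro lborel_prod.product_nn_integral_insert_rev) auto
        also have "\<dots> \<le> (\<integral>\<^sup>+ t. indicator {T..} t * ennreal (C i * s powr a * t powr - a) \<partial>lborel)"
        proof (rule nn_integral_mono)
          fix t :: real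
          show "(\<integral>\<^sup>+ y. indicator (B i) (y(i := t)) \<partial>lborel_on ?J)
              \<le> indicator {T..} t * ennreal (C i * s powr a * t powr - a)"
          proof (cases "T < t")
            case True
            then have t: "0 < t" using T by simp
            have "(\<integral>\<^sup>+ y. indicator (B i) (y(i := t)) \<partial>lborel_on ?J)
                = (\<integral>\<^sup>+ y. indicator (sublevel ?J l (s / t)) y \<partial>lborel_on ?J)"
            proof (rule nn_integral_cong)
              fix y assume y: "y \<in> space (lborel_on ?J)"
              have "esym_on ?J l (y(i := t)) = esym_on ?J l y" by (intro esym_on_cong) auto
              moreover have "y(i := t) \<in> space (lborel_on I)"
                using y i by (auto simp: space_PiM PiE_iff extensional_def)
              ultimately have "y(i := t) \<in> B i \<longleftrightarrow> y \<in> sublevel ?J l (s / t)"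
                using True y by (auto simp: B_def sublevel_def)
              then show "indicator (B i) (y(i := t)) = (indicator (sublevel ?J l (s / t)) y :: ennreal)"
                by (simp add: indicator_def)
            qed
            also have "\<dots> = emeasure (lborel_on ?J) (sublevel ?J l (s / t))" using I by simp
            also have "\<dots> \<le> ennreal (C i * (s / t) powr a)" using C(2)[OF i, of "s / t"] s t by simp
            also have "(s / t) powr a = s powr a * t powr - a"
              using s t by (simp add: powr_divide powr_minus field_simps)
            finally show ?thesis using True by (simp add: mult.assoc fun_upd_def)
          next
            case False
            then have "(\<integral>\<^sup>+ y. indicator (B i) (y(i := t)) \<partial>lborel_on ?J) = (\<integral>\<^sup>+ y. 0 \<partial>lborel_on ?J)"
              by (intro nn_integral_cong) (auto simp: B_def indicator_def)
            then show ?thesis by simp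
          qed
        qed
        also have "\<dots> = ennreal (C i * s powr a * (T powr (1 - a) / (a - 1)))"
          using a T C(1)[OF i] by (intro nn_integral_powr_tail) auto
        also have "C i * s powr a * (T powr (1 - a) / (a - 1)) = C i / (a - 1) * s powr e"
        proof -
          have "1 \<le> card I" using Suc.prems by simp
          have la: "real l * a = real (card I) - 1"
            using False \<open>1 \<le> card I\<close> by (simp add: a_def of_nat_diff)
          have ex: "a + 1 / real (Suc l) * (1 - a) = e"
          proof -
            have "real (Suc l) * (a + 1 / real (Suc l) * (1 - a)) = real l * a + 1"
              by (simp add: field_simps)
            also have "\<dots> = real (Suc l) * e" using la by (simp add: e_def)
            finally show ?thesis by (metis mult_cancel_left of_nat_0_eq_iff old.nat.distinct(2))
          qed
          have "s powr a * T powr (1 - a) = s powr e"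
            unfolding T_def using ex by (simp add: powr_powr powr_add[symmetric] del: of_nat_Suc)
          then show ?thesis by (metis (no_types, opaque_lifting) mult.assoc mult.commute times_divide_eq_right)
        qed
        finally show ?thesis .
      qed
      have "emeasure (lborel_on I) (sublevel I (Suc l) s)
          \<le> emeasure (lborel_on I) ((I \<rightarrow>\<^sub>E {0..T}) \<union> (\<Union>i\<in>I. B i))"
        using sub I B_sets by (intro emeasure_mono) (auto intro!: sets.Un sets.finite_UN sets_PiM_I_finite)
      also have "\<dots> \<le> emeasure (lborel_on I) (I \<rightarrow>\<^sub>E {0..T}) + emeasure (lborel_on I) (\<Union>i\<in>I. B i)"
        using I B_sets by (intro emeasure_subadditive) (auto intro!: sets.finite_UN sets_PiM_I_finite)
      also have "\<dots> \<le> emeasure (lborel_on I) (I \<rightarrow>\<^sub>E {0..T}) + (\<Sum>i\<in>I. emeasure (lborel_on I) (B i))"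
        using I B_sets by (intro add_left_mono emeasure_subadditive_finite) auto
      also have "\<dots> \<le> ennreal (s powr e) + (\<Sum>i\<in>I. ennreal (C i / (a - 1) * s powr e))"
      proof (intro add_mono sum_mono Bi)
        show "emeasure (lborel_on I) (I \<rightarrow>\<^sub>E {0..T}) \<le> ennreal (s powr e)"
          unfolding cube[OF T] by (simp add: T_def powr_powr e_def)
      qed
      also have "\<dots> = ennreal (s powr e + (\<Sum>i\<in>I. C i / (a - 1) * s powr e))"
        using C(1) a by (subst sum_ennreal) (auto simp: ennreal_plus sum_nonneg)
      also have "s powr e + (\<Sum>i\<in>I. C i / (a - 1) * s powr e)
          = (1 + (\<Sum>i\<in>I. C i / (a - 1))) * s powr (real (card I) / real (Suc l))"
        by (simp add: algebra_simps sum_distrib_right e_def)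
      finally show "emeasure (lborel_on I) (sublevel I (Suc l) s)
          \<le> ennreal ((1 + (\<Sum>i\<in>I. C i / (a - 1))) * s powr (real (card I) / real (Suc l)))" .
    qed
  qed
qed

section \<open>Null sets and grid boxes\<close>

lemma null_set_coord_eq_0:
  assumes "finite I" "i \<in> I"
  shows "{y\<in>space (lborel_on I). y i = (0::real)} \<in> null_sets (lborel_on I)"
proof -
  have "{y\<in>space (lborel_on (insert i (I - {i}))). y i = (0::real)} \<in> null_sets (lborel_on (insert i (I - {i})))"
  proof (rule null_set_if_countable_sections)
    have [measurable]: "(\<lambda>y. y i) \<in> borel_measurable (lborel_on (insert i (I - {i})))"
      by (rule borel_measurable_coord) simp
    show "{y\<in>space (lborel_on (insert i (I - {i}))). y i = 0} \<in> sets (lborel_on (insert i (I - {i})))"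
      by measurable
    fix y :: "'a \<Rightarrow> real"
    show "countable {t. y(i := t) \<in> {y\<in>space (lborel_on (insert i (I - {i}))). y i = 0}}"
      by (rule countable_subset[of _ "{0}"]) auto
  qed (use assms in auto)
  then show ?thesis using assms by (simp add: insert_absorb)
qed

text \<open>As a function of one coordinate, the polynomial is affine, and its slope is positive
  when the other coordinates are. So each section contains at most one point.\<close>

lemma null_set_esym_on_eq:
  assumes I: "finite I" and l: "1 \<le> l" "l \<le> card I"
  shows "{y\<in>space (lborel_on I). (\<forall>k\<in>I. 0 < y k) \<and> esym_on I l y = (c::real)} \<in> null_sets (lborel_on I)"
proof -
  obtain i where i: "i \<in> I" using l I by fastforce
  obtain l' where l': "l = Suc l'" using l by (cases l) auto
  let ?J = "I - {i}"
  have ins: "insert i ?J = I" using i by auto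
  let ?A = "{y\<in>space (lborel_on I). (\<forall>k\<in>I. 0 < y k) \<and> esym_on I l y = c}"
  have "?A \<in> null_sets (lborel_on (insert i ?J))"
  proof (rule null_set_if_countable_sections)
    have [measurable]: "(\<lambda>y. esym_on I l y) \<in> borel_measurable (lborel_on I)"
      by (rule borel_measurable_esym_on) simp
    have 1: "{y\<in>space (lborel_on I). esym_on I l y = c} \<in> sets (lborel_on I)" by measurable
    have "{y\<in>space (lborel_on I). 0 < y k} \<in> sets (lborel_on I)" if "k \<in> I" for k
    proof -
      have [measurable]: "(\<lambda>y. y k) \<in> borel_measurable (lborel_on I)"
        using that by (rule borel_measurable_coord)
      show ?thesis by measurable
    qed
    then have 2: "{y\<in>space (lborel_on I). \<forall>k\<in>I. 0 < y k} \<in> sets (lborel_on I)"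
      using I by (intro sets.sets_Collect_finite_All')
        (use i in auto)
    show "?A \<in> sets (lborel_on (insert i ?J))"
      unfolding ins by (intro sets.sets_Collect_conj 1 2)
    fix y :: "'a \<Rightarrow> real"
    show "countable {t. y(i := t) \<in> ?A}"
    proof (cases "\<forall>k\<in>?J. 0 < y k")
      case True
      define b where "b = esym_on ?J l' y"
      define d where "d = esym_on ?J l y"
      have b: "0 < b" unfolding b_def using True I l l' i by (intro esym_on_pos) auto
      have eq: "esym_on I l (y(i := t)) = d + t * b" for t
      proof -
        have "esym_on ?J l (y(i := t)) = d" "esym_on ?J l' (y(i := t)) = b"
          unfolding d_def b_def by (intro esym_on_cong; simp)+
        then show ?thesis using esym_on_remove[OF I i, of l' "y(i := t)"] by (simp add: l')
      qed
      have "{t. y(i := t) \<in> ?A} \<subseteq> {(c - d) / b}"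
      proof
        fix t assume "t \<in> {t. y(i := t) \<in> ?A}"
        then have "d + t * b = c" using eq by simp
        then show "t \<in> {(c - d) / b}" using b by (auto simp: field_simps)
      qed
      then show ?thesis by (rule countable_subset) simp
    next
      case False
      then have "{t. y(i := t) \<in> ?A} = {}" by auto
      then show ?thesis by (simp only: countable_empty)
    qed
  qed (use I in auto)
  then show ?thesis unfolding ins .
qed

text \<open>The lattice point is the upper corner: by monotonicity, the box of a point of
  \<open>hyp_set\<close> then lies in the limiting region. The boxes are half-open so that distinct
  lattice points have disjoint boxes.\<close>

definition grid_box :: "'i set \<Rightarrow> real \<Rightarrow> ('i \<Rightarrow> nat) \<Rightarrow> ('i \<Rightarrow> real) set" where
  "grid_box I c v = (\<Pi>\<^sub>E i\<in>I. {(real (v i) - 1) / c <.. real (v i) / c})"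

lemma sets_grid_box [simp]: "finite I \<Longrightarrow> grid_box I c v \<in> sets (lborel_on I)"
  unfolding grid_box_def by (intro sets_PiM_I_finite) auto

lemma grid_box_unique:
  assumes c: "0 < c" and y: "y \<in> grid_box I c v" and i: "i \<in> I"
  shows "v i = nat \<lceil>c * y i\<rceil>"
proof -
  have "(real (v i) - 1) / c < y i" "y i \<le> real (v i) / c"
    using y i by (auto simp: grid_box_def PiE_iff)
  then have "real (v i) - 1 < c * y i" "c * y i \<le> real (v i)" using c by (auto simp: field_simps)
  then have "\<lceil>c * y i\<rceil> = int (v i)" by (intro ceiling_unique) auto
  then show ?thesis by simp
qed

lemma measure_grid_boxes:
  assumes I: "finite I" and c: "0 < c" and S: "finite S" "S \<subseteq> extensional I"
  shows "measure (lborel_on I) (\<Union>v\<in>S. grid_box I c v) = real (card S) / c ^ card I"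
proof -
  have one: "emeasure (lborel_on I) (grid_box I c v) = ennreal (1 / c ^ card I)" for v
  proof -
    have "emeasure (lborel_on I) (grid_box I c v)
        = (\<Prod>i\<in>I. emeasure lborel {(real (v i) - 1) / c <.. real (v i) / c})"
      unfolding grid_box_def using I by (intro lborel_prod.emeasure_PiM) auto
    also have "\<dots> = (\<Prod>i\<in>I. ennreal (1 / c))"
    proof (rule prod.cong)
      fix i
      have "(real (v i) - 1) / c \<le> real (v i) / c" using c by (simp add: divide_right_mono)
      then show "emeasure lborel {(real (v i) - 1) / c <.. real (v i) / c} = ennreal (1 / c)"
        by (simp add: diff_divide_distrib[symmetric])
    qed simp
    also have "\<dots> = ennreal ((1 / c) ^ card I)" using c by (simp add: ennreal_power)
    finally show ?thesis by (simp add: power_one_over)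
  qed
  have disj: "disjoint_family_on (grid_box I c) S"
    unfolding disjoint_family_on_def
  proof (intro ballI impI)
    fix v w assume vw: "v \<in> S" "w \<in> S" "v \<noteq> w"
    show "grid_box I c v \<inter> grid_box I c w = {}"
    proof (rule ccontr)
      assume "grid_box I c v \<inter> grid_box I c w \<noteq> {}"
      then obtain y where "y \<in> grid_box I c v" "y \<in> grid_box I c w" by auto
      then have "\<And>i. i \<in> I \<Longrightarrow> v i = w i" using grid_box_unique[OF c] by metis
      then have "v = w" using vw S by (intro extensionalityI[of v I w]) auto
      then show False using vw by simp
    qed
  qed
  have "emeasure (lborel_on I) (\<Union>v\<in>S. grid_box I c v) = (\<Sum>v\<in>S. emeasure (lborel_on I) (grid_box I c v))"
    using I S disj by (intro sum_emeasure[symmetric]) auto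
  also have "\<dots> = ennreal (real (card S) / c ^ card I)"
    using c unfolding one by (simp add: ennreal_of_nat_eq_real_of_nat ennreal_mult[symmetric])
  finally show ?thesis using c by (simp add: measure_def)
qed

lemma tendsto_ceiling_scaled:
  assumes y: "0 \<le> y" and c: "filterlim c at_top F"
  shows "((\<lambda>n. real (nat \<lceil>c n * y\<rceil>) / c n) \<longlongrightarrow> y) F"
proof (rule tendsto_sandwich)
  have ev: "\<forall>\<^sub>F n in F. 0 < c n" using c by (simp add: filterlim_at_top_dense)
  show "\<forall>\<^sub>F n in F. y \<le> real (nat \<lceil>c n * y\<rceil>) / c n"
    using ev
  proof eventually_elim
    case (elim n)
    have "c n * y \<le> real (nat \<lceil>c n * y\<rceil>)" by linarith
    then show ?case using elim by (simp add: field_simps)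
  qed
  show "\<forall>\<^sub>F n in F. real (nat \<lceil>c n * y\<rceil>) / c n \<le> y + 1 / c n"
    using ev
  proof eventually_elim
    case (elim n)
    have "0 \<le> c n * y" using elim y by simp
    then have "real (nat \<lceil>c n * y\<rceil>) \<le> c n * y + 1" by linarith
    then show ?case using elim by (simp add: field_simps)
  qed
  show "((\<lambda>n. y + 1 / c n) \<longlongrightarrow> y) F"
    using tendsto_add[OF tendsto_const real_tendsto_divide_at_top[OF tendsto_const c], of y 1] by simp
qed simp

lemma hyp_set_0: "1 \<le> l \<Longrightarrow> l \<le> r \<Longrightarrow> hyp_set l r 0 = {}"
  using hyp_set_le[of l r _ 0 1] hyp_set_ge1[of _ l r 0 1] by fastforce

lemma powr_inverse_nat_pow: "0 < x \<Longrightarrow> (x powr (1 / real l)) ^ k = x powr (real k / real l)"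
  by (simp add: powr_realpow[symmetric] powr_powr)

text \<open>With \<open>c = n powr (1 / l)\<close> one has \<open>c ^ l = n\<close>, which turns the
  level \<open>n\<close> into 1, and \<open>c ^ r = n powr (r / l)\<close>. Coordinates are positive
  because the boxes are open on the left and \<open>v k >= 1\<close>.\<close>

lemma grid_box_hyp_set:
  assumes l: "1 \<le> l" "l \<le> r" and n: "1 \<le> n" and v: "v \<in> hyp_set l r n"
    and y: "y \<in> grid_box {1..r} (real n powr (1 / real l)) v"
  shows "y \<in> sublevel {1..r} l 1"
    and "(\<Prod>k=1..r. y k) \<le> real (\<Prod>k=1..r. v k) / real n powr (real r / real l)"
    and "\<And>k. k \<in> {1..r} \<Longrightarrow> 0 < y k"
proof -
  define c where "c = real n powr (1 / real l)"
  have c: "0 < c" using n by (simp add: c_def)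
  have b: "(real (v k) - 1) / c < y k" "y k \<le> real (v k) / c" if "k \<in> {1..r}" for k
    using y that by (auto simp: grid_box_def PiE_iff c_def)
  show pos: "0 < y k" if "k \<in> {1..r}" for k
  proof -
    have "0 \<le> (real (v k) - 1) / c" using hyp_set_ge1[OF v that] c by simp
    then show ?thesis using b(1)[OF that] by linarith
  qed
  have b': "y k \<le> 1 / c * real (v k)" if "k \<in> {1..r}" for k using b(2)[OF that] by simp
  have "esym_on {1..r} l y \<le> esym_on {1..r} l (\<lambda>k. 1 / c * real (v k))"
    using pos b' by (intro esym_on_mono) (auto simp: less_imp_le)
  also have "\<dots> = (1 / c) ^ l * real (esym_on {1..r} l v)"
    unfolding esym_on_scale by (simp add: esym_on_def)
  also have "\<dots> \<le> (1 / c) ^ l * real n"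
    using v c by (intro mult_left_mono) (auto simp: hyp_set_iff)
  also have "\<dots> = 1"
    using powr_inverse_nat_pow[of "real n" l l] l n by (simp add: power_divide c_def)
  finally have "esym_on {1..r} l y \<le> 1" .
  moreover have "y \<in> space (lborel_on {1..r})"
    using y by (auto simp: grid_box_def PiE_iff space_PiM)
  ultimately show "y \<in> sublevel {1..r} l 1" using pos by (auto simp: sublevel_def less_imp_le)
  have "(\<Prod>k=1..r. y k) \<le> (\<Prod>k=1..r. real (v k) / c)"
    using pos b by (intro prod_mono) (auto simp: less_imp_le)
  also have "\<dots> = real (\<Prod>k=1..r. v k) / c ^ r" by (simp add: prod_dividef)
  finally show "(\<Prod>k=1..r. y k) \<le> real (\<Prod>k=1..r. v k) / real n powr (real r / real l)"
    using powr_inverse_nat_pow[of "real n" l r] n by (simp add: c_def)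
qed

lemma finite_emeasure_sublevel:
  assumes "1 \<le> l" "l < r" shows "emeasure (lborel_on {1..r}) (sublevel {1..r} l 1) < \<infinity>"
proof -
  obtain C where "\<forall>s>0. emeasure (lborel_on {1..r}) (sublevel {1..r} l s)
      \<le> ennreal (C * s powr (real r / real l))"
    using emeasure_sublevel_le[of "{1..r}" l] assms by auto
  then have "emeasure (lborel_on {1..r}) (sublevel {1..r} l 1) \<le> ennreal (C * 1 powr (real r / real l))"
    by (metis zero_less_one)
  also have "\<dots> < \<infinity>" by simp
  finally show ?thesis .
qed

text \<open>The scaled count is the volume of the union of the boxes, and all boxes lie in one set
  of finite volume. Dominated convergence therefore reduces a counting limit to a pointwise
  statement about which \<open>y\<close> are covered.\<close>

lemma tendsto_card_scaled:
  assumes l: "1 \<le> l" "l < r" and S: "\<And>n. S n \<subseteq> hyp_set l r n"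
    and A: "A \<in> sets (lborel_on {1..r})"
    and lim: "AE y in lborel_on {1..r}.
      (\<lambda>n. indicator (\<Union>v\<in>S n. grid_box {1..r} (real n powr (1 / real l)) v) y :: real)
        \<longlonglongrightarrow> indicator A y"
  shows "(\<lambda>n. real (card (S n)) / real n powr (real r / real l)) \<longlonglongrightarrow> measure (lborel_on {1..r}) A"
proof -
  let ?M = "lborel_on {1..r}"
  define B where "B n = (\<Union>v\<in>S n. grid_box {1..r} (real n powr (1 / real l)) v)" for n
  have fin: "finite (S n)" for n using finite_hyp_set[of l r n] l S by (metis finite_subset less_imp_le)
  have B: "B n \<in> sets ?M" for n unfolding B_def using fin by (intro sets.finite_UN) auto
  have sub: "B n \<subseteq> sublevel {1..r} l 1" for n
  proof (cases "n = 0")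
    \<comment> \<open>For \<open>n = 0\<close> the scale is 0, which \<open>grid_box_hyp_set\<close>
      excludes; there are no points then.\<close>
    case True
    then have "S n = {}" using S[of n] hyp_set_0[of l r] l by auto
    then show ?thesis by (simp add: B_def)
  next
    case False
    then show ?thesis using grid_box_hyp_set(1)[of l r n] l S[of n] by (fastforce simp: B_def)
  qed
  have B_space: "B n \<inter> space ?M = B n" for n using sets.sets_into_space[OF B] by blast
  have A_space: "A \<inter> space ?M = A" using sets.sets_into_space[OF A] by blast
  have "(\<lambda>n. \<integral>y. indicator (B n) y \<partial>?M :: real) \<longlonglongrightarrow> (\<integral>y. indicator A y \<partial>?M)"
  proof (rule integral_dominated_convergence[where w = "indicator (sublevel {1..r} l 1)"])
    show "integrable ?M (indicator (sublevel {1..r} l 1) :: _ \<Rightarrow> real)"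
      using finite_emeasure_sublevel[OF l] by (intro integrable_real_indicator) auto
    show "AE y in ?M. (\<lambda>n. indicator (B n) y :: real) \<longlonglongrightarrow> indicator A y"
      using lim unfolding B_def .
    show "AE y in ?M. norm (indicator (B n) y :: real) \<le> indicator (sublevel {1..r} l 1) y" for n
      using sub[of n] by (auto simp: indicator_def)
  qed (use A B in auto)
  then have "(\<lambda>n. measure ?M (B n)) \<longlonglongrightarrow> measure ?M A"
    unfolding Bochner_Integration.integral_indicator B_space A_space .
  moreover have "\<forall>\<^sub>F n in sequentially. measure ?M (B n) = real (card (S n)) / real n powr (real r / real l)"
    using eventually_ge_at_top[of 1]
  proof eventually_elim
    case (elim n)
    have "S n \<subseteq> extensional {1..r}" using S[of n] by (auto simp: hyp_set_iff PiE_iff)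
    then have "measure ?M (B n) = real (card (S n)) / (real n powr (1 / real l)) ^ card {1..r}"
      unfolding B_def using elim fin by (intro measure_grid_boxes) auto
    then show ?case using powr_inverse_nat_pow[of "real n" l r] elim by simp
  qed
  ultimately show ?thesis by (rule Lim_transform_eventually)
qed

lemma filterlim_powr_inverse_nat: "1 \<le> l \<Longrightarrow> filterlim (\<lambda>n. real n powr (1 / real l)) at_top sequentially"
  by (intro filterlim_compose[OF real_powr_at_top filterlim_real_sequentially]) auto

lemma AE_pos_sublevel:
  assumes "finite I"
  shows "AE y in lborel_on I. y \<in> sublevel I l s \<longrightarrow> (\<forall>i\<in>I. 0 < y i)"
proof -
  have "AE y in lborel_on I. \<forall>i\<in>I. y i \<noteq> 0"
    using assms null_set_coord_eq_0[OF assms]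
    by (intro AE_finite_allI) (auto intro: AE_I'[OF null_set_coord_eq_0])
  then show ?thesis
    by eventually_elim (force simp: sublevel_def)
qed

text \<open>A box with \<open>v i = 1\<close> reaches up to \<open>1 / c\<close> in direction
  \<open>i\<close>, and \<open>c\<close> tends to infinity, so a point with \<open>y i > 0\<close>
  is eventually left uncovered. The other points are never covered.\<close>

lemma tendsto_card_face_scaled:
  assumes l: "1 \<le> l" "l < r" and i: "i \<in> {1..r}"
  shows "(\<lambda>n. real (card {v\<in>hyp_set l r n. v i = 1}) / real n powr (real r / real l)) \<longlonglongrightarrow> 0"
proof -
  let ?S = "\<lambda>n. {v\<in>hyp_set l r n. v i = 1}"
  let ?c = "\<lambda>n. real n powr (1 / real l)"
  have "(\<lambda>n. real (card (?S n)) / real n powr (real r / real l)) \<longlonglongrightarrow> measure (lborel_on {1..r}) {}"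
  proof (rule tendsto_card_scaled[OF l])
    have "AE y in lborel_on {1..r}. y i \<noteq> 0"
      by (rule AE_I'[OF null_set_coord_eq_0[OF _ i]]) auto
    then show "AE y in lborel_on {1..r}. (\<lambda>n. indicator (\<Union>v\<in>?S n. grid_box {1..r} (?c n) v) y :: real)
        \<longlonglongrightarrow> indicator {} y"
    proof eventually_elim
      case (elim y)
      have "\<forall>\<^sub>F n in sequentially. y \<notin> (\<Union>v\<in>?S n. grid_box {1..r} (?c n) v)"
      proof (cases "0 < y i")
        case True
        have "\<forall>\<^sub>F n in sequentially. 1 / y i < ?c n"
          using filterlim_powr_inverse_nat[OF l(1)] by (simp add: filterlim_at_top_dense)
        then show ?thesis
          using eventually_gt_at_top[of 0]
        proof eventually_elim
          case (elim n)
          show ?case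
          proof
            assume "y \<in> (\<Union>v\<in>?S n. grid_box {1..r} (?c n) v)"
            then obtain v where v: "v i = 1" "y \<in> grid_box {1..r} (?c n) v" by auto
            then have "y i \<in> {(real (v i) - 1) / ?c n<..real (v i) / ?c n}"
              using PiE_mem[OF v(2)[unfolded grid_box_def] i] by simp
            then have "y i \<le> 1 / ?c n" using v(1) by simp
            then show False using elim True by (simp add: field_simps)
          qed
        qed
      next
        case False
        show ?thesis using eventually_ge_at_top[of 1]
        proof eventually_elim
          case (elim n)
          then show ?case using grid_box_hyp_set(3)[of l r n _ y i] l i False by auto
        qed
      qed
      then have "\<forall>\<^sub>F n in sequentially. indicator (\<Union>v\<in>?S n. grid_box {1..r} (?c n) v) y = (0::real)"
        by eventually_elim simp
      then show ?case by (simp add: tendsto_eventually)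
    qed
  qed auto
  then show ?thesis by simp
qed

section \<open>Lattice points with bounded product\<close>

definition prod_sublevel :: "nat \<Rightarrow> nat \<Rightarrow> real \<Rightarrow> (nat \<Rightarrow> real) set" where
  "prod_sublevel l r x = {y\<in>sublevel {1..r} l 1. (\<Prod>k=1..r. y k) \<le> x}"

lemma sets_prod_sublevel [simp]: "prod_sublevel l r x \<in> sets (lborel_on {1..r})"
proof -
  have [measurable]: "(\<lambda>y. \<Prod>k=1..r. y k) \<in> borel_measurable (lborel_on {1..r})"
    by (intro borel_measurable_prod borel_measurable_coord)
  have "prod_sublevel l r x = sublevel {1..r} l 1 \<inter> {y\<in>space (lborel_on {1..r}). (\<Prod>k=1..r. y k) \<le> x}"
    by (auto simp: prod_sublevel_def sublevel_def)
  also have "\<dots> \<in> sets (lborel_on {1..r})" by (intro sets.Int sets_sublevel) auto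
  finally show ?thesis .
qed

text \<open>Off the null sets where an inequality is an equality or a coordinate is 0, the
  indicators are eventually constant. If \<open>y\<close> satisfies both inequalities strictly, so
  do the scaled corners above it for large \<open>n\<close>, because they tend to \<open>y\<close>.
  Conversely, a covered \<open>y\<close> lies below an admissible corner, and both polynomials are
  monotone.\<close>

lemma tendsto_card_prod_le_scaled:
  assumes l: "1 \<le> l" "l < r"
  shows "(\<lambda>n. real (card {v\<in>hyp_set l r n. real (\<Prod>k=1..r. v k) \<le> x * real n powr (real r / real l)})
            / real n powr (real r / real l)) \<longlonglongrightarrow> measure (lborel_on {1..r}) (prod_sublevel l r x)"
proof (rule tendsto_card_scaled[OF l])
  let ?M = "lborel_on {1..r}"
  let ?S = "\<lambda>n. {v\<in>hyp_set l r n. real (\<Prod>k=1..r. v k) \<le> x * real n powr (real r / real l)}"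
  let ?c = "\<lambda>n. real n powr (1 / real l)"
  have lr: "l \<le> r" using l by simp
  have e1: "AE y in ?M. (\<forall>k\<in>{1..r}. 0 < y k) \<longrightarrow> esym_on {1..r} l y \<noteq> 1"
    by (rule AE_I'[OF null_set_esym_on_eq[of "{1..r}" l 1]]) (use l in auto)
  \<comment> \<open>The product is \<open>esym_on\<close> of degree \<open>r\<close>, so the null
    set lemma covers its level sets as well.\<close>
  have e2: "AE y in ?M. (\<forall>k\<in>{1..r}. 0 < y k) \<longrightarrow> esym_on {1..r} r y \<noteq> x"
    by (rule AE_I'[OF null_set_esym_on_eq[of "{1..r}" r x]]) (use l in auto)
  have e3: "AE y in ?M. y \<in> sublevel {1..r} l 1 \<longrightarrow> (\<forall>i\<in>{1..r}. 0 < y i)"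
    by (rule AE_pos_sublevel) simp
  show "AE y in ?M. (\<lambda>n. indicator (\<Union>v\<in>?S n. grid_box {1..r} (?c n) v) y :: real)
      \<longlonglongrightarrow> indicator (prod_sublevel l r x) y"
    using e1 e2 e3
  proof eventually_elim
    case (elim y)
    show ?case
    proof (cases "y \<in> prod_sublevel l r x")
      case True
      then have pos: "\<And>k. k \<in> {1..r} \<Longrightarrow> 0 < y k" and lt1: "esym_on {1..r} l y < 1"
        and lt2: "(\<Prod>k=1..r. y k) < x"
        using elim esym_on_card[of "{1..r}" y]
        by (auto simp: prod_sublevel_def sublevel_def order_less_le)
      \<comment> \<open>The only candidate for a lattice point whose box contains \<open>y\<close>;
        the restriction makes it extensional, as \<open>hyp_set\<close> requires.\<close>
      define w where "w n = (\<lambda>k\<in>{1..r}. nat \<lceil>?c n * y k\<rceil>)" for n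
      have wlim: "(\<lambda>n. real (w n k) / ?c n) \<longlonglongrightarrow> y k" if "k \<in> {1..r}" for k
        unfolding w_def using tendsto_ceiling_scaled[OF _ filterlim_powr_inverse_nat[OF l(1)], of "y k"]
          pos[OF that] that by simp
      have "(\<lambda>n. esym_on {1..r} l (\<lambda>k. real (w n k) / ?c n)) \<longlonglongrightarrow> esym_on {1..r} l y"
        unfolding esym_on_def by (intro tendsto_sum tendsto_prod wlim) auto
      then have ev1: "\<forall>\<^sub>F n in sequentially. esym_on {1..r} l (\<lambda>k. real (w n k) / ?c n) < 1"
        using lt1 by (rule order_tendstoD)
      have "(\<lambda>n. \<Prod>k=1..r. real (w n k) / ?c n) \<longlonglongrightarrow> (\<Prod>k=1..r. y k)"
        by (intro tendsto_prod wlim)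
      then have ev2: "\<forall>\<^sub>F n in sequentially. (\<Prod>k=1..r. real (w n k) / ?c n) < x"
        using lt2 by (rule order_tendstoD)
      have "\<forall>\<^sub>F n in sequentially. indicator (\<Union>v\<in>?S n. grid_box {1..r} (?c n) v) y = (1::real)"
        using ev1 ev2 eventually_ge_at_top[of 1]
      proof eventually_elim
        case (elim n)
        have c: "0 < ?c n" using elim by simp
        have w1: "1 \<le> w n k" if "k \<in> {1..r}" for k
          using pos[OF that] c that by (simp add: w_def Suc_le_eq)
        have "esym_on {1..r} l (\<lambda>k. real (w n k) / ?c n) = (1 / ?c n) ^ l * real (esym_on {1..r} l (w n))"
          using esym_on_scale[of "{1..r}" l "1 / ?c n" "\<lambda>k. real (w n k)"] by (simp add: esym_on_def)
        also have "\<dots> = real (esym_on {1..r} l (w n)) / real n"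
          using powr_inverse_nat_pow[of "real n" l l] l elim by (simp add: power_divide)
        finally have "real (esym_on {1..r} l (w n)) / real n < 1" using elim(1) by linarith
        then have "real (esym_on {1..r} l (w n)) \<le> real n"
          using elim(3) by (simp add: divide_less_eq)
        then have wH: "w n \<in> hyp_set l r n" using w1 by (simp add: hyp_set_iff w_def PiE_iff)
        have "(\<Prod>k=1..r. real (w n k) / ?c n) = real (\<Prod>k=1..r. w n k) / real n powr (real r / real l)"
          using powr_inverse_nat_pow[of "real n" l r] elim by (simp add: prod_dividef)
        then have "real (\<Prod>k=1..r. w n k) / real n powr (real r / real l) < x"
          using elim(2) by linarith
        then have "real (\<Prod>k=1..r. w n k) \<le> x * real n powr (real r / real l)"
          using elim(3) by (simp add: divide_less_eq)
        then have wS: "w n \<in> ?S n" using wH by simp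
        have "y \<in> grid_box {1..r} (?c n) (w n)"
          unfolding grid_box_def
        proof (rule PiE_I)
          fix k assume k: "k \<in> {1..r}"
          have p: "0 < ?c n * y k" using c pos[OF k] by simp
          have wk: "real (w n k) = of_int \<lceil>?c n * y k\<rceil>" using p k by (simp add: w_def)
          have "real (w n k) - 1 < ?c n * y k" "?c n * y k \<le> real (w n k)"
            unfolding wk by linarith+
          then show "y k \<in> {(real (w n k) - 1) / ?c n<..real (w n k) / ?c n}"
            using c by (simp add: field_simps)
        next
          fix k assume "k \<notin> {1..r}"
          then show "y k = undefined"
            using True by (auto simp: prod_sublevel_def sublevel_def space_PiM PiE_iff extensional_def)
        qed
        then have "y \<in> (\<Union>v\<in>?S n. grid_box {1..r} (?c n) v)" by (rule UN_I[OF wS])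
        then show ?case by (simp only: indicator_simps)
      qed
      then show ?thesis using True by (simp add: tendsto_eventually)
    next
      case False
      have "\<forall>\<^sub>F n in sequentially. indicator (\<Union>v\<in>?S n. grid_box {1..r} (?c n) v) y = (0::real)"
        using eventually_ge_at_top[of 1]
      proof eventually_elim
        case (elim n)
        have "y \<notin> (\<Union>v\<in>?S n. grid_box {1..r} (?c n) v)"
        proof
          assume "y \<in> (\<Union>v\<in>?S n. grid_box {1..r} (?c n) v)"
          then obtain v where v: "v \<in> hyp_set l r n"
            "real (\<Prod>k=1..r. v k) \<le> x * real n powr (real r / real l)"
            "y \<in> grid_box {1..r} (?c n) v" by blast
          note g = grid_box_hyp_set(1,2)[OF l(1) lr elim v(1,3)]
          have "real (\<Prod>k=1..r. v k) / real n powr (real r / real l) \<le> x"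
            using v(2) elim by (simp add: field_simps)
          then have "y \<in> prod_sublevel l r x" using g by (simp add: prod_sublevel_def)
          then show False using False by simp
        qed
        then show ?case by simp
      qed
      then show ?thesis using False by (simp add: tendsto_eventually)
    qed
  qed
  show "prod_sublevel l r x \<in> sets ?M" by (rule sets_prod_sublevel)
qed auto

section \<open>Volumes in the law of \<open>U\<close>\<close>

lemma vol_total_eq: "vol_total l r = measure (lborel_on {1..r}) (sublevel {1..r} l 1)"
proof -
  have "{y \<in> {1..r} \<rightarrow>\<^sub>E {0..}. esym l r y \<le> 1} = sublevel {1..r} l (1::real)"
    by (auto simp: sublevel_def space_PiM PiE_iff esym_eq_esym_on)
  then show ?thesis by (simp add: vol_total_def)
qed

lemma vol_below_eq: "vol_below l r x = measure (lborel_on {1..r}) (prod_sublevel l r x)"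
proof -
  have "{y. (\<forall>i\<in>{1..r}. 0 \<le> y i) \<and> esym l r y \<le> 1 \<and> (\<Prod>i=1..r. y i) \<le> x} \<inter> space (lborel_on {1..r})
      = prod_sublevel l r x"
    by (auto simp: prod_sublevel_def sublevel_def esym_eq_esym_on)
  then show ?thesis by (simp add: vol_below_def)
qed

lemma vol_total_pos:
  assumes l: "1 \<le> l" "l < r" shows "0 < vol_total l r"
proof -
  \<comment> \<open>On the cube with this side the polynomial is at most
    \<open>(r choose l) * e ^ l\<close>, and \<open>e ^ l <= e\<close> because
    \<open>e <= 1\<close>.\<close>
  define e where "e = 1 / real (r choose l)"
  have "1 \<le> r choose l" using l by (simp add: Suc_le_eq less_imp_le)
  then have ch: "1 \<le> real (r choose l)" by linarith
  have e: "0 < e" "e \<le> 1"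
    using l frac_le[of 1 1 1 "real (r choose l)"] ch by (simp_all add: e_def)
  have "({1..r} \<rightarrow>\<^sub>E {0..e}) \<subseteq> sublevel {1..r} l 1"
  proof
    fix y assume y: "y \<in> {1..r} \<rightarrow>\<^sub>E {0..e}"
    have "esym_on {1..r} l y \<le> esym_on {1..r} l (\<lambda>_. e)"
      using y by (intro esym_on_mono) (auto simp: PiE_iff)
    also have "\<dots> = real (r choose l) * e ^ l" using esym_on_const[of "{1..r}" l e] by simp
    also have "\<dots> \<le> real (r choose l) * e ^ 1"
      using e l by (intro mult_left_mono power_decreasing) auto
    also have "\<dots> = 1" using l by (simp add: e_def)
    finally show "y \<in> sublevel {1..r} l 1" using y by (auto simp: sublevel_def space_PiM PiE_iff)
  qed
  moreover have "emeasure (lborel_on {1..r}) ({1..r} \<rightarrow>\<^sub>E {0..e}) = ennreal (e ^ r)"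
    using e lborel_prod.emeasure_PiM[of "{1..r}" "\<lambda>_. {0..e}"] by (simp add: ennreal_power)
  ultimately have "ennreal (e ^ r) \<le> emeasure (lborel_on {1..r}) (sublevel {1..r} l 1)"
    by (metis emeasure_mono finite_atLeastAtMost sets_sublevel)
  then have "0 < emeasure (lborel_on {1..r}) (sublevel {1..r} l 1)"
    using e by (metis ennreal_less_zero_iff less_le_trans zero_less_power)
  then show ?thesis unfolding vol_total_eq measure_def
    using finite_emeasure_sublevel[OF l] by (simp add: enn2real_positive_iff)
qed

lemma vol_below_eq_vol_total:
  assumes l: "1 \<le> l" "l \<le> r" and x: "real (r choose l) powr (- (real r / real l)) \<le> x"
  shows "vol_below l r x = vol_total l r"
proof -
  have "(\<Prod>k=1..r. y k) \<le> x" if "y \<in> sublevel {1..r} l 1" for y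
  proof -
    have "(\<Prod>k=1..r. y k) \<le> (1 / real (r choose l)) powr (real r / real l)"
      using prod_le_of_esym_on_le[of "{1..r}" l y 1] that l by (simp add: sublevel_def)
    also have "\<dots> = real (r choose l) powr (- (real r / real l))"
      using l by (simp add: powr_minus powr_divide field_simps)
    finally show ?thesis using x by linarith
  qed
  then have "prod_sublevel l r x = sublevel {1..r} l 1" by (auto simp: prod_sublevel_def)
  then show ?thesis by (simp add: vol_below_eq vol_total_eq)
qed

text \<open>This is the case \<open>x = 1\<close> of the preceding count, where the bound on the
  product holds automatically, for lattice points and in the limiting region alike.\<close>

lemma tendsto_card_hyp_set_scaled:
  assumes l: "1 \<le> l" "l < r"
  shows "(\<lambda>n. real (card (hyp_set l r n)) / real n powr (real r / real l)) \<longlonglongrightarrow> vol_total l r"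
proof -
  have lr: "l \<le> r" using l by simp
  have "1 \<le> r choose l" using l by (simp add: Suc_le_eq less_imp_le)
  then have "1 \<le> real (r choose l)" by linarith
  then have "real (r choose l) powr (- (real r / real l)) \<le> real (r choose l) powr 0"
    by (intro powr_mono) auto
  then have "vol_below l r 1 = vol_total l r"
    using l \<open>1 \<le> real (r choose l)\<close> by (intro vol_below_eq_vol_total) auto
  moreover have "{v\<in>hyp_set l r n. real (\<Prod>k=1..r. v k) \<le> 1 * real n powr (real r / real l)} = hyp_set l r n" for n
    using hyp_set_prod_le[OF l(1) lr] by auto
  ultimately show ?thesis
    using tendsto_card_prod_le_scaled[OF l, of 1] by (simp only: vol_below_eq[symmetric])
qed



lemma tendsto_ratio_of_scaled:
  assumes l: "1 \<le> l" "l < r" and a: "(\<lambda>n. a n / real n powr (real r / real l)) \<longlonglongrightarrow> A"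
  shows "(\<lambda>n. a n / real (card (hyp_set l r n))) \<longlonglongrightarrow> A / vol_total l r"
proof -
  have "(\<lambda>n. (a n / real n powr (real r / real l)) / (real (card (hyp_set l r n)) / real n powr (real r / real l)))
      \<longlonglongrightarrow> A / vol_total l r"
    using vol_total_pos[OF l] by (intro tendsto_divide a tendsto_card_hyp_set_scaled l) auto
  moreover have "\<forall>\<^sub>F n in sequentially.
    (a n / real n powr (real r / real l)) / (real (card (hyp_set l r n)) / real n powr (real r / real l))
      = a n / real (card (hyp_set l r n))"
    using eventually_ge_at_top[of 1] by eventually_elim simp
  ultimately show ?thesis by (rule Lim_transform_eventually)
qed

lemma hyp_set_face_negligible:
  assumes r: "2 \<le> r" and l: "1 \<le> l" "l \<le> r" and i: "i \<in> {1..r}"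
  shows "(\<lambda>n. real (card {v\<in>hyp_set l r n. v i = 1}) / real (card (hyp_set l r n))) \<longlonglongrightarrow> 0"
proof (cases "l = r")
  case True
  then show ?thesis using hyperbola_face_negligible[OF r i] by simp
next
  case False
  then have lr: "l < r" using l by simp
  show ?thesis using tendsto_ratio_of_scaled[OF l(1) lr tendsto_card_face_scaled[OF l(1) lr i]] by simp
qed

section \<open>Joint law of valuations and rescaled product\<close>

lemma tendsto_prod_law:
  assumes r: "2 \<le> r" and l: "1 \<le> l" "l \<le> r" and N: "prob_space N" and U: "has_U_law l r N U" and x: "0 \<le> x"
  shows "(\<lambda>n. real (card {v\<in>hyp_set l r n. real (\<Prod>k=1..r. v k) \<le> x * real n powr (real r / real l)})
            / real (card (hyp_set l r n))) \<longlonglongrightarrow> measure N {\<omega>\<in>space N. U \<omega> \<le> x}"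
proof -
  interpret N: prob_space N by (rule N)
  have [measurable]: "U \<in> borel_measurable N" using U by (simp add: has_U_law_def)
  show ?thesis
  proof (cases "l = r")
    case True
    have n_powr: "real n powr (real r / real l) = real n" for n using True r by simp
    have d: "distr N borel U = uniform_measure lborel {0..1}" using U True by (simp add: has_U_law_def)
    have "measure N {\<omega>\<in>space N. U \<omega> \<le> x} = measure (distr N borel U) {..x}"
      by (subst measure_distr) (auto intro!: arg_cong[where f = "measure N"])
    also have "\<dots> = measure lborel ({0..1} \<inter> {..x}) / measure lborel {0..1::real}"
      unfolding d by (rule measure_uniform_measure) auto
    also have "{0..1} \<inter> {..x} = {0..min 1 x}" by auto
    finally have F: "measure N {\<omega>\<in>space N. U \<omega> \<le> x} = min 1 x" using x by simp
    have pos: "\<forall>\<^sub>F n in sequentially. 0 < card (hyp_set r r n)"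
      using eventually_ge_at_top[of 1] by eventually_elim (use r in \<open>auto intro!: card_hyp_set_pos\<close>)
    show ?thesis
    proof (cases "x \<le> 1")
      case x1: True
      let ?c = "\<lambda>n. real (card {v\<in>hyp_set r r n. real (\<Prod>k=1..r. v k) \<le> x * real n})"
      let ?h = "\<lambda>n. real (card (hyp_set r r n))"
      have "(\<lambda>n. ?c n / ?h n - x) \<longlonglongrightarrow> 0"
      proof (rule Lim_null_comparison)
        show "(\<lambda>n. real (card {v\<in>hyp_set r r n. v 1 = 1}) / ?h n) \<longlonglongrightarrow> 0"
          using r by (intro hyperbola_face_negligible) auto
        show "\<forall>\<^sub>F n in sequentially. norm (?c n / ?h n - x) \<le> real (card {v\<in>hyp_set r r n. v 1 = 1}) / ?h n"
          using pos
        proof eventually_elim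
          case (elim n)
          then have h: "0 < ?h n" by simp
          have "\<bar>?c n - x * ?h n\<bar> \<le> real (card {v\<in>hyp_set r r n. v 1 = 1})"
            using r x x1 by (intro abs_card_prod_le_hyperbola) auto
          then have "\<bar>?c n - x * ?h n\<bar> / ?h n \<le> real (card {v\<in>hyp_set r r n. v 1 = 1}) / ?h n"
            using h by (intro divide_right_mono) auto
          moreover have "?c n / ?h n - x = (?c n - x * ?h n) / ?h n" using h by (simp add: field_simps)
          ultimately show ?case using h by (simp only: real_norm_def abs_divide abs_of_pos)
        qed
      qed
      then have "(\<lambda>n. ?c n / ?h n) \<longlonglongrightarrow> x" by (rule LIM_zero_cancel)
      then show ?thesis unfolding F n_powr using x1 True by (simp add: min_def)
    next
      case False
      have "\<forall>\<^sub>F n in sequentially. real (card {v\<in>hyp_set l r n. real (\<Prod>k=1..r. v k) \<le> x * real n powr (real r / real l)})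
            / real (card (hyp_set l r n)) = 1"
        using pos
      proof eventually_elim
        case (elim n)
        have "{v\<in>hyp_set l r n. real (\<Prod>k=1..r. v k) \<le> x * real n powr (real r / real l)} = hyp_set l r n"
        proof -
          have "real (\<Prod>k=1..r. v k) \<le> x * real n powr (real r / real l)" if "v \<in> hyp_set l r n" for v
          proof -
            have "real (\<Prod>k=1..r. v k) \<le> 1 * real n powr (real r / real l)"
              using hyp_set_prod_le[OF l that] by simp
            also have "\<dots> \<le> x * real n powr (real r / real l)"
              using False by (intro mult_right_mono) auto
            finally show ?thesis .
          qed
          then show ?thesis by auto
        qed
        then show ?case using elim True by (simp only: divide_self_if) simp
      qed
      then show ?thesis unfolding F using False by (simp add: tendsto_eventually)
    qed
  next
    case False
    then have lr: "l < r" using l by simp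
    define cm where "cm = real (r choose l) powr (- (real r / real l))"
    have law: "measure N {\<omega>\<in>space N. U \<omega> \<le> z} = vol_below l r z / vol_total l r" if "0 \<le> z" "z \<le> cm" for z
      using U that False by (simp add: has_U_law_def cm_def)
    have "(\<lambda>n. real (card {v\<in>hyp_set l r n. real (\<Prod>k=1..r. v k) \<le> x * real n powr (real r / real l)})
            / real (card (hyp_set l r n))) \<longlonglongrightarrow> vol_below l r x / vol_total l r"
      unfolding vol_below_eq
      by (rule tendsto_ratio_of_scaled[OF l(1) lr tendsto_card_prod_le_scaled[OF l(1) lr]])
    also have "vol_below l r x / vol_total l r = measure N {\<omega>\<in>space N. U \<omega> \<le> x}"
    proof (cases "x \<le> cm")
      case True
      then show ?thesis using law x by simp
    next
      \<comment> \<open>\<open>has_U_law\<close> prescribes no values beyond \<open>cm\<close>. At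
        \<open>cm\<close> the distribution function is already 1, and monotonicity carries this to
        all larger \<open>x\<close>.\<close>
      case F: False
      have "measure N {\<omega>\<in>space N. U \<omega> \<le> cm} = 1"
        using law[of cm] vol_below_eq_vol_total[OF l, of cm] vol_total_pos[OF l(1) lr]
        by (simp add: cm_def)
      moreover have "measure N {\<omega>\<in>space N. U \<omega> \<le> cm} \<le> measure N {\<omega>\<in>space N. U \<omega> \<le> x}"
        using F by (intro N.finite_measure_mono) auto
      ultimately have "measure N {\<omega>\<in>space N. U \<omega> \<le> x} = 1"
        using N.prob_le_1[of "{\<omega>\<in>space N. U \<omega> \<le> x}"] by linarith
      then show ?thesis
        using vol_below_eq_vol_total[OF l, of x] F vol_total_pos[OF l(1) lr] by (simp add: cm_def)
    qed
    finally show ?thesis .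
  qed
qed

text \<open>Read off from the limit at \<open>x = 0\<close>, where no point is counted, and at
  \<open>x = 1\<close>, where every point is. This treats both forms of the law at once.\<close>

lemma prob_U_le_0_and_1:
  assumes r: "2 \<le> r" and l: "1 \<le> l" "l \<le> r" and N: "prob_space N" and U: "has_U_law l r N U"
  shows "measure N {\<omega>\<in>space N. U \<omega> \<le> 0} = 0" and "measure N {\<omega>\<in>space N. U \<omega> \<le> 1} = 1"
proof -
  have "{v\<in>hyp_set l r n. real (\<Prod>k=1..r. v k) \<le> 0 * real n powr (real r / real l)} = {}" for n
    using hyp_set_prod_pos by (fastforce simp flip: of_nat_prod)
  then have "(\<lambda>n. 0::real) \<longlonglongrightarrow> measure N {\<omega>\<in>space N. U \<omega> \<le> 0}"
    using tendsto_prod_law[OF r l N U, of 0] by (simp only: card.empty) simp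
  then show "measure N {\<omega>\<in>space N. U \<omega> \<le> 0} = 0" using LIMSEQ_unique tendsto_const by blast
  have "{v\<in>hyp_set l r n. real (\<Prod>k=1..r. v k) \<le> 1 * real n powr (real r / real l)} = hyp_set l r n" for n
    using hyp_set_prod_le[OF l] by auto
  then have "(\<lambda>n. real (card (hyp_set l r n)) / real (card (hyp_set l r n))) \<longlonglongrightarrow> measure N {\<omega>\<in>space N. U \<omega> \<le> 1}"
    using tendsto_prod_law[OF r l N U, of 1] by (simp only: zero_le_one)
  moreover have "\<forall>\<^sub>F n in sequentially. real (card (hyp_set l r n)) / real (card (hyp_set l r n)) = 1"
    using eventually_ge_at_top[of "r choose l"]
    by eventually_elim (use card_hyp_set_pos[OF l] in auto)
  ultimately have "(\<lambda>n. 1::real) \<longlonglongrightarrow> measure N {\<omega>\<in>space N. U \<omega> \<le> 1}"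
    by (rule Lim_transform_eventually)
  then show "measure N {\<omega>\<in>space N. U \<omega> \<le> 1} = 1" using LIMSEQ_unique tendsto_const by blast
qed

text \<open>The limit is a function of \<open>x\<close> times a function of \<open>d\<close>. This
  factorization is the source of the independence of \<open>U\<close> and the valuations.\<close>

lemma tendsto_dvd_law:
  assumes r: "2 \<le> r" and l: "1 \<le> l" "l \<le> r" and N: "prob_space N" and U: "has_U_law l r N U" and x: "0 \<le> x"
    and d: "\<And>k. k \<in> {1..r} \<Longrightarrow> 1 \<le> d k"
  shows "(\<lambda>n. real (card {v\<in>hyp_set l r n. real (\<Prod>k=1..r. v k) \<le> x * real n powr (real r / real l)
              \<and> (\<forall>k\<in>{1..r}. d k dvd v k)})
            / real (card (hyp_set l r n)))
          \<longlonglongrightarrow> measure N {\<omega>\<in>space N. U \<omega> \<le> x} / (\<Prod>k=1..r. real (d k))"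
proof -
  let ?A = "\<lambda>n. {v\<in>hyp_set l r n. real (\<Prod>k=1..r. v k) \<le> x * real n powr (real r / real l)}"
  let ?B = "\<lambda>n. {v\<in>hyp_set l r n. real (\<Prod>k=1..r. v k) \<le> x * real n powr (real r / real l)
              \<and> (\<forall>k\<in>{1..r}. d k dvd v k)}"
  let ?h = "\<lambda>n. real (card (hyp_set l r n))"
  let ?P = "\<Prod>k=1..r. real (d k)"
  let ?e = "\<lambda>n. \<Sum>k=1..r. real (card {v\<in>hyp_set l r n. v k = 1}) / ?h n"
  have "(\<lambda>n. real (card (?B n)) / ?h n - real (card (?A n)) / ?h n / ?P) \<longlonglongrightarrow> 0"
  proof (rule Lim_null_comparison)
    have "?e \<longlonglongrightarrow> (\<Sum>k=1..r. 0)"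
      by (intro tendsto_sum hyp_set_face_negligible[OF r l])
    then show "?e \<longlonglongrightarrow> 0" by simp
    show "\<forall>\<^sub>F n in sequentially. norm (real (card (?B n)) / ?h n - real (card (?A n)) / ?h n / ?P) \<le> ?e n"
    proof (rule always_eventually, rule allI)
      fix n
      have fin: "finite (hyp_set l r n)" by (rule finite_hyp_set[OF l])
      have BA: "?B n = {v\<in>?A n. \<forall>k\<in>{1..r}. d k dvd v k}" by auto
      have "\<bar>real (card (?B n)) - real (card (?A n)) / ?P\<bar> \<le> (\<Sum>k=1..r. real (card {v\<in>?A n. v k = 1}))"
        unfolding BA using fin d by (intro card_coords_dvd lower_at_hyp_set_prod_le) auto
      also have "\<dots> \<le> (\<Sum>k=1..r. real (card {v\<in>hyp_set l r n. v k = 1}))"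
        using fin by (intro sum_mono of_nat_mono card_mono) auto
      finally have "\<bar>real (card (?B n)) - real (card (?A n)) / ?P\<bar> / ?h n
          \<le> (\<Sum>k=1..r. real (card {v\<in>hyp_set l r n. v k = 1})) / ?h n"
        by (rule divide_right_mono) simp
      also have "\<dots> = ?e n" by (rule sum_divide_distrib)
      finally have "\<bar>real (card (?B n)) - real (card (?A n)) / ?P\<bar> / ?h n \<le> ?e n" .
      moreover have "real (card (?B n)) / ?h n - real (card (?A n)) / ?h n / ?P
          = (real (card (?B n)) - real (card (?A n)) / ?P) / ?h n"
        by (simp only: diff_divide_distrib divide_divide_eq_left mult.commute)
      ultimately show "norm (real (card (?B n)) / ?h n - real (card (?A n)) / ?h n / ?P) \<le> ?e n"
        by (simp only: real_norm_def abs_divide abs_of_nat)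
    qed
  qed
  moreover have "(\<lambda>n. real (card (?A n)) / ?h n / ?P) \<longlonglongrightarrow> measure N {\<omega>\<in>space N. U \<omega> \<le> x} / ?P"
  proof (intro tendsto_divide tendsto_prod_law[OF r l N U x] tendsto_const)
    have "real (d k) \<noteq> 0" if "k \<in> {1..r}" for k using d[OF that] by simp
    then show "?P \<noteq> 0" by (simp only: prod_zero_iff finite_atLeastAtMost) blast
  qed
  ultimately show ?thesis
    using tendsto_add by fastforce
qed

lemma multiplicity_eq_iff_dvd:
  assumes "prime (p::nat)" "1 \<le> v"
  shows "multiplicity p v = a \<longleftrightarrow> p ^ a dvd v \<and> \<not> p ^ Suc a dvd v"
proof -
  have "\<not> is_unit p" "v \<noteq> 0" using assms by auto
  then have *: "p ^ b dvd v \<longleftrightarrow> b \<le> multiplicity p v" for b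
    using power_dvd_iff_le_multiplicity by blast
  show ?thesis unfolding * by auto
qed

text \<open>Prescribing one more valuation \<open>b\<close> at \<open>p0\<close> is the difference
  of two divisibility conditions, by \<open>p0 ^ b\<close> and by \<open>p0 ^ Suc b\<close>;
  correspondingly \<open>(1 - 1 / p) / p ^ b\<close> is a difference of two powers of
  \<open>1 / p\<close>. For the induction the divisors \<open>d\<close> must be arbitrary, up to
  coprimality with the primes still to be treated.\<close>

lemma tendsto_multiplicity_law:
  assumes r: "2 \<le> r" and l: "1 \<le> l" "l \<le> r" and N: "prob_space N" and U: "has_U_law l r N U" and x: "0 \<le> x"
    and J: "finite J" "J \<subseteq> {1..r} \<times> {p. prime p}"
    and d: "\<And>k. k \<in> {1..r} \<Longrightarrow> 1 \<le> d k" "\<And>k p. (k, p) \<in> J \<Longrightarrow> coprime p (d k)"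
  shows "(\<lambda>n. real (card {v\<in>hyp_set l r n. real (\<Prod>k=1..r. v k) \<le> x * real n powr (real r / real l)
              \<and> (\<forall>k\<in>{1..r}. d k dvd v k) \<and> (\<forall>(k, p)\<in>J. multiplicity p (v k) = a (k, p))})
            / real (card (hyp_set l r n)))
          \<longlonglongrightarrow> measure N {\<omega>\<in>space N. U \<omega> \<le> x} / (\<Prod>k=1..r. real (d k))
            * (\<Prod>(k, p)\<in>J. (1 - 1 / real p) * (1 / real p) ^ a (k, p))"
  using J d
proof (induction J arbitrary: d rule: finite_induct)
  case empty
  then show ?case using tendsto_dvd_law[OF r l N U x, of d] by simp
next
  case (insert kp J)
  obtain k0 p0 where kp: "kp = (k0, p0)" by (cases kp)
  have k0: "k0 \<in> {1..r}" and p0: "prime p0" using insert.prems kp by auto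
  define b where "b = a kp"
  \<comment> \<open>The power of \<open>p0\<close> is folded into the divisor of coordinate
    \<open>k0\<close>. By coprimality this says the same as the two divisibility conditions
    together.\<close>
  define e where "e c = d(k0 := d k0 * p0 ^ c)" for c
  define A where "A c n = {v\<in>hyp_set l r n. real (\<Prod>k=1..r. v k) \<le> x * real n powr (real r / real l)
              \<and> (\<forall>k\<in>{1..r}. e c k dvd v k) \<and> (\<forall>(k, p)\<in>J. multiplicity p (v k) = a (k, p))}" for c n
  define F where "F = measure N {\<omega>\<in>space N. U \<omega> \<le> x}"
  define Q where "Q = (\<Prod>(k, p)\<in>J. (1 - 1 / real p) * (1 / real p) ^ a (k, p))"
  have "(\<lambda>n. real (card (A c n)) / real (card (hyp_set l r n))) \<longlonglongrightarrow> F / (\<Prod>k=1..r. real (e c k)) * Q" for c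
    unfolding A_def F_def Q_def
  proof (rule insert.IH)
    show "J \<subseteq> {1..r} \<times> {p. prime p}" using insert.prems by auto
    show "1 \<le> e c k" if "k \<in> {1..r}" for k
      using insert.prems(2)[OF that] insert.prems(2)[OF k0] p0 by (auto simp: e_def Suc_le_eq prime_gt_0_nat)
    show "coprime p (e c k)" if kpJ: "(k, p) \<in> J" for k p
    proof (cases "k = k0")
      case True
      then have "p \<noteq> p0" using kpJ insert.hyps kp by auto
      moreover have "prime p" using kpJ insert.prems by auto
      ultimately have "coprime p p0" using p0 by (simp add: primes_coprime)
      moreover have "coprime p (d k0)" using insert.prems(3)[of k p] kpJ True by simp
      ultimately show ?thesis using True by (simp add: e_def)
    next
      case False
      then show ?thesis using insert.prems(3)[of k p] kpJ by (simp add: e_def)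
    qed
  qed
  note lim = this
  have pe: "(\<Prod>k=1..r. real (e c k)) = (\<Prod>k=1..r. real (d k)) * real p0 ^ c" for c
  proof -
    have "(\<Prod>k=1..r. real (e c k)) = real (e c k0) * (\<Prod>k\<in>{1..r} - {k0}. real (e c k))"
      using k0 by (intro prod.remove) auto
    also have "(\<Prod>k\<in>{1..r} - {k0}. real (e c k)) = (\<Prod>k\<in>{1..r} - {k0}. real (d k))"
      by (intro prod.cong) (auto simp: e_def)
    also have "real (e c k0) * (\<Prod>k\<in>{1..r} - {k0}. real (d k)) = (\<Prod>k=1..r. real (d k)) * real p0 ^ c"
      using k0 prod.remove[of "{1..r}" k0 "\<lambda>k. real (d k)"] by (simp add: e_def)
    finally show ?thesis .
  qed
  have cop: "coprime (d k0) (p0 ^ c)" for c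
    using insert.prems(3)[of k0 p0] kp by (simp add: coprime_commute)
  have e_dvd: "(\<forall>k\<in>{1..r}. e c k dvd v k) \<longleftrightarrow> (\<forall>k\<in>{1..r}. d k dvd v k) \<and> p0 ^ c dvd v k0" for c v
  proof -
    have "d k0 * p0 ^ c dvd v k0 \<longleftrightarrow> d k0 dvd v k0 \<and> p0 ^ c dvd v k0"
      using cop[of c] by (meson divides_mult dvd_mult_left dvd_mult_right)
    then show ?thesis using k0 by (auto simp: e_def)
  qed
  have set_eq: "{v\<in>hyp_set l r n. real (\<Prod>k=1..r. v k) \<le> x * real n powr (real r / real l)
              \<and> (\<forall>k\<in>{1..r}. d k dvd v k) \<and> (\<forall>(k, p)\<in>insert kp J. multiplicity p (v k) = a (k, p))}
      = A b n - A (Suc b) n" for n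
  proof -
    have "multiplicity p0 (v k0) = b \<longleftrightarrow> p0 ^ b dvd v k0 \<and> \<not> p0 ^ Suc b dvd v k0" if "v \<in> hyp_set l r n" for v
      using multiplicity_eq_iff_dvd[OF p0] hyp_set_ge1[OF that k0] by blast
    then show ?thesis unfolding A_def e_dvd by (auto simp: kp b_def)
  qed
  have sub: "A (Suc b) n \<subseteq> A b n" for n
    unfolding A_def e_dvd by (auto intro: dvd_trans[of "p0 ^ b" "p0 ^ Suc b"])
  have fin: "finite (A b n)" for n unfolding A_def using finite_hyp_set[OF l, of n] by simp
  have card_eq: "real (card (A b n - A (Suc b) n)) / real (card (hyp_set l r n))
      = real (card (A b n)) / real (card (hyp_set l r n)) - real (card (A (Suc b) n)) / real (card (hyp_set l r n))" for n
  proof -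
    have "card (A b n - A (Suc b) n) = card (A b n) - card (A (Suc b) n)"
      using sub fin finite_subset by (metis card_Diff_subset)
    moreover have "card (A (Suc b) n) \<le> card (A b n)" using sub fin by (simp add: card_mono)
    ultimately show ?thesis by (simp add: of_nat_diff diff_divide_distrib)
  qed
  have val: "F / (\<Prod>k=1..r. real (d k)) * (\<Prod>(k, p)\<in>insert kp J. (1 - 1 / real p) * (1 / real p) ^ a (k, p))
      = F / (\<Prod>k=1..r. real (e b k)) * Q - F / (\<Prod>k=1..r. real (e (Suc b) k)) * Q"
  proof -
    have p0': "real p0 \<noteq> 0" using p0 by (auto simp: prime_gt_0_nat)
    have "(\<Prod>(k, p)\<in>insert kp J. (1 - 1 / real p) * (1 / real p) ^ a (k, p)) = (1 - 1 / real p0) * (1 / real p0) ^ b * Q"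
      using insert.hyps by (simp add: Q_def kp b_def)
    moreover have "(1 - 1 / real p0) * (1 / real p0) ^ b = 1 / real p0 ^ b - 1 / real p0 ^ Suc b"
      using p0' by (simp add: power_one_over field_simps)
    ultimately have "(\<Prod>(k, p)\<in>insert kp J. (1 - 1 / real p) * (1 / real p) ^ a (k, p))
        = (1 / real p0 ^ b - 1 / real p0 ^ Suc b) * Q" by (simp only:)
    then show ?thesis unfolding pe
      by (simp add: left_diff_distrib right_diff_distrib del: power_Suc)
  qed
  show ?case
    unfolding set_eq card_eq F_def[symmetric] val by (intro tendsto_diff lim)
qed

section \<open>Primes dividing several coordinates\<close>

text \<open>Exponents are indexed by coordinate and prime, so that the valuations of a lattice point
  and the geometric variables are treated by the same lemmas.\<close>

definition collides :: "nat \<Rightarrow> (nat \<times> nat \<Rightarrow> nat) \<Rightarrow> nat \<Rightarrow> bool" where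
  "collides r e p \<longleftrightarrow> (\<exists>i\<in>{1..r}. \<exists>j\<in>{1..r}. i \<noteq> j \<and> e (i, p) \<noteq> 0 \<and> e (j, p) \<noteq> 0)"

definition prime_factor_at :: "nat \<Rightarrow> (nat \<times> nat \<Rightarrow> nat) \<Rightarrow> nat \<Rightarrow> real" where
  "prime_factor_at r e p = (if prime p
     then real p powi (int (MAX k\<in>{1..r}. e (k, p)) - int (\<Sum>k=1..r. e (k, p))) else 1)"

lemma prime_prod_eq_prodinf: "prime_prod r G \<omega> = prodinf (prime_factor_at r (\<lambda>(k, p). G k p \<omega>))"
  unfolding prime_prod_def
  by (rule arg_cong[where f = prodinf]) (auto simp: fun_eq_iff prime_factor_at_def)

lemma Max_le_sum_nat:
  fixes f :: "'i \<Rightarrow> nat"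
  assumes "finite I" "I \<noteq> {}" shows "(MAX k\<in>I. f k) \<le> (\<Sum>k\<in>I. f k)"
  using assms by (subst Max_le_iff) (auto intro: member_le_sum)

text \<open>Maximum and sum of nonnegative exponents agree exactly when at most one exponent is
  nonzero. So only colliding primes have a factor other than 1.\<close>

lemma collides_iff_Max_less_sum:
  assumes "1 \<le> r"
  shows "collides r e p \<longleftrightarrow> (MAX k\<in>{1..r}. e (k, p)) < (\<Sum>k=1..r. e (k, p))"
proof
  assume "collides r e p"
  then obtain i j where ij: "i \<in> {1..r}" "j \<in> {1..r}" "i \<noteq> j" "e (i, p) \<noteq> 0" "e (j, p) \<noteq> 0"
    by (auto simp: collides_def)
  show "(MAX k\<in>{1..r}. e (k, p)) < (\<Sum>k=1..r. e (k, p))"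
  proof (subst Max_less_iff)
    show "\<forall>a\<in>(\<lambda>k. e (k, p)) ` {1..r}. a < (\<Sum>k=1..r. e (k, p))"
    proof clarify
      fix k assume k: "k \<in> {1..r}"
      obtain m where m: "m \<in> {1..r}" "m \<noteq> k" "e (m, p) \<noteq> 0" using ij by metis
      have "e (k, p) < (\<Sum>k\<in>{k, m}. e (k, p))" using m by auto
      also have "\<dots> \<le> (\<Sum>k=1..r. e (k, p))" using k m by (intro sum_mono2) auto
      finally show "e (k, p) < (\<Sum>k=1..r. e (k, p))" .
    qed
  qed (use assms in auto)
next
  assume less: "(MAX k\<in>{1..r}. e (k, p)) < (\<Sum>k=1..r. e (k, p))"
  show "collides r e p"
  proof (rule ccontr)
    assume nc: "\<not> collides r e p"
    have "\<exists>i\<in>{1..r}. e (i, p) \<noteq> 0"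
    proof (rule ccontr)
      assume "\<not> (\<exists>i\<in>{1..r}. e (i, p) \<noteq> 0)"
      then have "(\<Sum>k=1..r. e (k, p)) = 0" by simp
      then show False using less by simp
    qed
    then obtain i where i: "i \<in> {1..r}" "e (i, p) \<noteq> 0" by blast
    have "(\<Sum>k=1..r. e (k, p)) = (\<Sum>k\<in>{i}. e (k, p))"
    proof (intro sum.mono_neutral_right)
      show "\<forall>k\<in>{1..r} - {i}. e (k, p) = 0" using nc i unfolding collides_def by blast
    qed (use i in auto)
    also have "\<dots> \<le> (MAX k\<in>{1..r}. e (k, p))" using i by simp
    finally show False using less by simp
  qed
qed

lemma prime_factor_at_eq_1: "1 \<le> r \<Longrightarrow> \<not> (prime p \<and> collides r e p) \<Longrightarrow> prime_factor_at r e p = 1"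
proof -
  assume r: "1 \<le> r" and nc: "\<not> (prime p \<and> collides r e p)"
  show "prime_factor_at r e p = 1"
  proof (cases "prime p")
    case True
    then have "(MAX k\<in>{1..r}. e (k, p)) = (\<Sum>k=1..r. e (k, p))"
      using nc collides_iff_Max_less_sum[OF r, of e p] Max_le_sum_nat[of "{1..r}" "\<lambda>k. e (k, p)"] r
      by (simp add: nat_less_le)
    then show ?thesis by (simp add: prime_factor_at_def)
  qed (simp add: prime_factor_at_def)
qed

text \<open>The third bound is uniform in \<open>p\<close>: infinitely many colliding primes keep
  the factors from tending to 1, so the infinite product diverges.\<close>

lemma prime_factor_at_bounds:
  assumes "1 \<le> r"
  shows "0 < prime_factor_at r e p" "prime_factor_at r e p \<le> 1"
    "prime p \<Longrightarrow> collides r e p \<Longrightarrow> prime_factor_at r e p \<le> 1 / 2"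
proof -
  show "0 < prime_factor_at r e p"
    by (auto simp: prime_factor_at_def prime_gt_0_nat)
  have half: "prime_factor_at r e p \<le> 1 / 2" if p: "prime p" "collides r e p"
  proof -
    define m where "m = (\<Sum>k=1..r. e (k, p)) - (MAX k\<in>{1..r}. e (k, p))"
    have m: "1 \<le> m" using collides_iff_Max_less_sum[OF assms, of e p] p by (simp add: m_def)
    have "prime_factor_at r e p = real p powi (- int m)"
      using p m by (simp add: prime_factor_at_def m_def of_nat_diff)
    also have "\<dots> = 1 / real p ^ m" by (simp add: power_int_minus divide_inverse)
    also have "\<dots> \<le> 1 / 2"
    proof -
      have "(2::real) ^ 1 \<le> 2 ^ m" using m by (intro power_increasing) auto
      also have "\<dots> \<le> real p ^ m" using prime_ge_2_nat[OF p(1)] by (intro power_mono) auto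
      finally show ?thesis using frac_le[of 1 1 2 "real p ^ m"] by simp
    qed
    finally show ?thesis .
  qed
  then show "prime p \<Longrightarrow> collides r e p \<Longrightarrow> prime_factor_at r e p \<le> 1 / 2" .
  show "prime_factor_at r e p \<le> 1"
    using half prime_factor_at_eq_1[OF assms, of p e] by fastforce
qed

definition prime_prod_upto :: "nat \<Rightarrow> nat \<Rightarrow> (nat \<times> nat \<Rightarrow> nat) \<Rightarrow> real" where
  "prime_prod_upto r K e = (\<Prod>p\<le>K. prime_factor_at r e p)"

lemma prime_prod_upto_bounds:
  assumes "1 \<le> r" shows "0 < prime_prod_upto r K e" "prime_prod_upto r K e \<le> 1"
proof -
  show "0 < prime_prod_upto r K e"
    unfolding prime_prod_upto_def by (intro prod_pos prime_factor_at_bounds[OF assms])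
  show "prime_prod_upto r K e \<le> 1"
    unfolding prime_prod_upto_def
    by (intro prod_le_1 conjI less_imp_le[OF prime_factor_at_bounds(1)[OF assms]]
        prime_factor_at_bounds(2)[OF assms])
qed

lemma prime_prod_upto_cong:
  assumes "\<And>k p. k \<in> {1..r} \<Longrightarrow> prime p \<Longrightarrow> p \<le> K \<Longrightarrow> e (k, p) = e' (k, p)"
  shows "prime_prod_upto r K e = prime_prod_upto r K e'"
  unfolding prime_prod_upto_def prime_factor_at_def
  by (intro prod.cong if_cong arg_cong2[where f = "(powi)"] arg_cong2[where f = "(-)"] refl
      arg_cong[where f = int] arg_cong[where f = Max] image_cong sum.cong)
    (auto simp: assms)

lemma prodinf_prime_factor_at_eq:
  assumes "1 \<le> r" "\<And>p. K < p \<Longrightarrow> prime p \<Longrightarrow> \<not> collides r e p"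
  shows "prodinf (prime_factor_at r e) = prime_prod_upto r K e"
proof -
  have "prime_factor_at r e p = 1" if "p \<notin> {..K}" for p
    using that assms by (intro prime_factor_at_eq_1) auto
  then show ?thesis unfolding prime_prod_upto_def by (intro prodinf_finite) auto
qed

text \<open>\<open>conv_in_distr\<close> requires measurability of \<open>prime_prod\<close> also on the null set where the
  product diverges.\<close>

lemma prodinf_prime_factor_at_junk:
  assumes r: "1 \<le> r" and inf: "\<And>K. \<exists>p>K. prime p \<and> collides r e p"
  shows "prodinf (prime_factor_at r e) = (THE x. False)"
proof -
  have "\<not> convergent_prod (prime_factor_at r e)"
  proof
    assume "convergent_prod (prime_factor_at r e)"
    then have "prime_factor_at r e \<longlonglongrightarrow> 1" by (rule convergent_prod_imp_LIMSEQ)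
    then have "\<forall>\<^sub>F p in sequentially. 1 / 2 < prime_factor_at r e p"
      by (rule order_tendstoD) simp
    then obtain K where "\<And>p. K \<le> p \<Longrightarrow> 1 / 2 < prime_factor_at r e p"
      by (auto simp: eventually_sequentially)
    moreover obtain p where "K < p" "prime p" "collides r e p" using inf by blast
    ultimately show False using prime_factor_at_bounds(3)[OF r, of p e] by (meson less_imp_le not_le)
  qed
  then have "\<not> (prime_factor_at r e has_prod x)" for x
    using has_prod_def convergent_prod_def by metis
  \<comment> \<open>\<open>prodinf\<close> is a definite description. With an empty predicate its
    value does not depend on \<open>e\<close>, so it is constant on the exceptional set.\<close>
  then have "(has_prod) (prime_factor_at r e) = (\<lambda>x. False)" by (intro ext) simp
  then show ?thesis unfolding prodinf_def by simp
qed

section \<open>Factorization of the ratio of lcm and product\<close>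

lemma multiplicity_Lcm_image:
  fixes v :: "'i \<Rightarrow> nat"
  assumes "finite I" "I \<noteq> {}" "\<And>k. k \<in> I \<Longrightarrow> v k \<noteq> 0" "prime p"
  shows "multiplicity p (LCM k\<in>I. v k) = (MAX k\<in>I. multiplicity p (v k))"
  using assms(1,2,3)
proof (induction rule: finite_ne_induct)
  case (singleton x)
  then show ?case by simp
next
  case (insert x F)
  have "0 \<notin> v ` F" using insert.prems by (metis imageE insertCI)
  then have "(LCM k\<in>F. v k) \<noteq> 0" using insert by (simp add: Lcm_0_iff)
  then show ?case using insert assms(4) by (simp add: multiplicity_lcm)
qed

lemma nat_eq_prod_prime_powers:
  fixes x :: nat
  assumes "x \<noteq> 0" "finite P" "prime_factors x \<subseteq> P" "\<And>p. p \<in> P \<Longrightarrow> prime p"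
  shows "x = (\<Prod>p\<in>P. p ^ multiplicity p x)"
proof -
  have "x = (\<Prod>p\<in>prime_factors x. p ^ multiplicity p x)"
    using prod_prime_factors[of x] assms by simp
  also have "\<dots> = (\<Prod>p\<in>P. p ^ multiplicity p x)"
  proof (rule prod.mono_neutral_left)
    show "\<forall>p\<in>P - prime_factors x. p ^ multiplicity p x = 1"
    proof
      fix p assume "p \<in> P - prime_factors x"
      then have "\<not> p dvd x" using assms by (auto simp: prime_factors_dvd)
      then show "p ^ multiplicity p x = 1" by (simp add: not_dvd_imp_multiplicity_0)
    qed
  qed (use assms in auto)
  finally show ?thesis .
qed

text \<open>At each prime the lcm takes the maximum of the valuations and the product takes their
  sum. Primes above \<open>K\<close> cancel because they do not collide.\<close>

lemma Lcm_div_prod_eq: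
  fixes v :: "nat \<Rightarrow> nat"
  assumes r: "1 \<le> r" and v: "\<And>k. k \<in> {1..r} \<Longrightarrow> 1 \<le> v k"
    and nc: "\<And>p. K < p \<Longrightarrow> prime p \<Longrightarrow> \<not> collides r (\<lambda>(k, p). multiplicity p (v k)) p"
  shows "real (LCM k\<in>{1..r}. v k) / real (\<Prod>k=1..r. v k)
       = prime_prod_upto r K (\<lambda>(k, p). multiplicity p (v k))"
proof -
  let ?e = "\<lambda>(k, p). multiplicity p (v k)"
  have v0: "v k \<noteq> 0" if "k \<in> {1..r}" for k using v[OF that] by simp
  define L where "L = (LCM k\<in>{1..r}. v k)"
  have "0 \<notin> v ` {1..r}" using v0 by (metis imageE)
  then have L0: "L \<noteq> 0" by (simp add: L_def Lcm_0_iff)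
  \<comment> \<open>Large enough for all prime factors of the coordinates, and at least
    \<open>K\<close>, so that the product up to \<open>Q\<close> can be cut back to
    \<open>K\<close>.\<close>
  define Q where "Q = max K (\<Sum>k=1..r. v k)"
  define P where "P = {p. prime p \<and> p \<le> Q}"
  have fP: "finite P" unfolding P_def by (rule finite_subset[of _ "{..Q}"]) auto
  have pf: "prime_factors (v k) \<subseteq> P" if k: "k \<in> {1..r}" for k
  proof
    fix p assume p: "p \<in> prime_factors (v k)"
    then have "p \<le> v k" using v0[OF k] by (auto simp: prime_factors_dvd dvd_imp_le)
    also have "\<dots> \<le> (\<Sum>k=1..r. v k)" using k by (intro member_le_sum) auto
    finally show "p \<in> P" using p by (auto simp: P_def Q_def prime_factors_dvd)
  qed
  have mL: "multiplicity p L = (MAX k\<in>{1..r}. multiplicity p (v k))" if "prime p" for p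
    unfolding L_def using that r v0 by (intro multiplicity_Lcm_image) auto
  have pL: "prime_factors L \<subseteq> P"
  proof
    fix p assume p: "p \<in> prime_factors L"
    then have pp: "prime p" "p dvd L" by (auto simp: prime_factors_dvd)
    then have "multiplicity p L \<noteq> 0" using L0 prime_multiplicity_gt_zero_iff[of p L] by simp
    then have "(MAX k\<in>{1..r}. multiplicity p (v k)) \<noteq> 0" using mL pp by simp
    moreover have "(MAX k\<in>{1..r}. multiplicity p (v k)) \<in> (\<lambda>k. multiplicity p (v k)) ` {1..r}"
      using r by (intro Max_in) auto
    ultimately obtain k where k: "k \<in> {1..r}" "multiplicity p (v k) \<noteq> 0" by fastforce
    then have "p dvd v k" by (metis not_dvd_imp_multiplicity_0)
    then have "p \<in> prime_factors (v k)" using pp v0[OF k(1)] by (simp add: prime_factors_dvd)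
    then show "p \<in> P" using pf[OF k(1)] by blast
  qed
  have Lp: "real L = (\<Prod>p\<in>P. real p ^ (MAX k\<in>{1..r}. multiplicity p (v k)))"
  proof -
    have "L = (\<Prod>p\<in>P. p ^ multiplicity p L)"
      using L0 fP pL by (intro nat_eq_prod_prime_powers) (auto simp: P_def)
    also have "\<dots> = (\<Prod>p\<in>P. p ^ (MAX k\<in>{1..r}. multiplicity p (v k)))"
      using mL by (intro prod.cong) (auto simp: P_def)
    finally have "real L = real (\<Prod>p\<in>P. p ^ (MAX k\<in>{1..r}. multiplicity p (v k)))" by simp
    then show ?thesis by simp
  qed
  have vp: "real (\<Prod>k=1..r. v k) = (\<Prod>p\<in>P. real p ^ (\<Sum>k=1..r. multiplicity p (v k)))"
  proof -
    have "(\<Prod>k=1..r. v k) = (\<Prod>k=1..r. \<Prod>p\<in>P. p ^ multiplicity p (v k))"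
      using v0 fP pf by (intro prod.cong nat_eq_prod_prime_powers) (auto simp: P_def)
    also have "\<dots> = (\<Prod>p\<in>P. \<Prod>k=1..r. p ^ multiplicity p (v k))" by (rule prod.swap)
    also have "\<dots> = (\<Prod>p\<in>P. p ^ (\<Sum>k=1..r. multiplicity p (v k)))" by (simp add: power_sum)
    finally have "real (\<Prod>k=1..r. v k) = real (\<Prod>p\<in>P. p ^ (\<Sum>k=1..r. multiplicity p (v k)))" by simp
    then show ?thesis by simp
  qed
  have "real L / real (\<Prod>k=1..r. v k) = (\<Prod>p\<in>P. prime_factor_at r ?e p)"
    unfolding Lp vp prod_dividef[symmetric]
  proof (rule prod.cong)
    fix p assume "p \<in> P"
    then have p: "prime p" "real p \<noteq> 0" by (auto simp: P_def prime_gt_0_nat)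
    then show "real p ^ (MAX k\<in>{1..r}. multiplicity p (v k)) / real p ^ (\<Sum>k=1..r. multiplicity p (v k))
        = prime_factor_at r ?e p"
      by (simp add: prime_factor_at_def power_int_diff del: of_nat_sum)
  qed simp
  also have "\<dots> = (\<Prod>p\<le>Q. prime_factor_at r ?e p)"
    by (rule prod.mono_neutral_left) (auto simp: P_def prime_factor_at_def)
  also have "\<dots> = (\<Prod>p\<le>K. prime_factor_at r ?e p)"
  proof (rule prod.mono_neutral_right)
    show "\<forall>p\<in>{..Q} - {..K}. prime_factor_at r ?e p = 1"
      using nc r by (auto intro!: prime_factor_at_eq_1)
  qed (auto simp: Q_def)
  finally show ?thesis by (simp add: L_def prime_prod_upto_def)
qed

text \<open>Telescoping, from the comparison of \<open>1 / p^2\<close> with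
  \<open>1 / (p - 1) - 1 / p\<close>.\<close>

lemma sum_inverse_squares_le:
  assumes "1 \<le> K" shows "(\<Sum>p\<in>{K<..n}. 1 / (real p)\<^sup>2) \<le> 1 / real K"
proof (cases "K \<le> n")
  case True
  have "(\<Sum>p\<in>{K<..n}. 1 / (real p)\<^sup>2) \<le> 1 / real K - 1 / real n"
    using True
  proof (induction rule: dec_induct)
    case base
    then show ?case by simp
  next
    case (step n)
    have n: "0 < real n" using step assms by simp
    have "{K<..Suc n} = insert (Suc n) {K<..n}" using step by auto
    then have "(\<Sum>p\<in>{K<..Suc n}. 1 / (real p)\<^sup>2) = 1 / (real (Suc n))\<^sup>2 + (\<Sum>p\<in>{K<..n}. 1 / (real p)\<^sup>2)"
      by simp
    also have "\<dots> \<le> 1 / (real (Suc n))\<^sup>2 + (1 / real K - 1 / real n)" using step by simp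
    also have "\<dots> \<le> 1 / real K - 1 / real (Suc n)"
    proof -
      have "1 / (real (Suc n))\<^sup>2 \<le> 1 / (real n * real (Suc n))"
        using n by (intro divide_left_mono) (auto simp: power2_eq_square)
      also have "\<dots> = 1 / real n - 1 / real (Suc n)" using n by (simp add: field_simps)
      finally show ?thesis by simp
    qed
    finally show ?case .
  qed
  then show ?thesis by (smt (verit) divide_nonneg_nonneg of_nat_0_le_iff)
next
  case False
  then show ?thesis by simp
qed

lemma card_offdiagonal_le: "real (card {ij \<in> {1..r} \<times> {1..r}. fst ij \<noteq> snd ij}) \<le> (real r)\<^sup>2"
proof -
  have "card {ij \<in> {1..r} \<times> {1..r}. fst ij \<noteq> snd ij} \<le> card ({1..r} \<times> {1..r})"
    by (intro card_mono) auto
  then have "real (card {ij \<in> {1..r} \<times> {1..r}. fst ij \<noteq> snd ij}) \<le> real (r * r)"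
    by (simp only: card_cartesian_product card_atLeastAtMost of_nat_le_iff) simp
  then show ?thesis by (simp add: power2_eq_square)
qed

text \<open>A union bound over pairs of coordinates and over all integers in \<open>{K<..n}\<close>;
  larger primes cannot divide a coordinate. Any error per prime would accumulate over this growing
  range, hence the use of the error-free \<open>card_two_coords_dvd\<close>.\<close>

lemma card_collisions_le:
  assumes l: "1 \<le> l" "l \<le> r" and K: "1 \<le> K"
  shows "real (card {v\<in>hyp_set l r n. \<exists>p>K. prime p \<and> collides r (\<lambda>(k, p). multiplicity p (v k)) p})
           \<le> (real r)\<^sup>2 / real K * real (card (hyp_set l r n))"
proof -
  let ?H = "hyp_set l r n"
  let ?I = "{ij \<in> {1..r} \<times> {1..r}. fst ij \<noteq> snd ij}"
  let ?D = "\<lambda>p ij. {v\<in>?H. p dvd v (fst ij) \<and> p dvd v (snd ij)}"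
  have fin: "finite ?H" by (rule finite_hyp_set[OF l])
  have "{v\<in>?H. \<exists>p>K. prime p \<and> collides r (\<lambda>(k, p). multiplicity p (v k)) p}
      \<subseteq> (\<Union>p\<in>{K<..n}. \<Union>ij\<in>?I. ?D p ij)"
  proof
    fix v assume "v \<in> {v\<in>?H. \<exists>p>K. prime p \<and> collides r (\<lambda>(k, p). multiplicity p (v k)) p}"
    then obtain p i j where *: "v \<in> ?H" "K < p" "i \<in> {1..r}" "j \<in> {1..r}" "i \<noteq> j"
      "multiplicity p (v i) \<noteq> 0" "multiplicity p (v j) \<noteq> 0" by (auto simp: collides_def)
    then have d: "p dvd v i" "p dvd v j" by (metis not_dvd_imp_multiplicity_0)+
    have "p \<le> v i" using d hyp_set_ge1[OF *(1,3)] by (intro dvd_imp_le) auto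
    also have "\<dots> \<le> n" by (rule hyp_set_le[OF l *(1,3)])
    finally have "p \<in> {K<..n}" using * by simp
    moreover have "(i, j) \<in> ?I" using * by auto
    moreover have "v \<in> ?D p (i, j)" using * d by auto
    ultimately show "v \<in> (\<Union>p\<in>{K<..n}. \<Union>ij\<in>?I. ?D p ij)" by blast
  qed
  then have "card {v\<in>?H. \<exists>p>K. prime p \<and> collides r (\<lambda>(k, p). multiplicity p (v k)) p}
      \<le> card (\<Union>p\<in>{K<..n}. \<Union>ij\<in>?I. ?D p ij)"
    using fin by (intro card_mono) auto
  also have "\<dots> \<le> (\<Sum>p\<in>{K<..n}. card (\<Union>ij\<in>?I. ?D p ij))" by (rule card_UN_le) simp
  also have "\<dots> \<le> (\<Sum>p\<in>{K<..n}. \<Sum>ij\<in>?I. card (?D p ij))" by (intro sum_mono card_UN_le) simp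
  finally have "real (card {v\<in>?H. \<exists>p>K. prime p \<and> collides r (\<lambda>(k, p). multiplicity p (v k)) p})
      \<le> real (\<Sum>p\<in>{K<..n}. \<Sum>ij\<in>?I. card (?D p ij))" by (rule of_nat_mono)
  also have "\<dots> = (\<Sum>p\<in>{K<..n}. \<Sum>ij\<in>?I. real (card (?D p ij)))" by simp
  also have "\<dots> \<le> (\<Sum>p\<in>{K<..n}. \<Sum>ij\<in>?I. real (card ?H) * (1 / (real p)\<^sup>2))"
  proof (intro sum_mono)
    fix p ij assume p: "p \<in> {K<..n}" and ij: "ij \<in> ?I"
    have "p\<^sup>2 * card (?D p ij) \<le> card ?H"
      using ij p fin by (intro card_two_coords_dvd lower_at_hyp_set) auto
    then have "(real p)\<^sup>2 * real (card (?D p ij)) \<le> real (card ?H)"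
      unfolding of_nat_power[symmetric] of_nat_mult[symmetric] of_nat_le_iff .
    then show "real (card (?D p ij)) \<le> real (card ?H) * (1 / (real p)\<^sup>2)"
      using p by (simp add: field_simps)
  qed
  also have "\<dots> = real (card ?I) * real (card ?H) * (\<Sum>p\<in>{K<..n}. 1 / (real p)\<^sup>2)"
    by (simp add: sum_distrib_left mult.assoc)
  also have "\<dots> \<le> (real r)\<^sup>2 * real (card ?H) * (1 / real K)"
  proof (intro mult_mono sum_inverse_squares_le K)
    show "real (card ?I) \<le> (real r)\<^sup>2" by (rule card_offdiagonal_le)
  qed (auto intro!: sum_nonneg)
  finally show ?thesis by (simp add: field_simps)
qed

text \<open>The approximating sequence may depend on \<open>e\<close>. This serves two truncations:
  of the set of primes, and of the values of the valuations.\<close>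

lemma tendsto_if_uniformly_approx:
  fixes T :: "nat \<Rightarrow> real"
  assumes "\<And>e. 0 < e \<Longrightarrow> \<exists>S s. S \<longlonglongrightarrow> s \<and> (\<forall>\<^sub>F n in sequentially. \<bar>T n - S n\<bar> \<le> e) \<and> \<bar>t - s\<bar> \<le> e"
  shows "T \<longlonglongrightarrow> t"
proof (rule tendstoI)
  fix e :: real assume "0 < e"
  then obtain S s where S: "S \<longlonglongrightarrow> s" "\<forall>\<^sub>F n in sequentially. \<bar>T n - S n\<bar> \<le> e / 4" "\<bar>t - s\<bar> \<le> e / 4"
    using assms[of "e / 4"] by auto
  have "\<forall>\<^sub>F n in sequentially. dist (S n) s < e / 4" using S(1) \<open>0 < e\<close> by (intro tendstoD) auto
  with S(2) show "\<forall>\<^sub>F n in sequentially. dist (T n) t < e"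
  proof eventually_elim
    case (elim n)
    then show ?case using S(3) \<open>0 < e\<close> unfolding dist_real_def by linarith
  qed
qed

text \<open>The function type may be uncountable, but the restricted vector takes values in a
  countable set, so preimages of points decide. With the discrete target, every function of the
  vector is measurable.\<close>

lemma measurable_restrict_count_space:
  fixes X :: "'j \<Rightarrow> 'a \<Rightarrow> nat"
  assumes J: "finite J" and X: "\<And>j. j \<in> J \<Longrightarrow> X j \<in> M \<rightarrow>\<^sub>M count_space UNIV"
  shows "(\<lambda>\<omega>. \<lambda>j\<in>J. X j \<omega>) \<in> M \<rightarrow>\<^sub>M count_space UNIV"
proof -
  have c: "countable (J \<rightarrow>\<^sub>E (UNIV :: nat set))" using J by (intro countable_PiE) auto
  have "(\<lambda>\<omega>. \<lambda>j\<in>J. X j \<omega>) \<in> M \<rightarrow>\<^sub>M count_space (J \<rightarrow>\<^sub>E UNIV)"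
    unfolding measurable_count_space_eq_countable[OF c]
  proof (intro conjI ballI)
    fix a :: "'j \<Rightarrow> nat" assume a: "a \<in> J \<rightarrow>\<^sub>E UNIV"
    have "(\<lambda>\<omega>. \<lambda>j\<in>J. X j \<omega>) -` {a} \<inter> space M = {\<omega>\<in>space M. \<forall>j\<in>J. X j \<omega> = a j}"
    proof (intro set_eqI iffI)
      fix \<omega> assume "\<omega> \<in> {\<omega>\<in>space M. \<forall>j\<in>J. X j \<omega> = a j}"
      then show "\<omega> \<in> (\<lambda>\<omega>. \<lambda>j\<in>J. X j \<omega>) -` {a} \<inter> space M"
        using a by (auto simp: fun_eq_iff PiE_iff extensional_def)
    qed auto
    also have "\<dots> \<in> sets M"
    proof (intro sets.sets_Collect_finite_All J)
      fix j assume "j \<in> J"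
      then have [measurable]: "X j \<in> M \<rightarrow>\<^sub>M count_space UNIV" by (rule X)
      show "{\<omega>\<in>space M. X j \<omega> = a j} \<in> sets M" by measurable
    qed
    finally show "(\<lambda>\<omega>. \<lambda>j\<in>J. X j \<omega>) -` {a} \<inter> space M \<in> sets M" .
  qed auto
  then show ?thesis
    using measurable_compose[of _ M "count_space (J \<rightarrow>\<^sub>E UNIV)" "\<lambda>x. x" "count_space UNIV"] by simp
qed

section \<open>Convergence of distribution functions\<close>

text \<open>The uniform probability of \<open>P\<close>, with value 0 when
  \<open>hyp_set l r n\<close> is empty. Of the rules below, only the complement rule asks for large
  \<open>n\<close>.\<close>

definition freq :: "nat \<Rightarrow> nat \<Rightarrow> nat \<Rightarrow> ((nat \<Rightarrow> nat) \<Rightarrow> bool) \<Rightarrow> real" where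
  "freq l r n P = real (card {v\<in>hyp_set l r n. P v}) / real (card (hyp_set l r n))"

lemma freq_cong: "(\<And>v. v \<in> hyp_set l r n \<Longrightarrow> P v \<longleftrightarrow> Q v) \<Longrightarrow> freq l r n P = freq l r n Q"
  unfolding freq_def by (metis (mono_tags, lifting) Collect_cong)

lemma freq_mono:
  assumes "1 \<le> l" "l \<le> r" "\<And>v. v \<in> hyp_set l r n \<Longrightarrow> P v \<Longrightarrow> Q v"
  shows "freq l r n P \<le> freq l r n Q"
  unfolding freq_def using finite_hyp_set[OF assms(1,2), of n] assms(3)
  by (intro divide_right_mono of_nat_mono card_mono) auto

lemma freq_disj_le:
  assumes "1 \<le> l" "l \<le> r"
  shows "freq l r n (\<lambda>v. P v \<or> Q v) \<le> freq l r n P + freq l r n Q"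
proof -
  have "{v\<in>hyp_set l r n. P v \<or> Q v} = {v\<in>hyp_set l r n. P v} \<union> {v\<in>hyp_set l r n. Q v}" by auto
  then have "card {v\<in>hyp_set l r n. P v \<or> Q v} \<le> card {v\<in>hyp_set l r n. P v} + card {v\<in>hyp_set l r n. Q v}"
    by (simp add: card_Un_le)
  then have "real (card {v\<in>hyp_set l r n. P v \<or> Q v})
      \<le> real (card {v\<in>hyp_set l r n. P v}) + real (card {v\<in>hyp_set l r n. Q v})" by linarith
  then show ?thesis unfolding freq_def add_divide_distrib[symmetric] by (intro divide_right_mono) auto
qed

lemma freq_diff_le:
  assumes l: "1 \<le> l" "l \<le> r" and PQ: "\<And>v. v \<in> hyp_set l r n \<Longrightarrow> \<not> R v \<Longrightarrow> P v \<longleftrightarrow> Q v"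
  shows "\<bar>freq l r n P - freq l r n Q\<bar> \<le> freq l r n R"
proof -
  have "freq l r n P \<le> freq l r n Q + freq l r n R"
    using order_trans[OF freq_mono[OF l] freq_disj_le[OF l]] PQ by blast
  moreover have "freq l r n Q \<le> freq l r n P + freq l r n R"
    using order_trans[OF freq_mono[OF l] freq_disj_le[OF l]] PQ by blast
  ultimately show ?thesis by linarith
qed

lemma freq_not:
  assumes l: "1 \<le> l" "l \<le> r" and n: "r choose l \<le> n"
  shows "freq l r n (\<lambda>v. \<not> P v) = 1 - freq l r n P"
proof -
  have fin: "finite (hyp_set l r n)" by (rule finite_hyp_set[OF l])
  have "card (hyp_set l r n) = card {v\<in>hyp_set l r n. \<not> P v} + card {v\<in>hyp_set l r n. P v}"
    using fin by (subst card_Un_disjoint[symmetric]) (auto intro!: arg_cong[where f = card])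
  then have "real (card {v\<in>hyp_set l r n. \<not> P v})
      = real (card (hyp_set l r n)) - real (card {v\<in>hyp_set l r n. P v})" by linarith
  then show ?thesis unfolding freq_def using card_hyp_set_pos[OF l n] by (simp add: diff_divide_distrib)
qed

lemma freq_sum:
  assumes l: "1 \<le> l" "l \<le> r" and D: "finite D"
  shows "freq l r n (\<lambda>v. P (f v) v \<and> f v \<in> D) = (\<Sum>a\<in>D. freq l r n (\<lambda>v. P a v \<and> f v = a))"
proof -
  have fin: "finite (hyp_set l r n)" by (rule finite_hyp_set[OF l])
  have "{v\<in>hyp_set l r n. P (f v) v \<and> f v \<in> D} = (\<Union>a\<in>D. {v\<in>hyp_set l r n. P a v \<and> f v = a})" by auto
  also have "card \<dots> = (\<Sum>a\<in>D. card {v\<in>hyp_set l r n. P a v \<and> f v = a})"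
    using fin D by (intro card_UN_disjoint) auto
  finally show ?thesis by (simp add: freq_def sum_divide_distrib)
qed

lemma (in prob_space) prob_diff_le:
  assumes "A \<in> events" "B \<in> events" "C \<in> events" "A \<subseteq> B \<union> C" "B \<subseteq> A \<union> C"
  shows "\<bar>prob A - prob B\<bar> \<le> prob C"
proof -
  have "prob A \<le> prob (B \<union> C)" "prob B \<le> prob (A \<union> C)"
    using assms by (auto intro!: finite_measure_mono)
  moreover have "prob (B \<union> C) \<le> prob B + prob C" "prob (A \<union> C) \<le> prob A + prob C"
    using assms by (auto intro!: measure_Un_le)
  ultimately show ?thesis by linarith
qed

text \<open>Only the limit side is fixed here. The finite side enters as \<open>freq\<close>, and
  the spaces \<open>M n\<close> appear after the locale.\<close>

locale geometric_limit = prob_space N for N :: "'b measure" +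
  fixes l r :: nat and G :: "nat \<Rightarrow> nat \<Rightarrow> 'b \<Rightarrow> nat" and U :: "'b \<Rightarrow> real"
  assumes r2: "2 \<le> r" and l1: "1 \<le> l" and lr: "l \<le> r"
    and geom: "geometric_family N G" and U_law: "has_U_law l r N U" and U_indep: "indep_of_family N U G"
begin

abbreviation Gv :: "'b \<Rightarrow> nat \<times> nat \<Rightarrow> nat" where "Gv \<omega> \<equiv> \<lambda>(k, p). G k p \<omega>"

abbreviation idx :: "(nat \<times> nat) set" where "idx \<equiv> {1..} \<times> {p. prime p}"

lemma r1: "1 \<le> r" using r2 by simp

lemma U_measurable [measurable]: "U \<in> borel_measurable N"
  using U_law by (simp add: has_U_law_def)

lemma G_measurable: "j \<in> idx \<Longrightarrow> (\<lambda>\<omega>. Gv \<omega> j) \<in> N \<rightarrow>\<^sub>M count_space UNIV"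
proof -
  assume j: "j \<in> idx"
  have "indep_vars (\<lambda>_. count_space UNIV) (\<lambda>(k, p). G k p) idx"
    using geom unfolding geometric_family_def by blast
  then have "random_variable (count_space UNIV) ((\<lambda>(k, p). G k p) j)"
    using j unfolding indep_vars_def2 by blast
  then show ?thesis by (cases j) simp
qed

lemma restrict_G_measurable:
  assumes "finite J" "J \<subseteq> idx"
  shows "(\<lambda>\<omega>. restrict (Gv \<omega>) J) \<in> N \<rightarrow>\<^sub>M count_space UNIV"
  using assms by (intro measurable_restrict_count_space G_measurable) auto

lemma pred_restrict_G:
  assumes "finite J" "J \<subseteq> idx"
  shows "Measurable.pred N (\<lambda>\<omega>. P (restrict (Gv \<omega>) J))"
  by (rule measurable_compose[OF restrict_G_measurable[OF assms]]) simp

lemma G_event: "j \<in> idx \<Longrightarrow> {\<omega>\<in>space N. Gv \<omega> j \<in> B} \<in> events"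
  using measurable_sets[OF G_measurable, of j B] by (simp add: vimage_def Int_def conj_commute)

lemma prob_G_eq_prod:
  assumes J: "finite J" "J \<subseteq> idx"
  shows "prob {\<omega>\<in>space N. \<forall>j\<in>J. Gv \<omega> j \<in> B j} = (\<Prod>j\<in>J. prob {\<omega>\<in>space N. Gv \<omega> j \<in> B j})"
proof (cases "J = {}")
  case True
  then show ?thesis by (simp add: prob_space)
next
  case False
  let ?X = "\<lambda>(k, p). G k p"
  have "indep_vars (\<lambda>_. count_space UNIV) ?X idx"
    using geom unfolding geometric_family_def by blast
  then have ind: "indep_sets (\<lambda>i. {?X i -` A \<inter> space N | A. A \<in> sets (count_space UNIV)}) idx"
    unfolding indep_vars_def2 by blast
  define A where "A j = ?X j -` B j \<inter> space N" for j
  have "prob (\<Inter>j\<in>J. A j) = (\<Prod>j\<in>J. prob (A j))"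
    by (rule indep_setsD[OF ind J(2) False J(1)]) (auto simp: A_def)
  moreover have "A j = {\<omega>\<in>space N. Gv \<omega> j \<in> B j}" for j by (cases j) (auto simp: A_def)
  moreover have "(\<Inter>j\<in>J. {\<omega>\<in>space N. Gv \<omega> j \<in> B j}) = {\<omega>\<in>space N. \<forall>j\<in>J. Gv \<omega> j \<in> B j}"
    using False by auto
  ultimately show ?thesis by simp
qed

lemma prob_G_eq:
  assumes J: "finite J" "J \<subseteq> idx"
  shows "prob {\<omega>\<in>space N. \<forall>j\<in>J. Gv \<omega> j = a j}
       = (\<Prod>(k, p)\<in>J. (1 - 1 / real p) * (1 / real p) ^ a (k, p))"
proof -
  have "prob {\<omega>\<in>space N. \<forall>j\<in>J. Gv \<omega> j = a j} = (\<Prod>j\<in>J. prob {\<omega>\<in>space N. Gv \<omega> j = a j})"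
    using prob_G_eq_prod[OF J, of "\<lambda>j. {a j}"] by simp
  also have "\<dots> = (\<Prod>(k, p)\<in>J. (1 - 1 / real p) * (1 / real p) ^ a (k, p))"
  proof (rule prod.cong)
    fix j assume "j \<in> J"
    moreover obtain k p where "j = (k, p)" by (cases j)
    ultimately show "prob {\<omega>\<in>space N. Gv \<omega> j = a j}
        = (case j of (k, p) \<Rightarrow> (1 - 1 / real p) * (1 / real p) ^ a (k, p))"
      using J geom unfolding geometric_family_def by auto
  qed simp
  finally show ?thesis .
qed

text \<open>The event about the family is the preimage of a finite-dimensional cylinder
  \<open>B\<close>, hence belongs to the sigma-algebra that is assumed independent of
  \<open>U\<close>.\<close>

lemma prob_U_G_eq:
  assumes J: "finite J" "J \<subseteq> idx"
  shows "prob {\<omega>\<in>space N. U \<omega> \<le> y \<and> (\<forall>j\<in>J. Gv \<omega> j = a j)}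
       = prob {\<omega>\<in>space N. U \<omega> \<le> y} * prob {\<omega>\<in>space N. \<forall>j\<in>J. Gv \<omega> j = a j}"
proof -
  let ?P = "Pi\<^sub>M idx (\<lambda>_. count_space (UNIV :: nat set))"
  let ?f = "\<lambda>\<omega>. \<lambda>(k, p)\<in>idx. G k p \<omega>"
  define B where "B = {g\<in>space ?P. \<forall>j\<in>J. g j = a j}"
  have B: "B \<in> sets ?P" unfolding B_def
  proof (intro sets.sets_Collect_finite_All J)
    fix j assume "j \<in> J"
    then have [measurable]: "(\<lambda>g. g j) \<in> ?P \<rightarrow>\<^sub>M count_space UNIV"
      using J measurable_component_singleton[of j idx "\<lambda>_. count_space UNIV"] by auto
    show "{g\<in>space ?P. g j = a j} \<in> sets ?P" by measurable
  qed
  have ind: "indep_set (sets (vimage_algebra (space N) U borel)) (sets (vimage_algebra (space N) ?f ?P))"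
    using U_indep unfolding indep_of_family_def Let_def .
  have "prob ((U -` {..y} \<inter> space N) \<inter> (?f -` B \<inter> space N))
      = prob (U -` {..y} \<inter> space N) * prob (?f -` B \<inter> space N)"
    by (rule indep_setD[OF ind in_vimage_algebra in_vimage_algebra[OF B]]) simp
  moreover have "U -` {..y} \<inter> space N = {\<omega>\<in>space N. U \<omega> \<le> y}" by auto
  moreover have "?f -` B \<inter> space N = {\<omega>\<in>space N. \<forall>j\<in>J. Gv \<omega> j = a j}"
  proof -
    have "?f \<omega> \<in> B \<longleftrightarrow> (\<forall>j\<in>J. Gv \<omega> j = a j)" for \<omega>
    proof -
      have "?f \<omega> \<in> space ?P" by (simp add: space_PiM)
      moreover have "?f \<omega> j = Gv \<omega> j" if "j \<in> J" for j using that J by (auto simp: restrict_def)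
      ultimately show ?thesis by (simp add: B_def)
    qed
    then show ?thesis by auto
  qed
  moreover have "{\<omega>\<in>space N. U \<omega> \<le> y} \<inter> {\<omega>\<in>space N. \<forall>j\<in>J. Gv \<omega> j = a j}
      = {\<omega>\<in>space N. U \<omega> \<le> y \<and> (\<forall>j\<in>J. Gv \<omega> j = a j)}" by auto
  ultimately show ?thesis by (simp only:)
qed

lemma AE_U: "AE \<omega> in N. 0 < U \<omega> \<and> U \<omega> \<le> 1"
proof -
  note p = prob_U_le_0_and_1[OF r2 l1 lr prob_space_axioms U_law]
  have "AE \<omega> in N. \<omega> \<notin> {\<omega>\<in>space N. U \<omega> \<le> 0}"
    using p(1) by (intro AE_not_in) (auto simp: null_sets_def emeasure_eq_measure)
  moreover have "AE \<omega> in N. \<omega> \<in> {\<omega>\<in>space N. U \<omega> \<le> 1}"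
    by (rule AE_prob_1[OF p(2)])
  ultimately show ?thesis by eventually_elim auto
qed

lemma restrict_eq_iff: "a \<in> extensional J \<Longrightarrow> restrict f J = a \<longleftrightarrow> (\<forall>j\<in>J. f j = a j)"
  by (auto simp: fun_eq_iff extensional_def restrict_def)

text \<open>On the event that the valuations equal \<open>a\<close>, the threshold is the constant
  \<open>t a\<close>. The sum over the finite set \<open>D\<close> then reduces a random threshold
  to the joint law.\<close>

lemma tendsto_threshold_finite:
  assumes J: "finite J" "J \<subseteq> {1..r} \<times> {p. prime p}" and D: "finite D" "D \<subseteq> extensional J"
    and t: "\<And>a. 0 \<le> t a"
  shows "(\<lambda>n. freq l r n (\<lambda>v. real (\<Prod>k=1..r. v k)
              \<le> t (restrict (\<lambda>(k, p). multiplicity p (v k)) J) * real n powr (real r / real l)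
            \<and> restrict (\<lambda>(k, p). multiplicity p (v k)) J \<in> D))
         \<longlonglongrightarrow> prob {\<omega>\<in>space N. U \<omega> \<le> t (restrict (Gv \<omega>) J) \<and> restrict (Gv \<omega>) J \<in> D}"
proof -
  have J': "J \<subseteq> idx" using J by auto
  note [measurable] = restrict_G_measurable[OF J(1) J']
  let ?m = "\<lambda>v. restrict (\<lambda>(k, p). multiplicity p (v k)) J"
  have 1: "freq l r n (\<lambda>v. real (\<Prod>k=1..r. v k) \<le> t (?m v) * real n powr (real r / real l) \<and> ?m v \<in> D)
      = (\<Sum>a\<in>D. freq l r n (\<lambda>v. real (\<Prod>k=1..r. v k) \<le> t a * real n powr (real r / real l) \<and> ?m v = a))" for n
    by (rule freq_sum[OF l1 lr D(1)])
  have "prob {\<omega>\<in>space N. U \<omega> \<le> t (restrict (Gv \<omega>) J) \<and> restrict (Gv \<omega>) J \<in> D}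
      = prob (\<Union>a\<in>D. {\<omega>\<in>space N. U \<omega> \<le> t a \<and> restrict (Gv \<omega>) J = a})"
    by (rule arg_cong[where f = prob]) auto
  also have "\<dots> = (\<Sum>a\<in>D. prob {\<omega>\<in>space N. U \<omega> \<le> t a \<and> restrict (Gv \<omega>) J = a})"
    by (intro finite_measure_finite_Union D) (auto simp: disjoint_family_on_def)
  finally have 2: "prob {\<omega>\<in>space N. U \<omega> \<le> t (restrict (Gv \<omega>) J) \<and> restrict (Gv \<omega>) J \<in> D}
      = (\<Sum>a\<in>D. prob {\<omega>\<in>space N. U \<omega> \<le> t a \<and> restrict (Gv \<omega>) J = a})" .
  show ?thesis unfolding 1 2
  proof (rule tendsto_sum)
    fix a assume "a \<in> D"
    then have a: "a \<in> extensional J" using D by auto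
    \<comment> \<open>The divisors are all taken to be 1, which makes the divisibility conditions
      vacuous and only prescribes the valuations.\<close>
    have e1: "freq l r n (\<lambda>v. real (\<Prod>k=1..r. v k) \<le> t a * real n powr (real r / real l) \<and> ?m v = a)
        = real (card {v\<in>hyp_set l r n. real (\<Prod>k=1..r. v k) \<le> t a * real n powr (real r / real l)
              \<and> (\<forall>k\<in>{1..r}. (1::nat) dvd v k) \<and> (\<forall>(k, p)\<in>J. multiplicity p (v k) = a (k, p))})
            / real (card (hyp_set l r n))" for n
    proof -
      have "?m v = a \<longleftrightarrow> (\<forall>k\<in>{1..r}. (1::nat) dvd v k) \<and> (\<forall>(k, p)\<in>J. multiplicity p (v k) = a (k, p))" for v
        unfolding restrict_eq_iff[OF a] by auto
      then show ?thesis unfolding freq_def by (simp only:)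
    qed
    have e2: "prob {\<omega>\<in>space N. U \<omega> \<le> t a \<and> restrict (Gv \<omega>) J = a}
        = prob {\<omega>\<in>space N. U \<omega> \<le> t a} / (\<Prod>k=1..r. real 1)
            * (\<Prod>(k, p)\<in>J. (1 - 1 / real p) * (1 / real p) ^ a (k, p))"
      unfolding restrict_eq_iff[OF a] prob_U_G_eq[OF J(1) J'] prob_G_eq[OF J(1) J'] by simp
    show "(\<lambda>n. freq l r n (\<lambda>v. real (\<Prod>k=1..r. v k) \<le> t a * real n powr (real r / real l) \<and> ?m v = a))
        \<longlonglongrightarrow> prob {\<omega>\<in>space N. U \<omega> \<le> t a \<and> restrict (Gv \<omega>) J = a}"
      unfolding e1 e2 using J t
      by (intro tendsto_multiplicity_law[OF r2 l1 lr prob_space_axioms U_law]) auto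
  qed
qed

lemma ex_finite_G_box:
  assumes J: "finite J" "J \<subseteq> idx" and e: "0 < e"
  shows "\<exists>A. 1 - e < prob {\<omega>\<in>space N. restrict (Gv \<omega>) J \<in> J \<rightarrow>\<^sub>E {..A}}"
proof -
  note [measurable] = restrict_G_measurable[OF J]
  let ?E = "\<lambda>A. {\<omega>\<in>space N. restrict (Gv \<omega>) J \<in> J \<rightarrow>\<^sub>E {..A}}"
  have "(\<lambda>A. prob (?E A)) \<longlonglongrightarrow> prob (\<Union>A. ?E A)"
  proof (rule finite_Lim_measure_incseq)
    show "incseq ?E" by (rule incseq_SucI) (auto simp: PiE_iff le_SucI)
    show "range ?E \<subseteq> events"
    proof clarify
      fix A show "?E A \<in> events" by (rule predE[OF pred_restrict_G[OF J]])
    qed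
  qed
  moreover have "(\<Union>A. ?E A) = space N"
  proof (intro subset_antisym subsetI)
    fix \<omega> assume w: "\<omega> \<in> space N"
    have "Gv \<omega> j \<le> (\<Sum>j\<in>J. Gv \<omega> j)" if "j \<in> J" for j
      using that J by (intro member_le_sum) auto
    then have "restrict (Gv \<omega>) J \<in> J \<rightarrow>\<^sub>E {..\<Sum>j\<in>J. Gv \<omega> j}" by (simp add: restrict_PiE_iff)
    then show "\<omega> \<in> (\<Union>A. ?E A)" using w by blast
  qed auto
  ultimately have "(\<lambda>A. prob (?E A)) \<longlonglongrightarrow> 1" by (simp add: prob_space)
  then have "\<forall>\<^sub>F A in sequentially. 1 - e < prob (?E A)"
    using e by (intro order_tendstoD(1)[of _ 1]) auto
  then show ?thesis by (auto simp: eventually_sequentially)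
qed

text \<open>A box \<open>D\<close> catches the limiting valuations up to probability
  \<open>e\<close>. By convergence on \<open>D\<close> itself it also catches the valuations of the
  lattice points, up to frequency \<open>e\<close> for large \<open>n\<close>.\<close>

lemma tendsto_threshold:
  assumes J: "finite J" "J \<subseteq> {1..r} \<times> {p. prime p}" and t: "\<And>a. 0 \<le> t a"
  shows "(\<lambda>n. freq l r n (\<lambda>v. real (\<Prod>k=1..r. v k)
              \<le> t (restrict (\<lambda>(k, p). multiplicity p (v k)) J) * real n powr (real r / real l)))
         \<longlonglongrightarrow> prob {\<omega>\<in>space N. U \<omega> \<le> t (restrict (Gv \<omega>) J)}"
proof (rule tendsto_if_uniformly_approx)
  fix e :: real assume e: "0 < e"
  have J': "J \<subseteq> idx" using J by auto
  note mG = restrict_G_measurable[OF J(1) J']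
  have mt [measurable]: "(\<lambda>\<omega>. t (restrict (Gv \<omega>) J)) \<in> borel_measurable N"
    by (rule measurable_compose[OF mG]) simp
  let ?m = "\<lambda>v. restrict (\<lambda>(k, p). multiplicity p (v k)) J"
  let ?s = "\<lambda>n. real n powr (real r / real l)"
  let ?pr = "\<lambda>v. real (\<Prod>k=1..r. v k)"
  obtain A where A: "1 - e < prob {\<omega>\<in>space N. restrict (Gv \<omega>) J \<in> J \<rightarrow>\<^sub>E {..A}}"
    using ex_finite_G_box[OF J(1) J' e] by blast
  define D where "D = (J \<rightarrow>\<^sub>E {..A})"
  have D: "finite D" "D \<subseteq> extensional J" using J by (auto simp: D_def PiE_iff intro!: finite_PiE)
  have [measurable]: "Measurable.pred N (\<lambda>\<omega>. restrict (Gv \<omega>) J \<in> D)"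
    by (rule pred_restrict_G[OF J(1) J'])
  let ?S = "\<lambda>n. freq l r n (\<lambda>v. ?pr v \<le> t (?m v) * ?s n \<and> ?m v \<in> D)"
  let ?s' = "prob {\<omega>\<in>space N. U \<omega> \<le> t (restrict (Gv \<omega>) J) \<and> restrict (Gv \<omega>) J \<in> D}"
  have S: "?S \<longlonglongrightarrow> ?s'" by (rule tendsto_threshold_finite[OF J D t])
  \<comment> \<open>With threshold 1 the condition on the product is always satisfied, and almost
    surely so is the one on \<open>U\<close>; what is left is the law of the valuations on
    \<open>D\<close>.\<close>
  have "(\<lambda>n. freq l r n (\<lambda>v. ?pr v \<le> 1 * ?s n \<and> ?m v \<in> D))
      \<longlonglongrightarrow> prob {\<omega>\<in>space N. U \<omega> \<le> 1 \<and> restrict (Gv \<omega>) J \<in> D}"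
    by (rule tendsto_threshold_finite[OF J D, of "\<lambda>_. 1"]) simp
  moreover have "freq l r n (\<lambda>v. ?pr v \<le> 1 * ?s n \<and> ?m v \<in> D) = freq l r n (\<lambda>v. ?m v \<in> D)" for n
    using hyp_set_prod_le[OF l1 lr] by (intro freq_cong) simp
  moreover have "prob {\<omega>\<in>space N. U \<omega> \<le> 1 \<and> restrict (Gv \<omega>) J \<in> D} = prob {\<omega>\<in>space N. restrict (Gv \<omega>) J \<in> D}"
  proof (rule finite_measure_eq_AE)
    show "AE \<omega> in N. \<omega> \<in> {\<omega>\<in>space N. U \<omega> \<le> 1 \<and> restrict (Gv \<omega>) J \<in> D}
        \<longleftrightarrow> \<omega> \<in> {\<omega>\<in>space N. restrict (Gv \<omega>) J \<in> D}"
      using AE_U by eventually_elim auto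
  qed measurable
  ultimately have lim: "(\<lambda>n. freq l r n (\<lambda>v. ?m v \<in> D)) \<longlonglongrightarrow> prob {\<omega>\<in>space N. restrict (Gv \<omega>) J \<in> D}"
    by (simp only:)
  have "\<forall>\<^sub>F n in sequentially. 1 - e < freq l r n (\<lambda>v. ?m v \<in> D)"
    using A by (intro order_tendstoD(1)[OF lim]) (simp add: D_def)
  then have ev: "\<forall>\<^sub>F n in sequentially. \<bar>freq l r n (\<lambda>v. ?pr v \<le> t (?m v) * ?s n) - ?S n\<bar> \<le> e"
    using eventually_ge_at_top[of "r choose l"]
  proof eventually_elim
    case (elim n)
    have "\<bar>freq l r n (\<lambda>v. ?pr v \<le> t (?m v) * ?s n) - ?S n\<bar> \<le> freq l r n (\<lambda>v. \<not> ?m v \<in> D)"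
      by (rule freq_diff_le[OF l1 lr]) auto
    also have "\<dots> = 1 - freq l r n (\<lambda>v. ?m v \<in> D)" by (rule freq_not[OF l1 lr elim(2)])
    finally show ?case using elim(1) by linarith
  qed
  have "\<bar>prob {\<omega>\<in>space N. U \<omega> \<le> t (restrict (Gv \<omega>) J)} - ?s'\<bar>
      \<le> prob (space N - {\<omega>\<in>space N. restrict (Gv \<omega>) J \<in> D})"
    by (rule prob_diff_le) auto
  also have "\<dots> = 1 - prob {\<omega>\<in>space N. restrict (Gv \<omega>) J \<in> D}" by (rule prob_compl) measurable
  also have "\<dots> \<le> e" using A by (simp add: D_def)
  finally have "\<bar>prob {\<omega>\<in>space N. U \<omega> \<le> t (restrict (Gv \<omega>) J)} - ?s'\<bar> \<le> e" .
  then show "\<exists>S s. S \<longlonglongrightarrow> s \<and> (\<forall>\<^sub>F n in sequentially. \<bar>freq l r n (\<lambda>v. ?pr v \<le> t (?m v) * ?s n) - S n\<bar> \<le> e)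
      \<and> \<bar>prob {\<omega>\<in>space N. U \<omega> \<le> t (restrict (Gv \<omega>) J)} - s\<bar> \<le> e"
    using S ev by blast
qed

section \<open>Collisions among the geometric variables\<close>

lemma prob_G_pos: "j \<in> idx \<Longrightarrow> prob {\<omega>\<in>space N. Gv \<omega> j \<in> {0<..}} = 1 / real (snd j)"
proof -
  assume j: "j \<in> idx"
  have "prob {\<omega>\<in>space N. Gv \<omega> j \<in> {0<..}} = prob (space N - {\<omega>\<in>space N. Gv \<omega> j = 0})"
    by (rule arg_cong[where f = prob]) auto
  also have "\<dots> = 1 - prob {\<omega>\<in>space N. Gv \<omega> j = 0}"
    using G_event[OF j, of "{0}"] by (intro prob_compl) simp
  also have "prob {\<omega>\<in>space N. Gv \<omega> j = 0} = 1 - 1 / real (snd j)"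
    using j geom unfolding geometric_family_def by (cases j) auto
  finally show ?thesis by simp
qed

lemma collides_measurable [measurable]:
  assumes "prime p" shows "Measurable.pred N (\<lambda>\<omega>. collides r (Gv \<omega>) p)"
proof -
  let ?J = "{1..r} \<times> {p}"
  have eq: "collides r (Gv \<omega>) p = collides r (restrict (Gv \<omega>) ?J) p" for \<omega>
    by (auto simp: collides_def)
  have "(\<lambda>\<omega>. restrict (Gv \<omega>) ?J) \<in> N \<rightarrow>\<^sub>M count_space UNIV"
    using assms by (intro restrict_G_measurable) auto
  then show ?thesis unfolding eq by (rule measurable_compose) simp
qed

text \<open>The counterpart of the counting bound: each variable is positive with probability
  \<open>1 / p\<close>, and two different coordinates are independent.\<close>

lemma prob_collides_le:
  assumes p: "prime p"
  shows "prob {\<omega>\<in>space N. collides r (Gv \<omega>) p} \<le> (real r)\<^sup>2 * (1 / (real p)\<^sup>2)"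
proof -
  let ?I = "{ij \<in> {1..r} \<times> {1..r}. fst ij \<noteq> snd ij}"
  let ?D = "\<lambda>ij. {\<omega>\<in>space N. \<forall>j\<in>{(fst ij, p), (snd ij, p)}. Gv \<omega> j \<in> {0<..}}"
  have D: "?D ij \<in> events" if "ij \<in> ?I" for ij
  proof (intro sets.sets_Collect_finite_All)
    fix j assume j: "j \<in> {(fst ij, p), (snd ij, p)}"
    then have "j \<in> idx" using that p by auto
    then show "{\<omega>\<in>space N. Gv \<omega> j \<in> {0<..}} \<in> events" by (rule G_event)
  qed simp
  have "prob {\<omega>\<in>space N. collides r (Gv \<omega>) p} \<le> prob (\<Union>ij\<in>?I. ?D ij)"
  proof (rule finite_measure_mono)
    show "{\<omega>\<in>space N. collides r (Gv \<omega>) p} \<subseteq> (\<Union>ij\<in>?I. ?D ij)"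
      by (force simp: collides_def)
    show "(\<Union>ij\<in>?I. ?D ij) \<in> events" using D by (intro sets.finite_UN) auto
  qed
  also have "\<dots> \<le> (\<Sum>ij\<in>?I. prob (?D ij))"
    using D by (intro finite_measure_subadditive_finite) auto
  also have "\<dots> = (\<Sum>ij\<in>?I. 1 / (real p)\<^sup>2)"
  proof (rule sum.cong)
    fix ij assume ij: "ij \<in> ?I"
    then have sub: "{(fst ij, p), (snd ij, p)} \<subseteq> idx" using p by auto
    have "prob (?D ij) = (\<Prod>j\<in>{(fst ij, p), (snd ij, p)}. prob {\<omega>\<in>space N. Gv \<omega> j \<in> {0<..}})"
      using sub by (intro prob_G_eq_prod) auto
    also have "\<dots> = (\<Prod>j\<in>{(fst ij, p), (snd ij, p)}. 1 / real p)"
      using sub prob_G_pos by (intro prod.cong) auto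
    also have "\<dots> = 1 / (real p)\<^sup>2" using ij by (auto simp: power2_eq_square)
    finally show "prob (?D ij) = 1 / (real p)\<^sup>2" .
  qed simp
  also have "\<dots> = real (card ?I) * (1 / (real p)\<^sup>2)" by simp
  also have "\<dots> \<le> (real r)\<^sup>2 * (1 / (real p)\<^sup>2)"
  proof (rule mult_right_mono)
    show "real (card ?I) \<le> (real r)\<^sup>2" by (rule card_offdiagonal_le)
  qed simp
  finally show ?thesis .
qed

lemma late_collision_measurable [measurable]:
  "{\<omega>\<in>space N. \<exists>p>K. prime p \<and> collides r (Gv \<omega>) p} \<in> events"
proof -
  have "{\<omega>\<in>space N. \<exists>p>K. prime p \<and> collides r (Gv \<omega>) p}
      = (\<Union>p\<in>{p. K < p \<and> prime p}. {\<omega>\<in>space N. collides r (Gv \<omega>) p})" by auto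
  also have "\<dots> \<in> events"
    using predE[OF collides_measurable] by (intro sets.countable_UN') auto
  finally show ?thesis .
qed

lemma prob_late_collision_le:
  assumes K: "1 \<le> K"
  shows "prob {\<omega>\<in>space N. \<exists>p>K. prime p \<and> collides r (Gv \<omega>) p} \<le> (real r)\<^sup>2 / real K"
proof -
  let ?C = "\<lambda>p. {\<omega>\<in>space N. collides r (Gv \<omega>) p}"
  let ?P = "\<lambda>m. {p\<in>{K<..m}. prime p}"
  let ?E = "\<lambda>m. \<Union>p\<in>?P m. ?C p"
  have ev: "?C p \<in> events" if "prime p" for p using collides_measurable[OF that] by (rule predE)
  have E: "?E m \<in> events" for m using ev by (intro sets.finite_UN) auto
  have le: "prob (?E m) \<le> (real r)\<^sup>2 / real K" for m
  proof -
    have "prob (?E m) \<le> (\<Sum>p\<in>?P m. prob (?C p))"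
      using ev by (intro finite_measure_subadditive_finite) auto
    also have "\<dots> \<le> (\<Sum>p\<in>?P m. (real r)\<^sup>2 * (1 / (real p)\<^sup>2))"
      by (intro sum_mono prob_collides_le) auto
    also have "\<dots> \<le> (\<Sum>p\<in>{K<..m}. (real r)\<^sup>2 * (1 / (real p)\<^sup>2))"
      by (intro sum_mono2) auto
    also have "\<dots> = (real r)\<^sup>2 * (\<Sum>p\<in>{K<..m}. 1 / (real p)\<^sup>2)" by (simp only: sum_distrib_left)
    also have "\<dots> \<le> (real r)\<^sup>2 * (1 / real K)"
      by (intro mult_left_mono sum_inverse_squares_le K) simp
    finally show ?thesis by simp
  qed
  have "(\<lambda>m. prob (?E m)) \<longlonglongrightarrow> prob (\<Union>m. ?E m)"
  proof (rule finite_Lim_measure_incseq)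
    show "range ?E \<subseteq> events" using E by auto
    show "incseq ?E" by (intro incseq_SucI UN_mono) auto
  qed
  moreover have "(\<Union>m. ?E m) = {\<omega>\<in>space N. \<exists>p>K. prime p \<and> collides r (Gv \<omega>) p}" by auto
  ultimately have "(\<lambda>m. prob (?E m)) \<longlonglongrightarrow> prob {\<omega>\<in>space N. \<exists>p>K. prime p \<and> collides r (Gv \<omega>) p}"
    by (simp only:)
  then show ?thesis by (rule LIMSEQ_le_const2) (use le in blast)
qed

text \<open>Collisions at arbitrarily large primes lie in every late collision event, and the
  probabilities of these tend to 0.\<close>

lemma AE_finite_collisions: "AE \<omega> in N. \<exists>K. \<not> (\<exists>p>K. prime p \<and> collides r (Gv \<omega>) p)"
proof -
  let ?L = "\<lambda>K. {\<omega>\<in>space N. \<exists>p>K. prime p \<and> collides r (Gv \<omega>) p}"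
  have "(\<Inter>K. ?L K) \<in> events" by (intro sets.countable_INT) auto
  have le: "prob (\<Inter>K. ?L K) \<le> (real r)\<^sup>2 / real (Suc K)" for K
  proof -
    have "prob (\<Inter>K. ?L K) \<le> prob (?L (Suc K))" by (rule finite_measure_mono) auto
    also have "\<dots> \<le> (real r)\<^sup>2 / real (Suc K)" by (rule prob_late_collision_le) simp
    finally show ?thesis .
  qed
  have "(\<lambda>K. (real r)\<^sup>2 / real (Suc K)) \<longlonglongrightarrow> 0"
    by (intro real_tendsto_divide_at_top[OF tendsto_const] filterlim_compose[OF filterlim_real_sequentially filterlim_Suc])
  then have "prob (\<Inter>K. ?L K) \<le> 0" by (rule LIMSEQ_le_const) (use le in blast)
  then have "prob (\<Inter>K. ?L K) = 0" by (simp add: measure_le_0_iff)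
  then have "AE \<omega> in N. \<omega> \<notin> (\<Inter>K. ?L K)"
    using \<open>(\<Inter>K. ?L K) \<in> events\<close> by (intro AE_not_in) (auto simp: null_sets_def emeasure_eq_measure)
  then show ?thesis by (rule AE_mp) (rule AE_I2, blast)
qed

lemma prime_prod_eq_upto:
  "\<not> (\<exists>p>K. prime p \<and> collides r (Gv \<omega>) p) \<Longrightarrow> prime_prod r G \<omega> = prime_prod_upto r K (Gv \<omega>)"
  unfolding prime_prod_eq_prodinf by (rule prodinf_prime_factor_at_eq[OF r1]) blast

lemma prime_prod_upto_restrict:
  "prime_prod_upto r K (restrict e ({1..r} \<times> {p. prime p \<and> p \<le> K})) = prime_prod_upto r K e"
  by (rule prime_prod_upto_cong) auto

lemma finite_primes_le: "finite ({1..r} \<times> {p::nat. prime p \<and> p \<le> K})"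
  by (rule finite_subset[of _ "{1..r} \<times> {..K}"]) auto

lemma prime_prod_upto_measurable: "(\<lambda>\<omega>. prime_prod_upto r K (Gv \<omega>)) \<in> borel_measurable N"
proof -
  have "(\<lambda>\<omega>. restrict (Gv \<omega>) ({1..r} \<times> {p. prime p \<and> p \<le> K})) \<in> N \<rightarrow>\<^sub>M count_space UNIV"
    by (intro restrict_G_measurable finite_primes_le) auto
  then have "(\<lambda>\<omega>. prime_prod_upto r K (restrict (Gv \<omega>) ({1..r} \<times> {p. prime p \<and> p \<le> K}))) \<in> borel_measurable N"
    by (rule measurable_compose) simp
  then show ?thesis by (simp only: prime_prod_upto_restrict)
qed

text \<open>\<open>N\<close> need not be complete, so null sets cannot be ignored. Off the
  exceptional event the partial products are eventually constant, so \<open>prime_prod\<close> is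
  their limit; on it, \<open>prime_prod\<close> is constant.\<close>

lemma prime_prod_measurable [measurable]: "prime_prod r G \<in> borel_measurable N"
proof -
  have eq: "prime_prod r G \<omega> = (if \<forall>K. \<exists>p>K. prime p \<and> collides r (Gv \<omega>) p then THE x. False
      else lim (\<lambda>K. prime_prod_upto r K (Gv \<omega>)))" for \<omega>
  proof (cases "\<forall>K. \<exists>p>K. prime p \<and> collides r (Gv \<omega>) p")
    case True
    then show ?thesis unfolding prime_prod_eq_prodinf
      using prodinf_prime_factor_at_junk[OF r1, of "Gv \<omega>"] by simp
  next
    case False
    then obtain K0 where K0: "\<not> (\<exists>p>K0. prime p \<and> collides r (Gv \<omega>) p)" by blast
    have "prime_prod_upto r K (Gv \<omega>) = prime_prod r G \<omega>" if "K0 \<le> K" for K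
      using K0 that by (intro prime_prod_eq_upto[symmetric]) (meson le_less_trans)
    then have "(\<lambda>K. prime_prod_upto r K (Gv \<omega>)) \<longlonglongrightarrow> prime_prod r G \<omega>"
      by (intro tendsto_eventually) (auto simp: eventually_sequentially)
    then have "lim (\<lambda>K. prime_prod_upto r K (Gv \<omega>)) = prime_prod r G \<omega>" by (rule limI)
    then show ?thesis using False by (simp only: if_False)
  qed
  note [measurable] = prime_prod_upto_measurable
  have [measurable]: "Measurable.pred N (\<lambda>\<omega>. \<forall>K. \<exists>p>K. prime p \<and> collides r (Gv \<omega>) p)"
  proof (rule pred_intros_countable(1))
    fix K show "Measurable.pred N (\<lambda>\<omega>. \<exists>p>K. prime p \<and> collides r (Gv \<omega>) p)"
      using late_collision_measurable by (simp add: pred_def)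
  qed
  show ?thesis unfolding eq[abs_def] by measurable
qed

lemma AE_prime_prod: "AE \<omega> in N. 0 < prime_prod r G \<omega> \<and> prime_prod r G \<omega> \<le> 1"
  using AE_finite_collisions
proof eventually_elim
  case (elim \<omega>)
  then obtain K where "prime_prod r G \<omega> = prime_prod_upto r K (Gv \<omega>)"
    using prime_prod_eq_upto by blast
  then show ?case using prime_prod_upto_bounds[OF r1, of K "Gv \<omega>"] by simp
qed

text \<open>Off the late collisions, truncation at \<open>K\<close> leaves the argument of
  \<open>phi\<close> unchanged rather than merely close. So the error is at most
  \<open>r^2 / K\<close> on both sides, for every \<open>n\<close> and without regard to the shape
  of \<open>phi\<close>.\<close>

lemma tendsto_lcm_threshold:
  fixes \<phi> :: "real \<Rightarrow> real"
  assumes \<phi>: "\<And>z. 0 \<le> \<phi> z" and \<phi>_meas [measurable]: "\<phi> \<in> borel_measurable borel"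
  shows "(\<lambda>n. freq l r n (\<lambda>v. real (\<Prod>k=1..r. v k)
            \<le> \<phi> (real (LCM k\<in>{1..r}. v k) / real (\<Prod>k=1..r. v k)) * real n powr (real r / real l)))
         \<longlonglongrightarrow> prob {\<omega>\<in>space N. U \<omega> \<le> \<phi> (prime_prod r G \<omega>)}"
proof (rule tendsto_if_uniformly_approx)
  fix e :: real assume e: "0 < e"
  obtain K where K: "1 \<le> K" "(real r)\<^sup>2 / real K \<le> e"
  proof -
    obtain K where "(real r)\<^sup>2 / e < real K" using reals_Archimedean2 by blast
    moreover have "0 \<le> (real r)\<^sup>2 / e" using e by simp
    ultimately have "0 < real K" "(real r)\<^sup>2 < e * real K" using e by (linarith, simp add: field_simps)
    then show ?thesis by (intro that[of K]) (auto simp: field_simps)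
  qed
  let ?J = "{1..r} \<times> {p. prime p \<and> p \<le> K}"
  let ?m = "\<lambda>v (k, p). multiplicity p (v k)"
  let ?s = "\<lambda>n. real n powr (real r / real l)"
  let ?pr = "\<lambda>v. real (\<Prod>k=1..r. v k)"
  let ?z = "\<lambda>v. real (LCM k\<in>{1..r}. v k) / real (\<Prod>k=1..r. v k)"
  let ?t = "\<lambda>a. \<phi> (prime_prod_upto r K a)"
  note [measurable] = prime_prod_upto_measurable
  have S: "(\<lambda>n. freq l r n (\<lambda>v. ?pr v \<le> ?t (?m v) * ?s n))
      \<longlonglongrightarrow> prob {\<omega>\<in>space N. U \<omega> \<le> ?t (Gv \<omega>)}"
    using tendsto_threshold[of ?J ?t, OF finite_primes_le _ \<phi>]
    unfolding prime_prod_upto_restrict by auto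
  have ev: "\<bar>freq l r n (\<lambda>v. ?pr v \<le> \<phi> (?z v) * ?s n) - freq l r n (\<lambda>v. ?pr v \<le> ?t (?m v) * ?s n)\<bar> \<le> e" for n
  proof -
    have "\<bar>freq l r n (\<lambda>v. ?pr v \<le> \<phi> (?z v) * ?s n) - freq l r n (\<lambda>v. ?pr v \<le> ?t (?m v) * ?s n)\<bar>
        \<le> freq l r n (\<lambda>v. \<exists>p>K. prime p \<and> collides r (?m v) p)"
    proof (rule freq_diff_le[OF l1 lr])
      fix v assume v: "v \<in> hyp_set l r n" and nc: "\<not> (\<exists>p>K. prime p \<and> collides r (?m v) p)"
      have "?z v = prime_prod_upto r K (?m v)"
        using nc hyp_set_ge1[OF v] by (intro Lcm_div_prod_eq r1) auto
      then show "?pr v \<le> \<phi> (?z v) * ?s n \<longleftrightarrow> ?pr v \<le> ?t (?m v) * ?s n" by (simp only:)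
    qed
    also have "\<dots> \<le> (real r)\<^sup>2 / real K"
    proof (cases "card (hyp_set l r n) = 0")
      case True
      then show ?thesis by (simp add: freq_def)
    next
      case False
      then show ?thesis unfolding freq_def using card_collisions_le[OF l1 lr K(1), of n]
        by (simp add: divide_le_eq)
    qed
    finally show ?thesis using K by simp
  qed
  have "\<bar>prob {\<omega>\<in>space N. U \<omega> \<le> \<phi> (prime_prod r G \<omega>)} - prob {\<omega>\<in>space N. U \<omega> \<le> ?t (Gv \<omega>)}\<bar>
      \<le> prob {\<omega>\<in>space N. \<exists>p>K. prime p \<and> collides r (Gv \<omega>) p}"
  proof (rule prob_diff_le)
    show "{\<omega>\<in>space N. U \<omega> \<le> \<phi> (prime_prod r G \<omega>)}
        \<subseteq> {\<omega>\<in>space N. U \<omega> \<le> ?t (Gv \<omega>)} \<union> {\<omega>\<in>space N. \<exists>p>K. prime p \<and> collides r (Gv \<omega>) p}"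
      using prime_prod_eq_upto[of K] by auto
    show "{\<omega>\<in>space N. U \<omega> \<le> ?t (Gv \<omega>)} \<subseteq> {\<omega>\<in>space N. U \<omega> \<le> \<phi> (prime_prod r G \<omega>)}
        \<union> {\<omega>\<in>space N. \<exists>p>K. prime p \<and> collides r (Gv \<omega>) p}"
      using prime_prod_eq_upto[of K] by auto
  qed measurable
  also have "\<dots> \<le> (real r)\<^sup>2 / real K" by (rule prob_late_collision_le[OF K(1)])
  finally have "\<bar>prob {\<omega>\<in>space N. U \<omega> \<le> \<phi> (prime_prod r G \<omega>)} - prob {\<omega>\<in>space N. U \<omega> \<le> ?t (Gv \<omega>)}\<bar> \<le> e"
    using K by simp
  then show "\<exists>S s. S \<longlonglongrightarrow> s \<and>
      (\<forall>\<^sub>F n in sequentially. \<bar>freq l r n (\<lambda>v. ?pr v \<le> \<phi> (?z v) * ?s n) - S n\<bar> \<le> e) \<and>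
      \<bar>prob {\<omega>\<in>space N. U \<omega> \<le> \<phi> (prime_prod r G \<omega>)} - s\<bar> \<le> e"
    using S ev by (intro exI conjI always_eventually allI) auto
qed

end

text \<open>Values in \<open>[0, 1]\<close> make every positive power agree almost everywhere with a
  bounded continuous function, so moments converge by weak convergence.\<close>

lemma conv_in_distr_and_moments:
  fixes X :: "nat \<Rightarrow> 'a \<Rightarrow> real" and Y :: "'b \<Rightarrow> real"
  assumes M: "\<And>n. n0 \<le> n \<Longrightarrow> prob_space (M n)"
    and X: "\<And>n. n0 \<le> n \<Longrightarrow> X n \<in> borel_measurable (M n)"
    and X01: "\<And>n. n0 \<le> n \<Longrightarrow> AE \<omega> in M n. 0 \<le> X n \<omega> \<and> X n \<omega> \<le> 1"
    and N: "prob_space N" and Y: "Y \<in> borel_measurable N"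
    and Y01: "AE \<omega> in N. 0 \<le> Y \<omega> \<and> Y \<omega> \<le> 1"
    and lim: "\<And>x. (\<lambda>n. measure (M n) {\<omega>\<in>space (M n). X n \<omega> \<le> x}) \<longlonglongrightarrow> measure N {\<omega>\<in>space N. Y \<omega> \<le> x}"
  shows "conv_in_distr M X N Y \<and> moments_converge M X N Y"
proof
  have cdf_N: "cdf (distr N borel Y) x = measure N {\<omega>\<in>space N. Y \<omega> \<le> x}" for x
    unfolding cdf_def using Y by (subst measure_distr) (auto intro!: arg_cong[where f = "measure N"])
  have cdf_M: "cdf (distr (M n) borel (X n)) x = measure (M n) {\<omega>\<in>space (M n). X n \<omega> \<le> x}" if "n0 \<le> n" for n x
    unfolding cdf_def using X[OF that]
    by (subst measure_distr) (auto intro!: arg_cong[where f = "measure (M n)"])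
  have cdf_lim: "(\<lambda>n. cdf (distr (M n) borel (X n)) x) \<longlonglongrightarrow> cdf (distr N borel Y) x" for x
    unfolding cdf_N
    by (rule Lim_transform_eventually[OF lim])
      (use cdf_M in \<open>auto simp: eventually_sequentially intro!: exI[of _ n0]\<close>)
  show "conv_in_distr M X N Y"
    unfolding conv_in_distr_def weak_conv_m_def weak_conv_def
    using X Y cdf_lim by (auto simp: eventually_sequentially)
  show "moments_converge M X N Y"
    unfolding moments_converge_def
  proof (intro allI impI)
    fix s :: real assume s: "0 < s"
    \<comment> \<open>Clamping makes the power bounded and continuous on the whole line; continuity
      at 0 uses \<open>s > 0\<close>.\<close>
    define f where "f t = (max 0 (min 1 t)) powr s" for t :: real
    have "continuous_on UNIV f"
      unfolding f_def using s by (intro continuous_on_powr' continuous_intros) auto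
    then have f: "\<And>t. isCont f t" by (simp add: continuous_on_eq_continuous_at)
    have f_meas [measurable]: "f \<in> borel_measurable borel"
      using \<open>continuous_on UNIV f\<close> by (rule borel_measurable_continuous_onI)
    have f_bound: "norm (f t) \<le> 1" for t
    proof -
      have "(max 0 (min 1 t)) powr s \<le> 1 powr s" using s by (intro powr_mono2) auto
      then show ?thesis by (simp add: f_def)
    qed
    have f_eq: "f t = t powr s" if "0 \<le> t \<and> t \<le> 1" for t using that by (simp add: f_def)
    have aux: "integrable Q (\<lambda>\<omega>. Z \<omega> powr s) \<and> (\<integral>\<omega>. Z \<omega> powr s \<partial>Q) = (\<integral>t. f t \<partial>distr Q borel Z)"
      if Q: "prob_space Q" and Z [measurable]: "Z \<in> borel_measurable Q"
        and Z01: "AE \<omega> in Q. 0 \<le> Z \<omega> \<and> Z \<omega> \<le> 1" for Q :: "'c measure" and Z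
    proof -
      interpret Q: prob_space Q by (rule Q)
      have ae: "AE \<omega> in Q. f (Z \<omega>) = Z \<omega> powr s" using Z01 by eventually_elim (rule f_eq)
      have i: "integrable Q (\<lambda>\<omega>. f (Z \<omega>))"
        using f_bound by (intro Q.integrable_const_bound[where B = 1]) auto
      have "integrable Q (\<lambda>\<omega>. Z \<omega> powr s)"
        using i ae by (subst integrable_cong_AE[OF _ _ ae, symmetric]) auto
      moreover have "(\<integral>\<omega>. Z \<omega> powr s \<partial>Q) = (\<integral>\<omega>. f (Z \<omega>) \<partial>Q)"
        using ae by (intro integral_cong_AE) auto
      ultimately show ?thesis by (simp add: integral_distr)
    qed
    \<comment> \<open>The sequence is shifted because below \<open>n0\<close> the \<open>M n\<close>
      are arbitrary measures, whereas the weak convergence theorem wants every term to be a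
      distribution.\<close>
    have "(\<lambda>n. \<integral>t. f t \<partial>distr (M (n + n0)) borel (X (n + n0))) \<longlonglongrightarrow> (\<integral>t. f t \<partial>distr N borel Y)"
    proof (rule weak_conv_imp_integral_bdd_continuous_conv[OF _ _ _ f f_bound])
      show "real_distribution (distr (M (n + n0)) borel (X (n + n0)))" for n
        using prob_space.real_distribution_distr[OF M X] by simp
      show "real_distribution (distr N borel Y)" by (rule prob_space.real_distribution_distr[OF N Y])
      show "weak_conv_m (\<lambda>n. distr (M (n + n0)) borel (X (n + n0))) (distr N borel Y)"
        unfolding weak_conv_m_def weak_conv_def using LIMSEQ_ignore_initial_segment[OF cdf_lim] by blast
    qed
    then have "(\<lambda>n. \<integral>\<omega>. X (n + n0) \<omega> powr s \<partial>M (n + n0)) \<longlonglongrightarrow> (\<integral>\<omega>. Y \<omega> powr s \<partial>N)"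
      using aux[OF M X X01] aux[OF N Y Y01] by simp
    then have "(\<lambda>n. \<integral>\<omega>. X n \<omega> powr s \<partial>M n) \<longlonglongrightarrow> (\<integral>\<omega>. Y \<omega> powr s \<partial>N)"
      by (rule LIMSEQ_offset)
    then show "(\<forall>\<^sub>F n in sequentially. integrable (M n) (\<lambda>\<omega>. X n \<omega> powr s)) \<and>
        integrable N (\<lambda>\<omega>. Y \<omega> powr s) \<and>
        (\<lambda>n. \<integral>\<omega>. X n \<omega> powr s \<partial>M n) \<longlonglongrightarrow> (\<integral>\<omega>. Y \<omega> powr s \<partial>N)"
      using aux[OF M X X01] aux[OF N Y Y01] by (auto simp: eventually_sequentially)
  qed
qed

section \<open>From counting to random vectors\<close>

lemma uniform_on_hyp_measurable:
  assumes "uniform_on_hyp l r n M V"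
  shows "(\<lambda>\<omega>. \<lambda>k\<in>{1..r}. V k \<omega>) \<in> M \<rightarrow>\<^sub>M count_space UNIV"
  using assms unfolding uniform_on_hyp_def by (intro measurable_restrict_count_space) auto

lemma measure_uniform_on_hyp:
  assumes l: "1 \<le> l" "l \<le> r" "r choose l \<le> n" and V: "uniform_on_hyp l r n M V"
  shows "measure M {\<omega>\<in>space M. P (\<lambda>k\<in>{1..r}. V k \<omega>)} = freq l r n P"
proof -
  let ?T = "\<lambda>\<omega>. \<lambda>k\<in>{1..r}. V k \<omega>"
  have "measure M {\<omega>\<in>space M. P (?T \<omega>)} = measure (distr M (count_space UNIV) ?T) {v. P v}"
    using uniform_on_hyp_measurable[OF V]
    by (subst measure_distr) (auto intro!: arg_cong[where f = "measure M"])
  also have "distr M (count_space UNIV) ?T = measure_pmf (pmf_of_set (hyp_set l r n))"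
    using V by (simp add: uniform_on_hyp_def)
  also have "measure (measure_pmf (pmf_of_set (hyp_set l r n))) {v. P v}
      = real (card (hyp_set l r n \<inter> {v. P v})) / real (card (hyp_set l r n))"
    using finite_hyp_set[OF l(1,2)] hyp_set_nonempty[OF l(3)] by (intro measure_pmf_of_set) auto
  also have "hyp_set l r n \<inter> {v. P v} = {v\<in>hyp_set l r n. P v}" by auto
  finally show ?thesis unfolding freq_def .
qed

lemma AE_uniform_on_hyp:
  assumes l: "1 \<le> l" "l \<le> r" "r choose l \<le> n" and V: "uniform_on_hyp l r n M V" and M: "prob_space M"
  shows "AE \<omega> in M. (\<lambda>k\<in>{1..r}. V k \<omega>) \<in> hyp_set l r n"
proof -
  interpret prob_space M by (rule M)
  have "measure M {\<omega>\<in>space M. (\<lambda>k\<in>{1..r}. V k \<omega>) \<in> hyp_set l r n} = 1"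
    using measure_uniform_on_hyp[OF l V, of "\<lambda>v. v \<in> hyp_set l r n"] card_hyp_set_pos[OF l]
    by (simp add: freq_def)
  from AE_prob_1[OF this] show ?thesis by eventually_elim auto
qed

lemma Lcm_div_prod_bounds:
  fixes v :: "nat \<Rightarrow> nat"
  assumes v: "v \<in> hyp_set l r n"
  shows "0 < real (LCM k\<in>{1..r}. v k) / real (\<Prod>k=1..r. v k)"
    and "real (LCM k\<in>{1..r}. v k) / real (\<Prod>k=1..r. v k) \<le> 1"
proof -
  have v0: "v k \<noteq> 0" if "k \<in> {1..r}" for k using hyp_set_ge1[OF v that] by simp
  have p: "0 < (\<Prod>k=1..r. v k)" by (rule hyp_set_prod_pos[OF v])
  have "0 \<notin> v ` {1..r}" using v0 by (metis imageE)
  then have "(LCM k\<in>{1..r}. v k) \<noteq> 0" by (simp add: Lcm_0_iff)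
  then have "0 < (LCM k\<in>{1..r}. v k)" by (simp only: neq0_conv)
  then show "0 < real (LCM k\<in>{1..r}. v k) / real (\<Prod>k=1..r. v k)" using p
    by (intro divide_pos_pos) (simp_all only: of_nat_0_less_iff)
  have "(LCM k\<in>{1..r}. v k) dvd (\<Prod>k=1..r. v k)"
    by (rule Lcm_least) (auto intro: dvd_prodI)
  then have "(LCM k\<in>{1..r}. v k) \<le> (\<Prod>k=1..r. v k)" using p by (rule dvd_imp_le)
  then show "real (LCM k\<in>{1..r}. v k) / real (\<Prod>k=1..r. v k) \<le> 1"
    using p by (simp only: divide_le_eq_1 of_nat_le_iff of_nat_0_less_iff simp_thms)
qed

theorem theorem3p7:
  fixes l r :: nat
    and M :: "nat \<Rightarrow> 'a measure" and V :: "nat \<Rightarrow> nat \<Rightarrow> 'a \<Rightarrow> nat"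
    and N :: "'b measure" and G :: "nat \<Rightarrow> nat \<Rightarrow> 'b \<Rightarrow> nat" and U :: "'b \<Rightarrow> real"
  assumes "r \<ge> 2" and "1 \<le> l" and "l \<le> r"
    and "\<And>n. n \<ge> r choose l \<Longrightarrow> prob_space (M n)"
    and "\<And>n. n \<ge> r choose l \<Longrightarrow> uniform_on_hyp l r n (M n) (V n)"
    and "prob_space N"
    and "geometric_family N G"
    and "has_U_law l r N U"
    and "indep_of_family N U G"
  shows "conv_in_distr M
           (\<lambda>n \<omega>. real (LCM k\<in>{1..r}. V n k \<omega>) / real (\<Prod>k=1..r. V n k \<omega>))
           N (prime_prod r G)
       \<and> conv_in_distr M
           (\<lambda>n \<omega>. real (LCM k\<in>{1..r}. V n k \<omega>) / real n powr (real r / real l))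
           N (\<lambda>\<omega>. U \<omega> * prime_prod r G \<omega>)
       \<and> moments_converge M
           (\<lambda>n \<omega>. real (LCM k\<in>{1..r}. V n k \<omega>) / real (\<Prod>k=1..r. V n k \<omega>))
           N (prime_prod r G)
       \<and> moments_converge M
           (\<lambda>n \<omega>. real (LCM k\<in>{1..r}. V n k \<omega>) / real n powr (real r / real l))
           N (\<lambda>\<omega>. U \<omega> * prime_prod r G \<omega>)"
proof -
  interpret geometric_limit N l r G U
    using assms by (intro geometric_limit.intro geometric_limit_axioms.intro)
  let ?T = "\<lambda>n \<omega>. \<lambda>k\<in>{1..r}. V n k \<omega>"
  let ?s = "\<lambda>n. real n powr (real r / real l)"
  define \<xi>1 :: "(nat \<Rightarrow> nat) \<Rightarrow> real" where "\<xi>1 v = real (LCM k\<in>{1..r}. v k) / real (\<Prod>k=1..r. v k)" for v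
  define \<xi>2 :: "nat \<Rightarrow> (nat \<Rightarrow> nat) \<Rightarrow> real" where "\<xi>2 n v = real (LCM k\<in>{1..r}. v k) / ?s n" for n v
  let ?X1 = "\<lambda>n \<omega>. real (LCM k\<in>{1..r}. V n k \<omega>) / real (\<Prod>k=1..r. V n k \<omega>)"
  let ?X2 = "\<lambda>n \<omega>. real (LCM k\<in>{1..r}. V n k \<omega>) / ?s n"
  have lcm_T: "(LCM k\<in>{1..r}. ?T n \<omega> k) = (LCM k\<in>{1..r}. V n k \<omega>)" for n \<omega>
    by (rule arg_cong[where f = Lcm], rule image_cong) auto
  have prod_T: "(\<Prod>k=1..r. ?T n \<omega> k) = (\<Prod>k=1..r. V n k \<omega>)" for n \<omega>
    by (rule prod.cong) auto
  have X1: "?X1 n \<omega> = \<xi>1 (?T n \<omega>)" for n \<omega> unfolding \<xi>1_def lcm_T prod_T ..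
  have X2: "?X2 n \<omega> = \<xi>2 n (?T n \<omega>)" for n \<omega> unfolding \<xi>2_def lcm_T ..
  have pr: "0 < real (\<Prod>k=1..r. v k)" "real (\<Prod>k=1..r. v k) \<le> ?s n" if "v \<in> hyp_set l r n" for n v
    using hyp_set_prod_pos[OF that] hyp_set_prod_le[OF l1 lr that] by (simp_all only: of_nat_0_less_iff)
  have \<xi>2_eq: "\<xi>2 n v = \<xi>1 v * (real (\<Prod>k=1..r. v k) / ?s n)" if "v \<in> hyp_set l r n" for n v
  proof -
    have "real (\<Prod>k=1..r. v k) \<noteq> 0" using pr(1)[OF that] by linarith
    moreover have "a / s = a / q * (q / s)" if "q \<noteq> 0" for a s q :: real using that by simp
    ultimately show ?thesis unfolding \<xi>1_def \<xi>2_def by blast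
  qed
  have b1: "0 < \<xi>1 v" "\<xi>1 v \<le> 1" if "v \<in> hyp_set l r n" for n v
    unfolding \<xi>1_def by (rule Lcm_div_prod_bounds[OF that])+

  have b2: "0 \<le> \<xi>2 n v" "\<xi>2 n v \<le> 1" if v: "v \<in> hyp_set l r n" for n v
  proof -
    have "0 \<le> real (\<Prod>k=1..r. v k) / ?s n" "real (\<Prod>k=1..r. v k) / ?s n \<le> 1"
      using pr[OF v] by (auto simp: divide_le_eq_1)
    then show "0 \<le> \<xi>2 n v" "\<xi>2 n v \<le> 1"
      unfolding \<xi>2_eq[OF v] using b1[OF v]
      by (intro mult_nonneg_nonneg mult_le_one; linarith)+
  qed
  have lim1: "(\<lambda>n. freq l r n (\<lambda>v. \<xi>1 v \<le> x)) \<longlonglongrightarrow> prob {\<omega>\<in>space N. prime_prod r G \<omega> \<le> x}" for x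
  proof -
    \<comment> \<open>The product lies strictly above 0 and at most at \<open>?s n\<close>, so
      threshold factor 1 always lets it pass and 0 never does. In the limit \<open>U\<close> behaves
      alike, being almost surely positive and at most 1.\<close>
    define \<phi> where "\<phi> z = (if z \<le> x then 1 else 0 :: real)" for z
    have "freq l r n (\<lambda>v. real (\<Prod>k=1..r. v k) \<le> \<phi> (\<xi>1 v) * ?s n) = freq l r n (\<lambda>v. \<xi>1 v \<le> x)" for n
    proof (rule freq_cong)
      fix v assume v: "v \<in> hyp_set l r n"
      have "q \<le> (if P then 1 else 0) * s \<longleftrightarrow> P" if "0 < q" "q \<le> s" for q s :: real and P
        using that by auto
      then show "real (\<Prod>k=1..r. v k) \<le> \<phi> (\<xi>1 v) * ?s n \<longleftrightarrow> \<xi>1 v \<le> x"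
        unfolding \<phi>_def using pr[OF v] by blast
    qed
    moreover have "prob {\<omega>\<in>space N. U \<omega> \<le> \<phi> (prime_prod r G \<omega>)} = prob {\<omega>\<in>space N. prime_prod r G \<omega> \<le> x}"
    proof (rule finite_measure_eq_AE)
      show "AE \<omega> in N. \<omega> \<in> {\<omega>\<in>space N. U \<omega> \<le> \<phi> (prime_prod r G \<omega>)} \<longleftrightarrow> \<omega> \<in> {\<omega>\<in>space N. prime_prod r G \<omega> \<le> x}"
        using AE_U by eventually_elim (auto simp: \<phi>_def split: if_splits)
    qed (unfold \<phi>_def, measurable)
    moreover have "\<phi> \<in> borel_measurable borel" unfolding \<phi>_def by measurable
    moreover have "0 \<le> \<phi> z" for z by (simp add: \<phi>_def)
    ultimately show ?thesis
      using tendsto_lcm_threshold[of \<phi>] unfolding \<xi>1_def[symmetric] by (simp only:)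
  qed
  have lim2: "(\<lambda>n. freq l r n (\<lambda>v. \<xi>2 n v \<le> x)) \<longlonglongrightarrow> prob {\<omega>\<in>space N. U \<omega> * prime_prod r G \<omega> \<le> x}" for x
  proof -
    \<comment> \<open>Dividing by the ratio turns the bound on lcm into one on the product. The
      maximum makes \<open>\<phi>\<close> nonnegative and changes no event, since the product is
      positive and \<open>U\<close> almost surely is.\<close>
    define \<phi> where "\<phi> z = max 0 (x / z)" for z
    have "freq l r n (\<lambda>v. real (\<Prod>k=1..r. v k) \<le> \<phi> (\<xi>1 v) * ?s n) = freq l r n (\<lambda>v. \<xi>2 n v \<le> x)" for n
    proof (rule freq_cong)
      fix v assume v: "v \<in> hyp_set l r n"
      define q where "q = real (\<Prod>k=1..r. v k)"
      have q: "0 < q" "0 < ?s n" using pr[OF v] unfolding q_def by linarith+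
      define z where "z = \<xi>1 v"
      have z: "0 < z" using b1[OF v] by (simp add: z_def)
      have "q \<le> \<phi> z * ?s n \<longleftrightarrow> q / ?s n \<le> max 0 (x / z)"
        using q by (simp add: \<phi>_def divide_le_eq)
      also have "\<dots> \<longleftrightarrow> q / ?s n \<le> x / z" using divide_pos_pos[OF q] by (auto simp: le_max_iff_disj)
      also have "\<dots> \<longleftrightarrow> z * (q / ?s n) \<le> x" using z by (simp add: le_divide_eq mult.commute)
      finally show "real (\<Prod>k=1..r. v k) \<le> \<phi> (\<xi>1 v) * ?s n \<longleftrightarrow> \<xi>2 n v \<le> x"
        unfolding \<xi>2_eq[OF v] q_def z_def .
    qed
    moreover have "prob {\<omega>\<in>space N. U \<omega> \<le> \<phi> (prime_prod r G \<omega>)} = prob {\<omega>\<in>space N. U \<omega> * prime_prod r G \<omega> \<le> x}"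
    proof (rule finite_measure_eq_AE)
      show "AE \<omega> in N. \<omega> \<in> {\<omega>\<in>space N. U \<omega> \<le> \<phi> (prime_prod r G \<omega>)}
          \<longleftrightarrow> \<omega> \<in> {\<omega>\<in>space N. U \<omega> * prime_prod r G \<omega> \<le> x}"
        using AE_U AE_prime_prod
      proof eventually_elim
        case (elim \<omega>)
        then have "U \<omega> \<le> \<phi> (prime_prod r G \<omega>) \<longleftrightarrow> U \<omega> \<le> x / prime_prod r G \<omega>"
          by (auto simp: \<phi>_def le_max_iff_disj)
        also have "\<dots> \<longleftrightarrow> U \<omega> * prime_prod r G \<omega> \<le> x" using elim by (simp add: le_divide_eq)
        finally show ?case by auto
      qed
    qed (unfold \<phi>_def, measurable)
    moreover have "\<phi> \<in> borel_measurable borel" unfolding \<phi>_def by measurable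
    moreover have "0 \<le> \<phi> z" for z by (simp add: \<phi>_def)
    ultimately show ?thesis
      using tendsto_lcm_threshold[of \<phi>] unfolding \<xi>1_def[symmetric] by (simp only:)
  qed
  have conv: "conv_in_distr M (\<lambda>n \<omega>. \<xi> n (?T n \<omega>)) N Y \<and> moments_converge M (\<lambda>n \<omega>. \<xi> n (?T n \<omega>)) N Y"
    if \<xi>01: "\<And>n v. v \<in> hyp_set l r n \<Longrightarrow> 0 \<le> \<xi> n v \<and> \<xi> n v \<le> 1"
      and Y: "Y \<in> borel_measurable N" "AE \<omega> in N. 0 \<le> Y \<omega> \<and> Y \<omega> \<le> 1"
      and lim: "\<And>x. (\<lambda>n. freq l r n (\<lambda>v. \<xi> n v \<le> x)) \<longlonglongrightarrow> prob {\<omega>\<in>space N. Y \<omega> \<le> x}"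
    for \<xi> :: "nat \<Rightarrow> (nat \<Rightarrow> nat) \<Rightarrow> real" and Y
  proof (rule conv_in_distr_and_moments[where ?n0.0 = "r choose l"])
    show "(\<lambda>\<omega>. \<xi> n (?T n \<omega>)) \<in> borel_measurable (M n)" if "r choose l \<le> n" for n
      by (rule measurable_compose[OF uniform_on_hyp_measurable[OF assms(5)[OF that]]]) simp
    show "AE \<omega> in M n. 0 \<le> \<xi> n (?T n \<omega>) \<and> \<xi> n (?T n \<omega>) \<le> 1" if "r choose l \<le> n" for n
      using AE_uniform_on_hyp[OF l1 lr that assms(5)[OF that] assms(4)[OF that]]
      by eventually_elim (rule \<xi>01)
    show "(\<lambda>n. measure (M n) {\<omega>\<in>space (M n). \<xi> n (?T n \<omega>) \<le> x}) \<longlonglongrightarrow> measure N {\<omega>\<in>space N. Y \<omega> \<le> x}" for x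
    proof (rule Lim_transform_eventually[OF lim])
      show "\<forall>\<^sub>F n in sequentially. freq l r n (\<lambda>v. \<xi> n v \<le> x) = measure (M n) {\<omega>\<in>space (M n). \<xi> n (?T n \<omega>) \<le> x}"
        using eventually_ge_at_top[of "r choose l"]
      proof eventually_elim
        case (elim n)
        show ?case by (rule measure_uniform_on_hyp[OF l1 lr elim assms(5)[OF elim], symmetric])
      qed
    qed
  qed (use assms Y in auto)
  have "conv_in_distr M ?X1 N (prime_prod r G) \<and> moments_converge M ?X1 N (prime_prod r G)"
    unfolding X1
  proof (rule conv[of "\<lambda>_. \<xi>1" "prime_prod r G", OF _ prime_prod_measurable _ lim1])
    show "0 \<le> \<xi>1 v \<and> \<xi>1 v \<le> 1" if "v \<in> hyp_set l r n" for n v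
      using b1[OF that] by simp
    show "AE \<omega> in N. 0 \<le> prime_prod r G \<omega> \<and> prime_prod r G \<omega> \<le> 1"
      using AE_prime_prod by eventually_elim auto
  qed
  moreover have "conv_in_distr M ?X2 N (\<lambda>\<omega>. U \<omega> * prime_prod r G \<omega>)
      \<and> moments_converge M ?X2 N (\<lambda>\<omega>. U \<omega> * prime_prod r G \<omega>)"
    unfolding X2
  proof (rule conv[OF _ _ _ lim2])
    show "0 \<le> \<xi>2 n v \<and> \<xi>2 n v \<le> 1" if "v \<in> hyp_set l r n" for n v
      using b2[OF that] by simp
    show "AE \<omega> in N. 0 \<le> U \<omega> * prime_prod r G \<omega> \<and> U \<omega> * prime_prod r G \<omega> \<le> 1"
      using AE_U AE_prime_prod by eventually_elim (auto intro!: mult_le_one mult_nonneg_nonneg)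
  qed measurable
  ultimately show ?thesis by blast
qed

end
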